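(* Let $\Sigma=\{S_i\}_i$ be a fan in $\mathbb{Z}[x]^n$. Then the abstract $P[\sigma]$-variety $X_\Sigma$ constructed from $\Sigma$ by gluing the affine toric $P[\sigma]$-varieties $X_i=\mathrm{Spec}^{P[\sigma]}(k[S_i])$ is a toric $P[\sigma]$-variety.
   Context: $k$ is a $\sigma$-field (field with ring endomorphism $\sigma$) of characteristic $0$. $P[x]=\{f\in\mathbb{Z}[x]: f=0$ or the leading coefficient of $f$ is positive$\}$, $P[x]^*=P[x]\setminus\{0\}$. For $a\neq0$ in a $\sigma$-field, $g=\sum c_ix^i\in\mathbb{Z}[x]$: $a^g=\prod_i\sigma^i(a)^{c_i}$; $0^g=0$ for $g\in P[x]^*$; $a^0=1$. A $P[x]$-semimodule is a subset $S\subseteq\mathbb{Z}[x]^n$ closed under addition and multiplication by elements of $P[x]$; it is affine if $S=\{\sum g_i\mathbf u_i: g_i\in P[x]\}$ for some finite subset $\{\mathbf u_1,\dots,\mathbf u_m\}$. $S^{md}=\{\mathbf u-\mathbf v:\mathbf u,\mathbf v\in S\}$. $k[S]=\bigoplus_{\mathbf u\in S}k\chi^{\mathbf u}$ with $\chi^{\mathbf u}\chi^{\mathbf v}=\chi^{\mathbf u+\mathbf v}$, $\sigma(\chi^{\mathbf u})=\chi^{x\mathbf u}$. $X=\mathrm{Spec}^{P[\sigma]}(k[S])$ is the functor sending a $\sigma$-field extension $K$ of $k$ to the set of $k$-$\sigma$-algebra homomorphisms $k[S]\to K$, identified with the maps $\varphi:S\to K$ with $\varphi(\sum g_i\mathbf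 v_i)=\prod\varphi(\mathbf v_i)^{g_i}$ ($g_i\in P[x]$). Its topological space is the set of $P[\sigma]$-prime ideals of $k[S]$, with closed sets $\{\mathfrak p\supseteq F\}$, $F\subseteq k[S]$. Here a prime ideal $\mathfrak p$ is $P[\sigma]$-prime if $\sigma(\mathfrak p)\subseteq\mathfrak p$, $\prod_i\sigma^i(a)^{c_i}\in\mathfrak p$ (with $c_i\in\mathbb N$ not all $0$) implies $a\in\mathfrak p$, and $\chi^{\mathbf u}f\in\mathfrak p$ implies $\chi^{g\mathbf u}f\in\mathfrak p$ for all $g\in P[x]^*$. For $\mathbf u\in S$, $X_{\chi^{\mathbf u}}=\mathrm{Spec}^{P[\sigma]}(k[S+\mathbb{Z}[x](-\mathbf u)])$ is the open subset of $X$ where $\chi^{\mathbf u}\neq0$. For a $\mathbb{Z}[x]$-lattice $M$ (a $\mathbb{Z}[x]$-module embeddable in some $\mathbb{Z}[x]^n$), $\mathrm{Spec}^{P[\sigma]}(k[M])$ is a $\sigma$-torus, with $K$-points $\mathrm{Hom}_{\mathbb{Z}[x]}(M,K^* )$ ($\mathbb{Z}[x]$ acting on $K^*$ by $a\mapsto a^g$), a group under pointwise multiplication. A fan $\Sigma$ is a finite collection $\{S_i\}_i$ of affine $P[x]$-semimodules in $\mathbb{Z}[x]^n$ such that: (a) there is a $\mathbb{Z}[x]$-lattice $M$ with $S_i^{md}=M$ for all $i$ (write $\Sigma^{md}=M$); (b) for all $i\neq j$ there is $\mathbf u\in S_i$ with $-\mathbf u\in S_j$ and $S_i+\mathbb{Z}[x](-\mathbf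 u)=S_j+\mathbb{Z}[x](\mathbf u)$; (c) for pairwise distinct $i,j,k$, and $\mathbf u\in S_i,\mathbf v\in S_j,\mathbf w\in S_k$ as given by (b), i.e. with $S_i+\mathbb{Z}[x](-\mathbf u)=S_j+\mathbb{Z}[x](\mathbf u)$, $S_j+\mathbb{Z}[x](-\mathbf v)=S_k+\mathbb{Z}[x](\mathbf v)$, $S_k+\mathbb{Z}[x](-\mathbf w)=S_i+\mathbb{Z}[x](\mathbf w)$, one has $S_i+\mathbb{Z}[x](-\mathbf u)+\mathbb{Z}[x](\mathbf w)=S_j+\mathbb{Z}[x](\mathbf u)+\mathbb{Z}[x](-\mathbf v)=S_k+\mathbb{Z}[x](\mathbf v)+\mathbb{Z}[x](-\mathbf w)$. An abstract $P[\sigma]$-variety is obtained by gluing finitely many affine $P[\sigma]$-varieties $V_\alpha$ along open subsets $V_{\beta\alpha}\subseteq V_\alpha$ by isomorphisms $g_{\beta\alpha}:V_{\beta\alpha}\simeq V_{\alpha\beta}$ with $g_{\alpha\beta}=g_{\beta\alpha}^{-1}$, $g_{\beta\alpha}(V_{\beta\alpha}\cap V_{\gamma\alpha})=V_{\alpha\beta}\cap V_{\gamma\beta}$ and $g_{\gamma\beta}\circ g_{\beta\alpha}=g_{\gamma\alpha}$ on $V_{\beta\alpha}\cap V_{\gamma\alpha}$; its open sets are the subsets restricting to open subsets of each $V_\alpha$, its closed sets are its subvarieties, and it is irreducible if it is not the union of two proper subvarieties. $X_\Sigma$ is obtained by gluing the $X_i$: for $i\ne j$ and $\mathbf u$ as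 in (b), the open subsets $(X_i)_{\chi^{\mathbf u}}\subseteq X_i$ and $(X_j)_{\chi^{-\mathbf u}}\subseteq X_j$ are identified via the identity of $k[S_i+\mathbb{Z}[x](-\mathbf u)]=k[S_j+\mathbb{Z}[x](\mathbf u)]$. An (abstract) toric $P[\sigma]$-variety is an irreducible abstract $P[\sigma]$-variety $X$ containing a $\sigma$-torus $T$ as an open subset such that the action of $T$ on itself extends to a $\sigma$-algebraic group action of $T$ on $X$ (an action given by a morphism $T\times X\to X$). *)

theory Defs
  imports
    "HOL-Library.Poly_Mapping"
    "HOL-Library.FuncSet"
    "HOL-Computational_Algebra.Polynomial"
    "HOL-Algebra.Ideal"
    "HOL-Algebra.RingHom"
begin

section \<open>Exponents and \<open>P[x]\<close>-semimodules\<close>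

text \<open>Exponent vectors are finitely supported families of elements of \<open>\<int>[x]\<close>; \<open>\<int>[x]\<^sup>n\<close> is the set of
  those supported in \<open>{..<n}\<close>. Other index types occur only for products, where the index type
  is a sum.\<close>

type_synonym 'b expo = "'b \<Rightarrow>\<^sub>0 int poly"

definition Zxn :: "nat \<Rightarrow> nat expo set" where
  "Zxn n = {u. Poly_Mapping.keys u \<subseteq> {..<n}}"

definition smul :: "int poly \<Rightarrow> 'b expo \<Rightarrow> 'b expo" (infixr \<open>\<odot>\<close> 75) where
  "g \<odot> u = Poly_Mapping.map (\<lambda>c. g * c) u"

definition Px :: "int poly set" where
  "Px = {g. g = 0 \<or> lead_coeff g > 0}"

definition semimodule :: "'b expo set \<Rightarrow> bool" where
  "semimodule S \<longleftrightarrow> (\<forall>u\<in>S. \<forall>v\<in>S. u + v \<in> S) \<and> (\<forall>g\<in>Px. \<forall>u\<in>S. g \<odot> u \<in> S)"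

definition affine_semimodule :: "'b expo set \<Rightarrow> bool" where
  "affine_semimodule S \<longleftrightarrow> semimodule S \<and>
     (\<exists>B. finite B \<and> S = {\<Sum>u\<in>B. g u \<odot> u | g. \<forall>u\<in>B. g u \<in> Px})"

definition semi_md :: "'b expo set \<Rightarrow> 'b expo set" where
  "semi_md S = {u - v | u v. u \<in> S \<and> v \<in> S}"

text \<open>A \<open>\<int>[x]\<close>-lattice, realised as a submodule of some \<open>\<int>[x]\<^sup>m\<close>.\<close>

definition zx_lattice :: "nat expo set \<Rightarrow> bool" where
  "zx_lattice M \<longleftrightarrow> (\<exists>m. M \<subseteq> Zxn m) \<and> 0 \<in> M \<and>
     (\<forall>u\<in>M. \<forall>v\<in>M. u + v \<in> M) \<and> (\<forall>g. \<forall>u\<in>M. g \<odot> u \<in> M)"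

definition add_span :: "'b expo set \<Rightarrow> 'b expo \<Rightarrow> 'b expo set" where
  "add_span S u = {s + g \<odot> u | s g. s \<in> S}"


section \<open>The algebras \<open>k[S]\<close>\<close>

type_synonym ('b, 'k) alg = "'b expo \<Rightarrow>\<^sub>0 'k"

definition class_ring :: "'a::comm_ring_1 set \<Rightarrow> 'a ring" where
  "class_ring A = \<lparr>carrier = A, mult = (*), one = 1, zero = 0, add = (+)\<rparr>"

definition kalg :: "'b expo set \<Rightarrow> ('b, 'k::zero) alg set" where
  "kalg S = {f. Poly_Mapping.keys f \<subseteq> S}"

definition chi :: "'b expo \<Rightarrow> ('b, 'k::zero_neq_one) alg" where
  "chi u = Poly_Mapping.single u 1"

definition sigma_field :: "('k::field_char_0 \<Rightarrow> 'k) \<Rightarrow> bool" where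
  "sigma_field \<sigma> \<longleftrightarrow> \<sigma> \<in> ring_hom (class_ring UNIV) (class_ring UNIV)"

definition alg_sigma :: "('k \<Rightarrow> 'k) \<Rightarrow> ('b, 'k::field_char_0) alg \<Rightarrow> ('b, 'k) alg" where
  "alg_sigma \<sigma> f =
     (\<Sum>u\<in>Poly_Mapping.keys f. Poly_Mapping.single ([:0, 1:] \<odot> u) (\<sigma> (Poly_Mapping.lookup f u)))"

definition sigma_prod ::
  "('k \<Rightarrow> 'k) \<Rightarrow> ('b, 'k::field_char_0) alg \<Rightarrow> (nat \<Rightarrow>\<^sub>0 nat) \<Rightarrow> ('b, 'k) alg" where
  "sigma_prod \<sigma> a c =
     (\<Prod>i\<in>Poly_Mapping.keys c. ((alg_sigma \<sigma> ^^ i) a) ^ Poly_Mapping.lookup c i)"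

definition Psigma_prime ::
  "('k \<Rightarrow> 'k) \<Rightarrow> 'b expo set \<Rightarrow> ('b, 'k::field_char_0) alg set \<Rightarrow> bool" where
  "Psigma_prime \<sigma> S \<pp> \<longleftrightarrow>
     primeideal \<pp> (class_ring (kalg S)) \<and>
     alg_sigma \<sigma> ` \<pp> \<subseteq> \<pp> \<and>
     (\<forall>a\<in>kalg S. \<forall>c. c \<noteq> 0 \<longrightarrow> sigma_prod \<sigma> a c \<in> \<pp> \<longrightarrow> a \<in> \<pp>) \<and>
     (\<forall>u\<in>S. \<forall>f\<in>kalg S. chi u * f \<in> \<pp> \<longrightarrow> (\<forall>g\<in>Px - {0}. chi (g \<odot> u) * f \<in> \<pp>))"


section \<open>\<open>\<sigma>\<close>-field extensions and affine \<open>P[\<sigma>]\<close>-varieties\<close>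

text \<open>The extensions \<open>K\<close> of \<open>k\<close> range over the structures with carrier inside a type \<open>'u\<close>, which
  acts as a universe; it is a free type variable throughout, hence arbitrarily large.\<close>

record ('u, 'k) sfext = "'u ring" +
  ext_sigma :: "'u \<Rightarrow> 'u"
  ext_emb :: "'k \<Rightarrow> 'u"

definition sigma_ext :: "('k::field_char_0 \<Rightarrow> 'k) \<Rightarrow> ('u, 'k) sfext \<Rightarrow> bool" where
  "sigma_ext \<sigma> K \<longleftrightarrow> field K \<and> ext_sigma K \<in> ring_hom K K \<and>
     ext_emb K \<in> ring_hom (class_ring UNIV) K \<and>
     (\<forall>a. ext_emb K (\<sigma> a) = ext_sigma K (ext_emb K a))"

text \<open>The affine \<open>P[\<sigma>]\<close>-variety cut out by \<open>eqs\<close> in \<open>Spec (k[semi])\<close>. With \<open>semi = P[x]\<^sup>m\<close>, where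
  \<open>k[semi]\<close> is the \<open>P[\<sigma>]\<close>-polynomial ring in \<open>m\<close> variables, these are the zero sets of
  \<open>P[\<sigma>]\<close>-polynomials; with \<open>eqs = {}\<close> one gets \<open>Spec (k[semi])\<close>.\<close>

record (overloaded) ('b, 'k) affvar =
  semi :: "'b expo set"
  eqs :: "('b, 'k) alg set"

definition affine_var :: "('b, 'k::field_char_0) affvar \<Rightarrow> bool" where
  "affine_var V \<longleftrightarrow> affine_semimodule (semi V) \<and> eqs V \<subseteq> kalg (semi V)"

definition Spec_alg :: "'b expo set \<Rightarrow> ('b, 'k) affvar" where
  "Spec_alg S = \<lparr>semi = S, eqs = {}\<rparr>"

definition spec :: "('k \<Rightarrow> 'k) \<Rightarrow> ('b, 'k::field_char_0) affvar \<Rightarrow> ('b, 'k) alg set set" where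
  "spec \<sigma> V = {\<pp>. Psigma_prime \<sigma> (semi V) \<pp> \<and> eqs V \<subseteq> \<pp>}"

definition kpts ::
  "('k \<Rightarrow> 'k) \<Rightarrow> ('b, 'k::field_char_0) affvar \<Rightarrow> ('u, 'k) sfext \<Rightarrow> (('b, 'k) alg \<Rightarrow> 'u) set" where
  "kpts \<sigma> V K = {h \<in> extensional (kalg (semi V)).
     h \<in> ring_hom (class_ring (kalg (semi V))) K \<and>
     (\<forall>c. h (Poly_Mapping.single 0 c) = ext_emb K c) \<and>
     (\<forall>f\<in>kalg (semi V). h (alg_sigma \<sigma> f) = ext_sigma K (h f)) \<and>
     (\<forall>f\<in>eqs V. h f = \<zero>\<^bsub>K\<^esub>)}"

definition closed_in_var ::
  "('k \<Rightarrow> 'k) \<Rightarrow> ('b, 'k::field_char_0) affvar \<Rightarrow> ('b, 'k) alg set set \<Rightarrow> bool" where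
  "closed_in_var \<sigma> V C \<longleftrightarrow> (\<exists>F\<subseteq>kalg (semi V). C = {\<pp> \<in> spec \<sigma> V. F \<subseteq> \<pp>})"

definition open_in_var ::
  "('k \<Rightarrow> 'k) \<Rightarrow> ('b, 'k::field_char_0) affvar \<Rightarrow> ('b, 'k) alg set set \<Rightarrow> bool" where
  "open_in_var \<sigma> V U \<longleftrightarrow> U \<subseteq> spec \<sigma> V \<and> closed_in_var \<sigma> V (spec \<sigma> V - U)"

definition basic_open ::
  "('k \<Rightarrow> 'k) \<Rightarrow> ('b, 'k::field_char_0) affvar \<Rightarrow> ('b, 'k) alg \<Rightarrow> ('b, 'k) alg set set" where
  "basic_open \<sigma> V e = {\<pp> \<in> spec \<sigma> V. e \<notin> \<pp>}"

text \<open>A variety has both a topological space (prime ideals) and a functor of points. To avoid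
  stating everything twice, the points of the space and the \<open>K\<close>-points for all \<open>K\<close> are put into
  one type.\<close>

datatype ('a, 'k, 'u) gen_pt =
    Prime "'a set"
  | KPt "('u, 'k) sfext" "'a \<Rightarrow> 'u"

type_synonym ('b, 'k, 'u) pt = "(('b, 'k) alg, 'k, 'u) gen_pt"

definition pts :: "('k \<Rightarrow> 'k) \<Rightarrow> ('b, 'k::field_char_0) affvar \<Rightarrow> ('b, 'k, 'u) pt set" where
  "pts \<sigma> V = Prime ` spec \<sigma> V \<union> {KPt K h | K h. sigma_ext \<sigma> K \<and> h \<in> kpts \<sigma> V K}"

text \<open>The underlying point of the topological space.\<close>

fun support :: "('b, 'k::field_char_0) affvar \<Rightarrow> ('b, 'k, 'u) pt \<Rightarrow> ('b, 'k) alg set" where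
  "support V (Prime \<pp>) = \<pp>"
| "support V (KPt K h) = {f \<in> kalg (semi V). h f = \<zero>\<^bsub>K\<^esub>}"

definition pts_over ::
  "('k \<Rightarrow> 'k) \<Rightarrow> ('b, 'k::field_char_0) affvar \<Rightarrow> ('b, 'k) alg set set \<Rightarrow> ('b, 'k, 'u) pt set" where
  "pts_over \<sigma> V U = {x \<in> pts \<sigma> V. support V x \<in> U}"


section \<open>Morphisms between open subsets of affine varieties\<close>

text \<open>\<open>represents x y f a d\<close>: the value of \<open>f\<close> at \<open>y\<close> is the value of \<open>a / d\<close> at \<open>x\<close> (\<open>d\<close> being
  nonzero at \<open>x\<close>); for points of the topological space, the two vanish simultaneously. It also
  forces \<open>x\<close> and \<open>y\<close> to be of the same kind.\<close>

fun represents ::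
  "('b, 'k, 'u) pt \<Rightarrow> ('c, 'k, 'u) pt \<Rightarrow> ('c, 'k) alg \<Rightarrow> ('b, 'k) alg \<Rightarrow> ('b, 'k) alg \<Rightarrow> bool" where
  "represents (Prime \<pp>) (Prime \<qq>) f a d \<longleftrightarrow> (f \<in> \<qq> \<longleftrightarrow> a \<in> \<pp>)"
| "represents (KPt K h) (KPt L h') f a d \<longleftrightarrow> K = L \<and> h' f \<otimes>\<^bsub>K\<^esub> h d = h a"
| "represents _ _ _ _ _ \<longleftrightarrow> False"

text \<open>Near each point of \<open>U\<close>, on some affine open subset where \<open>e \<noteq> 0\<close>, the map \<open>g\<close> is given by a
  comorphism from \<open>k[semi V']\<close> to the localisation of \<open>k[semi V]\<close> at the \<open>\<sigma>\<close>-powers of \<open>e\<close>.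
  Naturality in \<open>K\<close> and continuity are consequences.\<close>

definition regular_map ::
  "('k \<Rightarrow> 'k) \<Rightarrow> ('b, 'k::field_char_0) affvar \<Rightarrow> ('b, 'k) alg set set \<Rightarrow>
   ('c, 'k) affvar \<Rightarrow> ('c, 'k) alg set set \<Rightarrow> (('b, 'k, 'u) pt \<Rightarrow> ('c, 'k, 'u) pt) \<Rightarrow> bool" where
  "regular_map \<sigma> V U V' U' g \<longleftrightarrow>
     (\<forall>x\<in>pts_over \<sigma> V U. g x \<in> pts_over \<sigma> V' U') \<and>
     (\<forall>\<pp>\<in>U. \<exists>e\<in>kalg (semi V). e \<notin> \<pp> \<and> basic_open \<sigma> V e \<subseteq> U \<and>
        (\<forall>f\<in>kalg (semi V'). \<exists>a\<in>kalg (semi V). \<exists>c.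
           \<forall>x\<in>pts_over \<sigma> V (basic_open \<sigma> V e). represents x (g x) f a (sigma_prod \<sigma> e c)))"


section \<open>Abstract \<open>P[\<sigma>]\<close>-varieties\<close>

text \<open>\<open>overlap X \<beta> \<alpha>\<close> is \<open>V\<^sub>\<beta>\<^sub>\<alpha> \<subseteq> V\<^sub>\<alpha>\<close> and \<open>glue X \<beta> \<alpha>\<close> is \<open>g\<^sub>\<beta>\<^sub>\<alpha> : V\<^sub>\<beta>\<^sub>\<alpha> \<rightarrow> V\<^sub>\<alpha>\<^sub>\<beta>\<close>; both matter only for
  \<open>\<alpha> \<noteq> \<beta>\<close>.\<close>

record (overloaded) ('i, 'b, 'k, 'u) avar =
  idx :: "'i set"
  chart :: "'i \<Rightarrow> ('b, 'k) affvar"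
  overlap :: "'i \<Rightarrow> 'i \<Rightarrow> ('b, 'k) alg set set"
  glue :: "'i \<Rightarrow> 'i \<Rightarrow> ('b, 'k, 'u) pt \<Rightarrow> ('b, 'k, 'u) pt"

definition abstract_variety ::
  "('k \<Rightarrow> 'k) \<Rightarrow> ('i, 'b, 'k::field_char_0, 'u) avar \<Rightarrow> bool" where
  "abstract_variety \<sigma> X \<longleftrightarrow>
     finite (idx X) \<and>
     (\<forall>\<alpha>\<in>idx X. affine_var (chart X \<alpha>)) \<and>
     (\<forall>\<alpha>\<in>idx X. \<forall>\<beta>\<in>idx X. \<alpha> \<noteq> \<beta> \<longrightarrow>
        open_in_var \<sigma> (chart X \<alpha>) (overlap X \<beta> \<alpha>) \<and>
        regular_map \<sigma> (chart X \<alpha>) (overlap X \<beta> \<alpha>) (chart X \<beta>) (overlap X \<alpha> \<beta>) (glue X \<beta> \<alpha>) \<and>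
        (\<forall>x\<in>pts_over \<sigma> (chart X \<alpha>) (overlap X \<beta> \<alpha>). glue X \<alpha> \<beta> (glue X \<beta> \<alpha> x) = x)) \<and>
     (\<forall>\<alpha>\<in>idx X. \<forall>\<beta>\<in>idx X. \<forall>\<gamma>\<in>idx X. \<alpha> \<noteq> \<beta> \<longrightarrow> \<beta> \<noteq> \<gamma> \<longrightarrow> \<alpha> \<noteq> \<gamma> \<longrightarrow>
        glue X \<beta> \<alpha> ` pts_over \<sigma> (chart X \<alpha>) (overlap X \<beta> \<alpha> \<inter> overlap X \<gamma> \<alpha>)
          = pts_over \<sigma> (chart X \<beta>) (overlap X \<alpha> \<beta> \<inter> overlap X \<gamma> \<beta>) \<and>
        (\<forall>x\<in>pts_over \<sigma> (chart X \<alpha>) (overlap X \<beta> \<alpha> \<inter> overlap X \<gamma> \<alpha>).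
           glue X \<gamma> \<beta> (glue X \<beta> \<alpha> x) = glue X \<gamma> \<alpha> x))"

definition glue_rel ::
  "('k \<Rightarrow> 'k) \<Rightarrow> ('i, 'b, 'k::field_char_0, 'u) avar \<Rightarrow>
   (('i \<times> ('b, 'k, 'u) pt) \<times> ('i \<times> ('b, 'k, 'u) pt)) set" where
  "glue_rel \<sigma> X = {((\<alpha>, x), (\<beta>, y)). \<alpha> \<in> idx X \<and> \<beta> \<in> idx X \<and>
     x \<in> pts \<sigma> (chart X \<alpha>) \<and> y \<in> pts \<sigma> (chart X \<beta>) \<and>
     (\<alpha> = \<beta> \<and> x = y \<or>
      \<alpha> \<noteq> \<beta> \<and> support (chart X \<alpha>) x \<in> overlap X \<beta> \<alpha> \<and> y = glue X \<beta> \<alpha> x)}"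

text \<open>The point of the glued variety given by the point \<open>x\<close> of the chart \<open>\<alpha>\<close>.\<close>

definition cls ::
  "('k \<Rightarrow> 'k) \<Rightarrow> ('i, 'b, 'k::field_char_0, 'u) avar \<Rightarrow> 'i \<Rightarrow> ('b, 'k, 'u) pt \<Rightarrow>
   ('i \<times> ('b, 'k, 'u) pt) set" where
  "cls \<sigma> X \<alpha> x = glue_rel \<sigma> X `` {(\<alpha>, x)}"

text \<open>The topological space of \<open>X\<close> and the functor of points.\<close>

definition top_pts ::
  "('k \<Rightarrow> 'k) \<Rightarrow> ('i, 'b, 'k::field_char_0, 'u) avar \<Rightarrow> ('i \<times> ('b, 'k, 'u) pt) set set" where
  "top_pts \<sigma> X = {cls \<sigma> X \<alpha> (Prime \<pp>) | \<alpha> \<pp>. \<alpha> \<in> idx X \<and> \<pp> \<in> spec \<sigma> (chart X \<alpha>)}"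

definition avar_kpts ::
  "('k \<Rightarrow> 'k) \<Rightarrow> ('i, 'b, 'k::field_char_0, 'u) avar \<Rightarrow> ('u, 'k) sfext \<Rightarrow>
   ('i \<times> ('b, 'k, 'u) pt) set set" where
  "avar_kpts \<sigma> X K = {cls \<sigma> X \<alpha> (KPt K h) | \<alpha> h. \<alpha> \<in> idx X \<and> h \<in> kpts \<sigma> (chart X \<alpha>) K}"

definition chart_part ::
  "('k \<Rightarrow> 'k) \<Rightarrow> ('i, 'b, 'k::field_char_0, 'u) avar \<Rightarrow> ('i \<times> ('b, 'k, 'u) pt) set set \<Rightarrow> 'i \<Rightarrow>
   ('b, 'k) alg set set" where
  "chart_part \<sigma> X W \<alpha> = {\<pp> \<in> spec \<sigma> (chart X \<alpha>). cls \<sigma> X \<alpha> (Prime \<pp>) \<in> W}"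

definition avar_open ::
  "('k \<Rightarrow> 'k) \<Rightarrow> ('i, 'b, 'k::field_char_0, 'u) avar \<Rightarrow> ('i \<times> ('b, 'k, 'u) pt) set set \<Rightarrow> bool" where
  "avar_open \<sigma> X W \<longleftrightarrow> W \<subseteq> top_pts \<sigma> X \<and>
     (\<forall>\<alpha>\<in>idx X. open_in_var \<sigma> (chart X \<alpha>) (chart_part \<sigma> X W \<alpha>))"

definition avar_closed ::
  "('k \<Rightarrow> 'k) \<Rightarrow> ('i, 'b, 'k::field_char_0, 'u) avar \<Rightarrow> ('i \<times> ('b, 'k, 'u) pt) set set \<Rightarrow> bool" where
  "avar_closed \<sigma> X C \<longleftrightarrow> C \<subseteq> top_pts \<sigma> X \<and> avar_open \<sigma> X (top_pts \<sigma> X - C)"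

definition irreducible_variety ::
  "('k \<Rightarrow> 'k) \<Rightarrow> ('i, 'b, 'k::field_char_0, 'u) avar \<Rightarrow> bool" where
  "irreducible_variety \<sigma> X \<longleftrightarrow>
     \<not> (\<exists>C D. avar_closed \<sigma> X C \<and> avar_closed \<sigma> X D \<and>
          C \<noteq> top_pts \<sigma> X \<and> D \<noteq> top_pts \<sigma> X \<and> C \<union> D = top_pts \<sigma> X)"

text \<open>All points (of both kinds) of the open subset \<open>W\<close>.\<close>

definition avar_pts_over ::
  "('k \<Rightarrow> 'k) \<Rightarrow> ('i, 'b, 'k::field_char_0, 'u) avar \<Rightarrow> ('i \<times> ('b, 'k, 'u) pt) set set \<Rightarrow>
   ('i \<times> ('b, 'k, 'u) pt) set set" where
  "avar_pts_over \<sigma> X W =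
     {cls \<sigma> X \<alpha> x | \<alpha> x. \<alpha> \<in> idx X \<and> x \<in> pts_over \<sigma> (chart X \<alpha>) (chart_part \<sigma> X W \<alpha>)}"

text \<open>A morphism from the open subset \<open>W\<close> of \<open>X\<close> to the open subset \<open>W'\<close> of \<open>Y\<close>: locally a
  morphism from an open subset of a chart of \<open>X\<close> to a chart of \<open>Y\<close>.\<close>

definition avar_morphism ::
  "('k \<Rightarrow> 'k) \<Rightarrow> ('i, 'b, 'k::field_char_0, 'u) avar \<Rightarrow> ('i \<times> ('b, 'k, 'u) pt) set set \<Rightarrow>
   ('j, 'c, 'k, 'u) avar \<Rightarrow> ('j \<times> ('c, 'k, 'u) pt) set set \<Rightarrow>
   (('i \<times> ('b, 'k, 'u) pt) set \<Rightarrow> ('j \<times> ('c, 'k, 'u) pt) set) \<Rightarrow> bool" where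
  "avar_morphism \<sigma> X W Y W' f \<longleftrightarrow>
     (\<forall>\<xi>\<in>avar_pts_over \<sigma> X W. f \<xi> \<in> avar_pts_over \<sigma> Y W') \<and>
     (\<forall>\<alpha>\<in>idx X. \<forall>\<pp>\<in>chart_part \<sigma> X W \<alpha>. \<exists>\<beta>\<in>idx Y. \<exists>U g.
        \<pp> \<in> U \<and> U \<subseteq> chart_part \<sigma> X W \<alpha> \<and> open_in_var \<sigma> (chart X \<alpha>) U \<and>
        regular_map \<sigma> (chart X \<alpha>) U (chart Y \<beta>) (spec \<sigma> (chart Y \<beta>)) g \<and>
        (\<forall>x\<in>pts_over \<sigma> (chart X \<alpha>) U. f (cls \<sigma> X \<alpha> x) = cls \<sigma> Y \<beta> (g x)))"

definition affine_avar :: "('b, 'k) affvar \<Rightarrow> (unit, 'b, 'k, 'u) avar" where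
  "affine_avar V = \<lparr>idx = {()}, chart = (\<lambda>_. V), overlap = (\<lambda>_ _. {}), glue = (\<lambda>_ _ x. x)\<rparr>"


section \<open>Products of affine varieties\<close>

definition push :: "('a \<Rightarrow> 'b) \<Rightarrow> ('a \<Rightarrow>\<^sub>0 'c::comm_monoid_add) \<Rightarrow> ('b \<Rightarrow>\<^sub>0 'c)" where
  "push \<phi> f = (\<Sum>a\<in>Poly_Mapping.keys f. Poly_Mapping.single (\<phi> a) (Poly_Mapping.lookup f a))"

text \<open>The pushforwards along the index maps embed \<open>\<int>[x]\<^sup>m\<close> and \<open>\<int>[x]\<^sup>n\<close> as the two summands of
  \<open>\<int>[x]\<^sup>m\<^sup>+\<^sup>n\<close>; pushing forward along these embeddings gives \<open>f \<mapsto> f \<otimes> 1\<close> and \<open>f \<mapsto> 1 \<otimes> f\<close> into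
  \<open>k[S \<times> S'] = k[S] \<otimes> k[S']\<close>.\<close>

definition tens1 :: "('b, 'k::field_char_0) alg \<Rightarrow> ('b + 'c, 'k) alg" where
  "tens1 = push (push Inl)"

definition tens2 :: "('c, 'k::field_char_0) alg \<Rightarrow> ('b + 'c, 'k) alg" where
  "tens2 = push (push Inr)"

definition prod_affvar ::
  "('b, 'k::field_char_0) affvar \<Rightarrow> ('c, 'k) affvar \<Rightarrow> ('b + 'c, 'k) affvar" where
  "prod_affvar V V' = \<lparr>semi = {push Inl u + push Inr v | u v. u \<in> semi V \<and> v \<in> semi V'},
     eqs = tens1 ` eqs V \<union> tens2 ` eqs V'\<rparr>"

definition proj1 ::
  "('b, 'k::field_char_0) affvar \<Rightarrow> (('b + 'c, 'k) alg \<Rightarrow> 'u) \<Rightarrow> ('b, 'k) alg \<Rightarrow> 'u" where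
  "proj1 V h = (\<lambda>f\<in>kalg (semi V). h (tens1 f))"

definition proj2 ::
  "('c, 'k::field_char_0) affvar \<Rightarrow> (('b + 'c, 'k) alg \<Rightarrow> 'u) \<Rightarrow> ('c, 'k) alg \<Rightarrow> 'u" where
  "proj2 V h = (\<lambda>f\<in>kalg (semi V). h (tens2 f))"


section \<open>\<open>\<sigma>\<close>-tori and toric \<open>P[\<sigma>]\<close>-varieties\<close>

text \<open>The homomorphism \<open>k[S] \<rightarrow> K\<close> corresponding to a map \<open>\<phi> : S \<rightarrow> K\<close>.\<close>

definition kpt_of_map ::
  "('u, 'k::field_char_0) sfext \<Rightarrow> 'b expo set \<Rightarrow> ('b expo \<Rightarrow> 'u) \<Rightarrow> ('b, 'k) alg \<Rightarrow> 'u" where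
  "kpt_of_map K S \<phi> = (\<lambda>f\<in>kalg S.
     finsum K (\<lambda>u. ext_emb K (Poly_Mapping.lookup f u) \<otimes>\<^bsub>K\<^esub> \<phi> u) (Poly_Mapping.keys f))"

text \<open>The group structure on the \<open>K\<close>-points \<open>Hom(M, K\<^sup>*)\<close> of the torus: pointwise
  multiplication.\<close>

definition torus_one ::
  "('u, 'k::field_char_0) sfext \<Rightarrow> nat expo set \<Rightarrow> (nat, 'k) alg \<Rightarrow> 'u" where
  "torus_one K M = kpt_of_map K M (\<lambda>u. \<one>\<^bsub>K\<^esub>)"

definition torus_mult ::
  "('u, 'k::field_char_0) sfext \<Rightarrow> nat expo set \<Rightarrow> ((nat, 'k) alg \<Rightarrow> 'u) \<Rightarrow> ((nat, 'k) alg \<Rightarrow> 'u) \<Rightarrow>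
   (nat, 'k) alg \<Rightarrow> 'u" where
  "torus_mult K M s t = kpt_of_map K M (\<lambda>u. s (chi u) \<otimes>\<^bsub>K\<^esub> t (chi u))"

definition torus_avar :: "nat expo set \<Rightarrow> (unit, nat, 'k, 'u) avar" where
  "torus_avar M = affine_avar (Spec_alg M)"

text \<open>\<open>j\<close> identifies the torus with an open subset of \<open>X\<close>.\<close>

definition torus_embedding ::
  "('k \<Rightarrow> 'k) \<Rightarrow> nat expo set \<Rightarrow> ('i, 'b, 'k::field_char_0, 'u) avar \<Rightarrow>
   ((unit \<times> (nat, 'k, 'u) pt) set \<Rightarrow> ('i \<times> ('b, 'k, 'u) pt) set) \<Rightarrow> bool" where
  "torus_embedding \<sigma> M X j \<longleftrightarrow>
     (\<exists>W j'. avar_open \<sigma> X W \<and>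
        avar_morphism \<sigma> (torus_avar M) (top_pts \<sigma> (torus_avar M)) X W j \<and>
        avar_morphism \<sigma> X W (torus_avar M) (top_pts \<sigma> (torus_avar M)) j' \<and>
        (\<forall>\<tau>\<in>avar_pts_over \<sigma> (torus_avar M) (top_pts \<sigma> (torus_avar M)). j' (j \<tau>) = \<tau>) \<and>
        (\<forall>\<xi>\<in>avar_pts_over \<sigma> X W. j (j' \<xi>) = \<xi>))"

text \<open>\<open>T \<times> X\<close> is the functor \<open>K \<mapsto> T(K) \<times> X(K)\<close>, covered by the affine open subvarieties
  \<open>T \<times> X\<^sub>\<alpha>\<close>; a morphism from it is a family of maps on \<open>K\<close>-points which, locally on the
  \<open>T \<times> X\<^sub>\<alpha>\<close>, is given by morphisms to the charts of \<open>X\<close>.\<close>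

definition action_morphism ::
  "('k \<Rightarrow> 'k) \<Rightarrow> nat expo set \<Rightarrow> ('i, 'b, 'k::field_char_0, 'u) avar \<Rightarrow>
   (('u, 'k) sfext \<Rightarrow> ((nat, 'k) alg \<Rightarrow> 'u) \<Rightarrow>
     ('i \<times> ('b, 'k, 'u) pt) set \<Rightarrow> ('i \<times> ('b, 'k, 'u) pt) set) \<Rightarrow> bool" where
  "action_morphism \<sigma> M X act \<longleftrightarrow>
     (\<forall>K. sigma_ext \<sigma> K \<longrightarrow>
        (\<forall>t\<in>kpts \<sigma> (Spec_alg M) K. \<forall>\<xi>\<in>avar_kpts \<sigma> X K. act K t \<xi> \<in> avar_kpts \<sigma> X K)) \<and>
     (\<forall>\<alpha>\<in>idx X. \<forall>\<qq>\<in>spec \<sigma> (prod_affvar (Spec_alg M) (chart X \<alpha>)). \<exists>\<beta>\<in>idx X. \<exists>U g.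
        \<qq> \<in> U \<and> open_in_var \<sigma> (prod_affvar (Spec_alg M) (chart X \<alpha>)) U \<and>
        regular_map \<sigma> (prod_affvar (Spec_alg M) (chart X \<alpha>)) U
          (chart X \<beta>) (spec \<sigma> (chart X \<beta>)) g \<and>
        (\<forall>K h. KPt K h \<in> pts_over \<sigma> (prod_affvar (Spec_alg M) (chart X \<alpha>)) U \<longrightarrow>
           act K (proj1 (Spec_alg M) h) (cls \<sigma> X \<alpha> (KPt K (proj2 (chart X \<alpha>) h)))
             = cls \<sigma> X \<beta> (g (KPt K h))))"

definition torus_action ::
  "('k \<Rightarrow> 'k) \<Rightarrow> nat expo set \<Rightarrow> ('i, 'b, 'k::field_char_0, 'u) avar \<Rightarrow>
   (('u, 'k) sfext \<Rightarrow> ((nat, 'k) alg \<Rightarrow> 'u) \<Rightarrow>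
     ('i \<times> ('b, 'k, 'u) pt) set \<Rightarrow> ('i \<times> ('b, 'k, 'u) pt) set) \<Rightarrow> bool" where
  "torus_action \<sigma> M X act \<longleftrightarrow> action_morphism \<sigma> M X act \<and>
     (\<forall>K. sigma_ext \<sigma> K \<longrightarrow> (\<forall>\<xi>\<in>avar_kpts \<sigma> X K.
        act K (torus_one K M) \<xi> = \<xi> \<and>
        (\<forall>s\<in>kpts \<sigma> (Spec_alg M) K. \<forall>t\<in>kpts \<sigma> (Spec_alg M) K.
           act K (torus_mult K M s t) \<xi> = act K s (act K t \<xi>))))"

definition toric_variety ::
  "('k \<Rightarrow> 'k) \<Rightarrow> ('i, 'b, 'k::field_char_0, 'u) avar \<Rightarrow> bool" where
  "toric_variety \<sigma> X \<longleftrightarrow> abstract_variety \<sigma> X \<and> irreducible_variety \<sigma> X \<and>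
     (\<exists>M j act. zx_lattice M \<and> torus_embedding \<sigma> M X j \<and> torus_action \<sigma> M X act \<and>
        (\<forall>K. sigma_ext \<sigma> K \<longrightarrow>
           (\<forall>s\<in>kpts \<sigma> (Spec_alg M) K. \<forall>t\<in>kpts \<sigma> (Spec_alg M) K.
              act K s (j (cls \<sigma> (torus_avar M) () (KPt K t)))
                = j (cls \<sigma> (torus_avar M) () (KPt K (torus_mult K M s t))))))"


section \<open>Fans\<close>

text \<open>The relation between \<open>S\<^sub>i\<close>, \<open>S\<^sub>j\<close> and \<open>u\<close> in condition (b).\<close>

definition fan_pair :: "'b expo set \<Rightarrow> 'b expo set \<Rightarrow> 'b expo \<Rightarrow> bool" where
  "fan_pair S S' u \<longleftrightarrow> u \<in> S \<and> - u \<in> S' \<and> add_span S (- u) = add_span S' u"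

text \<open>A fan is nonempty, so that \<open>\<Sigma>\<^sup>m\<^sup>d\<close> is defined (the variety of an empty collection would be
  empty, hence not toric).\<close>

definition fan :: "nat \<Rightarrow> 'i set \<Rightarrow> ('i \<Rightarrow> nat expo set) \<Rightarrow> bool" where
  "fan n I S \<longleftrightarrow> finite I \<and> I \<noteq> {} \<and>
     (\<forall>i\<in>I. affine_semimodule (S i) \<and> S i \<subseteq> Zxn n) \<and>
     (\<exists>M. zx_lattice M \<and> (\<forall>i\<in>I. semi_md (S i) = M)) \<and>
     (\<forall>i\<in>I. \<forall>j\<in>I. i \<noteq> j \<longrightarrow> (\<exists>u. fan_pair (S i) (S j) u)) \<and>
     (\<forall>i\<in>I. \<forall>j\<in>I. \<forall>k\<in>I. i \<noteq> j \<longrightarrow> j \<noteq> k \<longrightarrow> i \<noteq> k \<longrightarrow>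
        (\<forall>u v w. fan_pair (S i) (S j) u \<longrightarrow> fan_pair (S j) (S k) v \<longrightarrow> fan_pair (S k) (S i) w \<longrightarrow>
           add_span (add_span (S i) (- u)) w = add_span (add_span (S j) u) (- v) \<and>
           add_span (add_span (S j) u) (- v) = add_span (add_span (S k) v) (- w)))"

text \<open>Restriction of points along \<open>Spec (k[S']) \<rightarrow> Spec (k[S])\<close> for \<open>S \<subseteq> S'\<close>.\<close>

fun restrict_pt :: "'b expo set \<Rightarrow> ('b, 'k::field_char_0, 'u) pt \<Rightarrow> ('b, 'k, 'u) pt" where
  "restrict_pt S (Prime \<pp>) = Prime (\<pp> \<inter> kalg S)"
| "restrict_pt S (KPt K h) = KPt K (restrict h (kalg S))"

text \<open>The variety of a fan, for a choice \<open>u i j\<close> of vectors as in (b). The open subset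
  \<open>\<chi>\<^sup>u \<noteq> 0\<close> of \<open>X\<^sub>i\<close> is \<open>Spec (k[S\<^sub>i + \<int>[x](-u)])\<close> via restriction of points, which is inverted and
  then followed by restriction to \<open>S\<^sub>j\<close>; this is the identification via the identity of
  \<open>k[S\<^sub>i + \<int>[x](-u)] = k[S\<^sub>j + \<int>[x]u]\<close>.\<close>

definition fan_variety ::
  "('k \<Rightarrow> 'k) \<Rightarrow> 'i set \<Rightarrow> ('i \<Rightarrow> nat expo set) \<Rightarrow> ('i \<Rightarrow> 'i \<Rightarrow> nat expo) \<Rightarrow>
   ('i, nat, 'k::field_char_0, 'u) avar" where
  "fan_variety \<sigma> I S u = \<lparr>
     idx = I,
     chart = (\<lambda>i. Spec_alg (S i)),
     overlap = (\<lambda>j i. basic_open \<sigma> (Spec_alg (S i)) (chi (u i j))),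
     glue = (\<lambda>j i x. restrict_pt (S j)
       (the_inv_into (pts \<sigma> (Spec_alg (add_span (S i) (- u i j)))) (restrict_pt (S i)) x))\<rparr>"

end

(*
  For semimodules S and S' and u as in condition (b), S + Z[x](-u) is simply the sum S + S', so the
  points of X_i lying over X_j are exactly those extending to k[S_i + S_j]; such an extension is unique
  since this algebra is a localisation of k[S_i]. Points of X_i and X_j are therefore identified iff
  they are restrictions of one point over S_i + S_j, and the cocycle conditions reduce to the symmetry
  of S_i + S_j + S_k. The lattice M is the localisation of every S_i
  at the sum of its generators, so the torus Spec k[M] is a basic open subset of each chart; the zero
  ideal of k[M] restricts to a common generic point. The action is X^v |-> X^v (x) X^v on each chart.
*)

theory Submission
  imports Defs "HOL-Library.Set_Algebras"
begin

section \<open>Exponents and \<open>P[x]\<close>-semimodules\<close>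

text \<open>The shape of the proof comes from a mismatch of exponents. In \<open>add_span\<close>
  the vector -u may be multiplied by any integer polynomial, while a morphism may only use
  denominators \<open>sigma_prod \<sigma> e c\<close>, which for e = \<open>chi u\<close> are the
  characters of g u with g having nonnegative coefficients. Splitting a polynomial into positive and
  negative parts bridges the gap: the positive multiples of u are absorbed into S and the rest is a
  legitimate denominator. The ideals of the topology turn out to be the reflexive prime
  sigma-ideals, which extend uniquely to localisations; K-points do so by the universal property.
  Hence both kinds of points can be moved by the same restriction maps. The sum of two semimodules
  mentions neither a vector u nor an order of the charts, and S + S = S absorbs the diagonal case,
  so one description serves all pairs and triples of indices. That the zero ideal is prime rests on
  a linear order on the exponents, and that it is reflexive on the injectivity of sigma.\<close>

lemma lookup_smul [simp]: "Poly_Mapping.lookup (g \<odot> u) k = g * Poly_Mapping.lookup u k"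
  by (simp add: smul_def Poly_Mapping.map.rep_eq when_def)

lemma smul_add_right: "g \<odot> (u + v) = g \<odot> u + g \<odot> v"
  by (rule poly_mapping_eqI) (simp add: lookup_add algebra_simps)

lemma smul_add_left: "(g + h) \<odot> u = g \<odot> u + h \<odot> u"
  by (rule poly_mapping_eqI) (simp add: lookup_add algebra_simps)

lemma smul_diff_left: "(g - h) \<odot> u = g \<odot> u - h \<odot> u"
  by (rule poly_mapping_eqI) (simp add: lookup_minus algebra_simps)

lemma smul_smul: "g \<odot> h \<odot> u = (g * h) \<odot> u"
  by (rule poly_mapping_eqI) (simp add: algebra_simps)

lemma smul_uminus_right: "g \<odot> (- u) = - (g \<odot> u)"
  by (rule poly_mapping_eqI) simp

lemma smul_zero [simp]: "g \<odot> 0 = 0" "0 \<odot> u = 0" and smul_one [simp]: "1 \<odot> u = u"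
  by (auto intro!: poly_mapping_eqI)

lemma smul_x_inj: "[:0, 1:] \<odot> u = [:0, 1:] \<odot> v \<longleftrightarrow> u = v"
proof
  assume "[:0, 1:] \<odot> u = [:0, 1:] \<odot> v"
  then have "[:0, 1:] * Poly_Mapping.lookup u k = [:0, 1:] * Poly_Mapping.lookup v k" for k
    by (metis lookup_smul)
  then show "u = v"
    by (intro poly_mapping_eqI) (metis mult_left_cancel pCons_eq_0_iff zero_neq_one)
qed simp

text \<open>These g are exactly those for which \<open>chi (g \<odot> u)\<close> is a product of
  powers of the sigma^i(\<open>chi u\<close>). Members of \<open>Px\<close> may have negative lower
  coefficients, so they are too many for this purpose.\<close>

definition natpoly :: "int poly \<Rightarrow> bool" where
  "natpoly g \<longleftrightarrow> (\<forall>i. coeff g i \<ge> 0)"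

lemma natpoly_add: "natpoly g \<Longrightarrow> natpoly h \<Longrightarrow> natpoly (g + h)"
  by (simp add: natpoly_def)

lemma natpoly_mult: "natpoly g \<Longrightarrow> natpoly h \<Longrightarrow> natpoly (g * h)"
  by (auto simp: natpoly_def coeff_mult intro: sum_nonneg)

lemma natpoly_simps [simp]: "natpoly 0" "natpoly 1" "natpoly [:0, 1:]"
  by (auto simp: natpoly_def coeff_pCons split: nat.split)

lemma natpoly_Px: "natpoly g \<Longrightarrow> g \<in> Px"
  unfolding natpoly_def Px_def by (metis (lifting) leading_coeff_0_iff mem_Collect_eq order_le_less)

text \<open>Take the positive and the negative part of every coefficient.\<close>

lemma natpoly_diffE:
  obtains a b where "natpoly a" "natpoly b" "g = a - b"
proof
  show "natpoly (map_poly (max 0) g)" "natpoly (map_poly (max 0) (- g))"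
    by (auto simp: natpoly_def coeff_map_poly)
  show "g = map_poly (max 0) g - map_poly (max 0) (- g)"
    by (rule poly_eqI) (simp add: coeff_map_poly)
qed

definition natpoly_of :: "(nat \<Rightarrow>\<^sub>0 nat) \<Rightarrow> int poly" where
  "natpoly_of c = (\<Sum>i\<in>Poly_Mapping.keys c. monom (int (Poly_Mapping.lookup c i)) i)"

lemma coeff_natpoly_of: "coeff (natpoly_of c) i = int (Poly_Mapping.lookup c i)"
  by (simp add: natpoly_of_def coeff_sum in_keys_iff)

lemma natpoly_ofE:
  assumes "natpoly g"
  obtains c where "g = natpoly_of c"
proof
  have "finite {i. coeff g i \<noteq> 0}"
    by (metis MOST_coeff_eq_0 eventually_cofinite)
  then have "finite {i. nat (coeff g i) \<noteq> 0}"
    by (rule rev_finite_subset) auto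
  then show "g = natpoly_of (Abs_poly_mapping (\<lambda>i. nat (coeff g i)))"
    using assms by (intro poly_eqI) (simp add: coeff_natpoly_of natpoly_def)
qed

text \<open>Since 0 lies in \<open>Px\<close>, a semimodule contains 0 as soon as it is nonempty.
  The zero vector supplies the unit of k[S].\<close>

definition pointed :: "'b expo set \<Rightarrow> bool" where
  "pointed S \<longleftrightarrow> semimodule S \<and> 0 \<in> S"

lemma pointedD:
  assumes "pointed S"
  shows pointed_zero: "0 \<in> S"
    and pointed_add: "u \<in> S \<Longrightarrow> v \<in> S \<Longrightarrow> u + v \<in> S"
    and pointed_smul: "g \<in> Px \<Longrightarrow> u \<in> S \<Longrightarrow> g \<odot> u \<in> S"
    and pointed_natpoly: "natpoly g \<Longrightarrow> u \<in> S \<Longrightarrow> g \<odot> u \<in> S"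
    and pointed_x: "u \<in> S \<Longrightarrow> [:0, 1:] \<odot> u \<in> S"
  using assms natpoly_Px unfolding pointed_def semimodule_def
  by (auto simp del: smul_zero intro: natpoly_Px[of "[:0,1:]", simplified])

lemma Px_zero [simp]: "0 \<in> Px" by (simp add: Px_def)

lemma affine_semimodule_pointed: "affine_semimodule S \<Longrightarrow> pointed S"
proof -
  assume "affine_semimodule S"
  then obtain B where "semimodule S" and
    B: "S = {\<Sum>u\<in>B. g u \<odot> u | g. \<forall>u\<in>B. g u \<in> Px}"
    unfolding affine_semimodule_def by blast
  moreover have "0 \<in> S" unfolding B by (rule CollectI, rule exI[of _ "\<lambda>_. 0"]) simp
  ultimately show "pointed S" by (simp add: pointed_def)
qed

lemma pointed_set_plus: "pointed S \<Longrightarrow> pointed T \<Longrightarrow> pointed (S + T)"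
proof -
  assume S: "pointed S" and T: "pointed T"
  show "pointed (S + T)"
    unfolding pointed_def semimodule_def
  proof (intro conjI ballI)
    show "0 \<in> S + T"
      using set_plus_intro[OF pointed_zero[OF S] pointed_zero[OF T]] by simp
    fix u assume "u \<in> S + T"
    then obtain a b where u: "u = a + b" "a \<in> S" "b \<in> T" by (rule set_plus_elim)
    { fix v assume "v \<in> S + T"
      then obtain c d where v: "v = c + d" "c \<in> S" "d \<in> T" by (rule set_plus_elim)
      have "u + v = (a + c) + (b + d)" using u v by (simp add: algebra_simps)
      then show "u + v \<in> S + T"
        using set_plus_intro[OF pointed_add[OF S u(2) v(2)] pointed_add[OF T u(3) v(3)]] by simp }
    { fix g assume "g \<in> Px"
      then show "g \<odot> u \<in> S + T"
        using u S T by (auto simp: smul_add_right intro!: set_plus_intro pointed_smul) }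
  qed
qed

text \<open>Lets an overlap of a chart with itself be treated as an overlap over the sum, and
  removes repeated summands in triple overlaps.\<close>

lemma pointed_set_plus_self: "pointed S \<Longrightarrow> S + S = S"
proof
  assume S: "pointed S"
  show "S + S \<subseteq> S" using S by (auto elim!: set_plus_elim intro: pointed_add)
  show "S \<subseteq> S + S"
    using set_plus_intro[OF _ pointed_zero[OF S]] by fastforce
qed

lemma pointed_subset_plus:
  assumes "pointed S" "pointed T"
  shows "S \<subseteq> S + T" "T \<subseteq> S + T"
  using set_plus_intro[of _ S 0 T] set_plus_intro[of 0 S _ T] assms pointed_zero by fastforce+

text \<open>\<open>k[T]\<close> is the localisation of \<open>k[S]\<close> at the \<open>\<sigma>\<close>-powers of \<open>\<chi>\<^sup>u\<close>.\<close>

definition localises :: "'b expo set \<Rightarrow> 'b expo set \<Rightarrow> 'b expo \<Rightarrow> bool" where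
  "localises S T u \<longleftrightarrow> pointed S \<and> u \<in> S \<and> T = add_span S (- u)"

text \<open>With the multiplier of -u written as a - b, the vector b u is absorbed into S, and what
  remains to be subtracted is a u. So every element of the localisation is a fraction whose
  denominator is a sigma-power of \<open>chi u\<close>.\<close>

lemma add_span_uminusE:
  assumes S: "pointed S" and u: "u \<in> S" and t: "t \<in> add_span S (- u)"
  obtains s g where "s \<in> S" "natpoly g" "t = s - g \<odot> u"
proof -
  obtain s g where sg: "t = s + g \<odot> (- u)" "s \<in> S" using t by (auto simp: add_span_def)
  obtain a b where ab: "natpoly a" "natpoly b" "g = a - b" by (rule natpoly_diffE)
  show thesis
  proof
    show "s + b \<odot> u \<in> S" using S u sg ab by (auto intro!: pointed_add pointed_natpoly)
    show "t = (s + b \<odot> u) - a \<odot> u"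
      using sg ab by (simp add: smul_uminus_right smul_diff_left)
  qed (fact ab)
qed

lemma add_spanI: "s \<in> S \<Longrightarrow> s + g \<odot> u \<in> add_span S u"
  by (auto simp: add_span_def)

lemma localises_pointed:
  assumes "localises S T u"
  shows "pointed S" "pointed T"
proof -
  have S: "pointed S" and T: "T = add_span S (- u)" using assms by (auto simp: localises_def)
  show "pointed S" by fact
  show "pointed T"
    unfolding pointed_def semimodule_def T
  proof (intro conjI ballI)
    show "0 \<in> add_span S (- u)" using add_spanI[OF pointed_zero[OF S], of 0] by simp
    fix v assume "v \<in> add_span S (- u)"
    then obtain s g where v: "s \<in> S" "v = s + g \<odot> (- u)" by (auto simp: add_span_def)
    { fix w assume "w \<in> add_span S (- u)"
      then obtain s' g' where w: "s' \<in> S" "w = s' + g' \<odot> (- u)" by (auto simp: add_span_def)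
      have "v + w = (s + s') + (g + g') \<odot> (- u)"
        by (simp add: v w smul_add_left)
      then show "v + w \<in> add_span S (- u)"
        using add_spanI[OF pointed_add[OF S v(1) w(1)]] by metis }
    { fix h assume "h \<in> Px"
      then have "h \<odot> v = h \<odot> s + (h * g) \<odot> (- u)" "h \<odot> s \<in> S"
        using v S by (auto simp: smul_add_right smul_smul intro: pointed_smul)
      then show "h \<odot> v \<in> add_span S (- u)"
        using add_spanI[of "h \<odot> s" S] by metis }
  qed
qed

lemma localises_subset: "localises S T u \<Longrightarrow> S \<subseteq> T"
  using add_spanI[of _ S 0 "- u"] by (auto simp: localises_def)

lemma localises_uminus: "localises S T u \<Longrightarrow> - (g \<odot> u) \<in> T"
  using add_spanI[of 0 S g "- u"]
  by (simp add: localises_def smul_uminus_right pointed_zero)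

lemma localises_refl: "pointed S \<Longrightarrow> localises S S 0"
  by (auto simp: localises_def add_span_def pointed_zero)

text \<open>Inverting two characters is inverting their product: both fractions are brought over a
  common denominator that is a multiple of u + v.\<close>

lemma localises_plus:
  assumes T: "localises S T u" and T': "localises S T' v"
  shows "localises S (T + T') (u + v)"
  unfolding localises_def
proof (intro conjI)
  show S: "pointed S" using T by (simp add: localises_def)
  have u: "u \<in> S" "v \<in> S" using T T' by (auto simp: localises_def)
  show "u + v \<in> S" using S u by (rule pointed_add)
  show "T + T' = add_span S (- (u + v))"
  proof
    show "T + T' \<subseteq> add_span S (- (u + v))"
    proof
      fix t assume "t \<in> T + T'"
      then obtain a b where t: "t = a + b" "a \<in> T" "b \<in> T'" by (rule set_plus_elim)
      obtain s g where a: "s \<in> S" "natpoly g" "a = s - g \<odot> u"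
        using add_span_uminusE[OF S u(1)] t(2) T unfolding localises_def by metis
      obtain s' g' where b: "s' \<in> S" "natpoly g'" "b = s' - g' \<odot> v"
        using add_span_uminusE[OF S u(2)] t(3) T' unfolding localises_def by metis
      \<comment> \<open>Subtracting (g + g')(u + v) removes g v and g' u as well; both are added
        back, and they lie in S because g and g' have nonnegative coefficients.\<close>
      have "t = (s + s' + g' \<odot> u + g \<odot> v) + (g + g') \<odot> (- (u + v))"
        unfolding t a b smul_uminus_right smul_add_left smul_add_right
        by (simp add: algebra_simps)
      moreover have "s + s' + g' \<odot> u + g \<odot> v \<in> S"
        using S u a b by (auto intro!: pointed_add pointed_natpoly)
      ultimately show "t \<in> add_span S (- (u + v))" using add_spanI by metis
    qed
    show "add_span S (- (u + v)) \<subseteq> T + T'"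
    proof
      fix t assume "t \<in> add_span S (- (u + v))"
      then obtain s g where t: "s \<in> S" "t = s + g \<odot> (- (u + v))" by (auto simp: add_span_def)
      have "t = (s + g \<odot> (- u)) + (0 + g \<odot> (- v))"
        unfolding t smul_uminus_right smul_add_right by simp
      then show "t \<in> T + T'"
        using set_plus_intro[of "s + g \<odot> (- u)" T "0 + g \<odot> (- v)" T'] add_spanI t T T'
          pointed_zero[OF S] unfolding localises_def by metis
    qed
  qed
qed

text \<open>Both summands lie in the common semimodule \<open>add_span S (- u)\<close> =
  \<open>add_span S' u\<close>. Conversely s - g u with g having nonnegative coefficients is s + g
  (-u), and -u lies in S'. The result is independent of the chosen u.\<close>

lemma fan_pair_localises:
  assumes S: "pointed S" and S': "pointed S'" and p: "fan_pair S S' u"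
  shows "localises S (S + S') u"
  unfolding localises_def
proof (intro conjI)
  have u: "u \<in> S" "- u \<in> S'" and e: "add_span S (- u) = add_span S' u"
    using p by (auto simp: fan_pair_def)
  show "u \<in> S" "pointed S" by fact+
  have L: "localises S (add_span S (- u)) u" using S u by (simp add: localises_def)
  have L': "localises S' (add_span S (- u)) (- u)" using S' u e by (simp add: localises_def)
  show "S + S' = add_span S (- u)"
  proof
    show "S + S' \<subseteq> add_span S (- u)"
      using localises_subset[OF L] localises_subset[OF L'] localises_pointed(2)[OF L]
      by (auto elim!: set_plus_elim intro!: pointed_add)
    show "add_span S (- u) \<subseteq> S + S'"
    proof
      fix t assume "t \<in> add_span S (- u)"
      then obtain s g where "s \<in> S" "natpoly g" "t = s - g \<odot> u"
        by (rule add_span_uminusE[OF S u(1)])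
      moreover then have "g \<odot> (- u) \<in> S'" using S' u by (auto intro: pointed_natpoly)
      ultimately show "t \<in> S + S'"
        using set_plus_intro[of s S "g \<odot> (- u)" S'] by (simp add: smul_uminus_right)
    qed
  qed
qed

text \<open>A single inverted vector suffices: if v is the sum of the generators, then v - b lies in
  S for each generator b, so -b = (v - b) - v is available once -v is. Finite generation is what
  makes v exist.\<close>

lemma affine_semimodule_localises_md:
  assumes "affine_semimodule S"
  obtains v where "localises S (semi_md S) v"
proof -
  have S: "pointed S" using assms by (rule affine_semimodule_pointed)
  obtain B where B: "finite B" "S = {\<Sum>u\<in>B. g u \<odot> u | g. \<forall>u\<in>B. g u \<in> Px}"
    using assms unfolding affine_semimodule_def by blast
  have sums: "(\<Sum>u\<in>A. f u) \<in> T" if "pointed T" "\<And>u. u \<in> A \<Longrightarrow> f u \<in> T" for A f and T :: "'a expo set"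
    using that by (induction A rule: infinite_finite_induct) (auto intro: pointed_zero pointed_add)
  have BS: "u \<in> S" if "u \<in> B" for u
  proof -
    \<comment> \<open>A generator is the combination with coefficient 1 at itself and 0
      elsewhere.\<close>
    have "(\<Sum>w\<in>B. (if w = u then 1 else 0) \<odot> w) = u"
      using that B(1) by (simp add: if_distrib[of "\<lambda>g. g \<odot> _"] cong: if_cong)
    then show ?thesis
      unfolding B(2) using natpoly_Px[of 1]
      by (intro CollectI exI[of _ "\<lambda>w. if w = u then 1 else 0"]) auto
  qed
  let ?v = "\<Sum>u\<in>B. u"
  let ?T = "add_span S (- ?v)"
  have v: "?v \<in> S" using S BS by (rule sums)
  have L: "localises S ?T ?v" using S v by (simp add: localises_def)
  have T: "pointed ?T" using L by (rule localises_pointed)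
  \<comment> \<open>Stated with a coefficient g in \<open>Px\<close>, because \<open>Px\<close> has
    no negatives and a general element of S is a \<open>Px\<close>-combination of
    generators.\<close>
  have neg: "- (g \<odot> b) \<in> ?T" if "b \<in> B" "g \<in> Px" for b g
  proof -
    have "?v = b + (\<Sum>u\<in>B - {b}. u)" using B(1) that by (simp add: sum.remove)
    then have "- (g \<odot> b) = g \<odot> (\<Sum>u\<in>B - {b}. u) + - (g \<odot> ?v)"
      by (simp add: smul_add_right)
    moreover have "(\<Sum>u\<in>B - {b}. u) \<in> S" using S BS by (intro sums) auto
    ultimately show ?thesis
      using pointed_add[OF T subsetD[OF localises_subset[OF L] pointed_smul[OF S \<open>g \<in> Px\<close>]] 
         localises_uminus[OF L]] by metis
  qed
  have "?T = semi_md S"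
  proof
    show "?T \<subseteq> semi_md S"
    proof
      fix t assume "t \<in> ?T"
      then obtain s g where "s \<in> S" "natpoly g" "t = s - g \<odot> ?v"
        by (rule add_span_uminusE[OF S v])
      then show "t \<in> semi_md S"
        unfolding semi_md_def using S v by (blast intro: pointed_natpoly)
    qed
    show "semi_md S \<subseteq> ?T"
    proof
      fix t assume "t \<in> semi_md S"
      then obtain s s' where t: "t = s - s'" "s \<in> S" "s' \<in> S" by (auto simp: semi_md_def)
      obtain g where g: "s' = (\<Sum>u\<in>B. g u \<odot> u)" "\<forall>u\<in>B. g u \<in> Px" using t(3) B(2) by blast
      have "- s' = (\<Sum>u\<in>B. - (g u \<odot> u))" by (simp add: g sum_negf)
      also have "\<dots> \<in> ?T" using T neg g(2) by (intro sums) auto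
      finally show "t \<in> ?T"
        using pointed_add[OF T subsetD[OF localises_subset[OF L] t(2)]] t(1) by fastforce
    qed
  qed
  with L show thesis using that by metis
qed

section \<open>The algebras \<open>k[S]\<close>\<close>

lemma kalg_zero [simp]: "0 \<in> kalg S"
  and kalg_add: "f \<in> kalg S \<Longrightarrow> g \<in> kalg S \<Longrightarrow> f + g \<in> kalg S"
  and kalg_single: "u \<in> S \<Longrightarrow> Poly_Mapping.single u c \<in> kalg S"
  and kalg_chi: "u \<in> S \<Longrightarrow> chi u \<in> kalg S"
  and kalg_mono: "S \<subseteq> T \<Longrightarrow> kalg S \<subseteq> kalg T"
  using Poly_Mapping.keys_add[of f g] by (auto simp: kalg_def chi_def)

lemma kalg_uminus: "f \<in> kalg S \<Longrightarrow> - f \<in> kalg S" for f :: "('b, 'k::ring_1) alg"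
  by (auto simp: kalg_def in_keys_iff)

lemma kalg_mult: "pointed S \<Longrightarrow> f \<in> kalg S \<Longrightarrow> g \<in> kalg S \<Longrightarrow> f * g \<in> kalg S"
  for f :: "('b, 'k::comm_ring_1) alg"
  using Poly_Mapping.keys_mult[of f g] unfolding kalg_def by (blast intro: pointed_add)

lemma chi_zero: "chi 0 = 1"
  by (simp add: chi_def)

lemma chi_add: "chi (u + v) = (chi u * chi v :: ('b, 'k::comm_ring_1) alg)"
  by (simp add: chi_def mult_single)

lemma chi_uminus: "chi (- u) * chi u = (1 :: ('b, 'k::comm_ring_1) alg)"
  by (metis chi_add chi_zero add.left_inverse)

lemma kalg_one: "pointed S \<Longrightarrow> (1 :: ('b, 'k::comm_ring_1) alg) \<in> kalg S"
  by (metis chi_zero kalg_chi pointed_zero)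

lemma kalg_power: "pointed S \<Longrightarrow> f \<in> kalg S \<Longrightarrow> f ^ n \<in> kalg S"
  for f :: "('b, 'k::comm_ring_1) alg"
  by (induction n) (auto intro: kalg_one kalg_mult)

lemma kalg_prod: "pointed S \<Longrightarrow> (\<And>i. i \<in> A \<Longrightarrow> f i \<in> kalg S) \<Longrightarrow> (\<Prod>i\<in>A. f i) \<in> kalg S"
  for f :: "'i \<Rightarrow> ('b, 'k::comm_ring_1) alg"
  by (induction A rule: infinite_finite_induct) (auto intro: kalg_one kalg_mult)

lemma single_eq_chi: "Poly_Mapping.single u c = (Poly_Mapping.single 0 c * chi u :: ('b, 'k::comm_ring_1) alg)"
  by (simp add: chi_def mult_single)

lemma sum_single_lookup:
  "(\<Sum>a\<in>Poly_Mapping.keys f. Poly_Mapping.single a (Poly_Mapping.lookup f a)) = f"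
  by (rule poly_mapping_eqI) (simp add: lookup_sum lookup_single when_def in_keys_iff)

lemma kalg_induct [consumes 1, case_names zero single add]:
  assumes "f \<in> kalg S" and "P 0" and "\<And>u c. u \<in> S \<Longrightarrow> P (Poly_Mapping.single u c)"
    and "\<And>f g. f \<in> kalg S \<Longrightarrow> g \<in> kalg S \<Longrightarrow> P f \<Longrightarrow> P g \<Longrightarrow> P (f + g)"
  shows "P (f :: ('b, 'k::comm_monoid_add) alg)"
proof -
  have "(\<Sum>a\<in>A. Poly_Mapping.single a (Poly_Mapping.lookup f a)) \<in> kalg S \<and>
      P (\<Sum>a\<in>A. Poly_Mapping.single a (Poly_Mapping.lookup f a))" if "finite A" "A \<subseteq> S" for A
    using that by induction (auto intro: assms kalg_add kalg_single)
  from this[of "Poly_Mapping.keys f"] show ?thesis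
    using assms(1) by (simp add: sum_single_lookup kalg_def)
qed

lemma poly_mapping_add_induct [case_names zero single add]:
  assumes "P 0" and "\<And>u c. P (Poly_Mapping.single u c)" and "\<And>f g. P f \<Longrightarrow> P g \<Longrightarrow> P (f + g)"
  shows "P (f :: 'a \<Rightarrow>\<^sub>0 'c::comm_monoid_add)"
proof -
  have "P (\<Sum>a\<in>A. Poly_Mapping.single a (Poly_Mapping.lookup f a))" if "finite A" for A
    using that by induction (auto intro: assms)
  from this[of "Poly_Mapping.keys f"] show ?thesis by (simp add: sum_single_lookup)
qed

section \<open>Pushforward along maps of indices and of exponents\<close>

lemma push_zero [simp]: "push \<phi> 0 = 0"
  by (simp add: push_def)

lemma push_add: "push \<phi> (f + g) = push \<phi> f + push \<phi> g"
  unfolding push_def by (rule setsum_keys_plus_distrib) (simp_all add: single_add)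

lemma push_single [simp]: "push \<phi> (Poly_Mapping.single a c) = Poly_Mapping.single (\<phi> a) c"
  by (cases "c = 0") (simp_all add: push_def)

lemma smul_single: "g \<odot> Poly_Mapping.single a c = Poly_Mapping.single a (g * c)"
  by (rule poly_mapping_eqI) (simp add: lookup_single mult_when)

lemma push_smul: "push \<phi> (g \<odot> u) = g \<odot> push \<phi> u"
proof (induction u rule: poly_mapping_add_induct)
  case (single u c)
  show ?case by (simp add: smul_single)
qed (simp_all add: push_add smul_add_right)

lemma push_id: "push (\<lambda>a. a) f = f"
  by (simp add: push_def sum_single_lookup)

text \<open>These are the Z[x]-linear maps of exponents; \<open>push \<psi>\<close> is then a
  homomorphism of sigma-algebras. It is applied to the identity (restriction of points), to the two
  summand embeddings (projections of a product) and to the diagonal v -> (v, v) (the torus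
  action).\<close>

locale additive_map =
  fixes \<psi> :: "'b expo \<Rightarrow> 'c expo"
  assumes add: "\<psi> (u + v) = \<psi> u + \<psi> v" and smul: "\<psi> (g \<odot> u) = g \<odot> \<psi> u"
begin

lemma zero [simp]: "\<psi> 0 = 0"
  using add[of 0 0] by simp

lemma push_mult: "push \<psi> (f * g) = push \<psi> f * (push \<psi> g :: ('c, 'k::comm_ring_1) alg)"
proof (induction f rule: poly_mapping_add_induct)
  case (single u c)
  show ?case
    by (induction g rule: poly_mapping_add_induct) (simp_all add: push_add mult_single add algebra_simps)
qed (simp_all add: push_add algebra_simps)

lemma push_one: "push \<psi> 1 = (1 :: ('c, 'k::comm_ring_1) alg)"
  using push_single[of \<psi> 0 "1::'k"] by simp

lemma push_chi: "push \<psi> (chi u) = chi (\<psi> u)"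
  by (simp add: chi_def)

lemma push_kalg: "f \<in> kalg S \<Longrightarrow> \<psi> ` S \<subseteq> T \<Longrightarrow> push \<psi> f \<in> kalg T"
  by (induction f rule: kalg_induct) (auto simp: push_add intro: kalg_single kalg_add)

end

lemma additive_map_id: "additive_map (\<lambda>u. u)"
  by unfold_locales auto

lemma additive_map_push: "additive_map (push \<phi>)"
  by unfold_locales (simp_all add: push_add push_smul)

locale sigma_base =
  fixes \<sigma> :: "'k::field_char_0 \<Rightarrow> 'k"
  assumes sigma_field: "sigma_field \<sigma>"
begin

section \<open>The endomorphism sigma of k[S] and sigma-powers of characters\<close>

lemma sigma_add: "\<sigma> (a + b) = \<sigma> a + \<sigma> b" and sigma_mult: "\<sigma> (a * b) = \<sigma> a * \<sigma> b"
  and sigma_one: "\<sigma> 1 = 1"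
  using sigma_field by (auto simp: sigma_field_def ring_hom_def class_ring_def)

lemma sigma_zero [simp]: "\<sigma> 0 = 0"
  using sigma_add[of 0 0] by simp

lemma sigma_eq_0_iff: "\<sigma> a = 0 \<longleftrightarrow> a = 0"
  by (metis sigma_zero sigma_one sigma_mult mult_zero_left right_inverse zero_neq_one)

lemma alg_sigma_zero [simp]: "alg_sigma \<sigma> 0 = 0"
  by (simp add: alg_sigma_def)

lemma alg_sigma_add: "alg_sigma \<sigma> (f + g) = alg_sigma \<sigma> f + alg_sigma \<sigma> g"
  unfolding alg_sigma_def
  by (rule setsum_keys_plus_distrib) (simp_all add: sigma_add single_add)

lemma alg_sigma_single:
  "alg_sigma \<sigma> (Poly_Mapping.single u c) = Poly_Mapping.single ([:0, 1:] \<odot> u) (\<sigma> c)"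
  by (cases "c = 0") (simp_all add: alg_sigma_def)

lemma alg_sigma_chi: "alg_sigma \<sigma> (chi u) = chi ([:0, 1:] \<odot> u)"
  by (simp add: chi_def alg_sigma_single sigma_one)

lemma alg_sigma_one: "alg_sigma \<sigma> 1 = 1"
  using alg_sigma_chi[of 0] by (simp add: chi_zero)

lemma alg_sigma_mult: "alg_sigma \<sigma> (f * g) = alg_sigma \<sigma> f * alg_sigma \<sigma> g"
proof (induction f rule: poly_mapping_add_induct)
  case (single u c)
  show ?case
    by (induction g rule: poly_mapping_add_induct)
      (simp_all add: alg_sigma_add alg_sigma_single mult_single sigma_mult smul_add_right algebra_simps)
qed (simp_all add: alg_sigma_add algebra_simps)

lemma alg_sigma_kalg:
  assumes "pointed S" and "f \<in> kalg S"
  shows "alg_sigma \<sigma> f \<in> kalg S"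
  using assms(2)
  by (induction f rule: kalg_induct)
    (simp_all add: alg_sigma_add alg_sigma_single kalg_single kalg_add pointed_x[OF assms(1)])

text \<open>Multiplication by x is injective on exponents, so applying sigma merges no two terms.
  Injectivity of \<open>alg_sigma\<close> follows coefficientwise.\<close>

lemma lookup_alg_sigma: "Poly_Mapping.lookup (alg_sigma \<sigma> f) ([:0, 1:] \<odot> u) = \<sigma> (Poly_Mapping.lookup f u)"
  by (induction f rule: poly_mapping_add_induct)
    (simp_all add: alg_sigma_add lookup_add sigma_add alg_sigma_single lookup_single smul_x_inj when_def)

lemma alg_sigma_eq_0_iff: "alg_sigma \<sigma> f = 0 \<longleftrightarrow> f = 0"
proof
  assume "alg_sigma \<sigma> f = 0"
  then have "\<sigma> (Poly_Mapping.lookup f u) = 0" for u by (metis lookup_alg_sigma lookup_zero)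
  then show "f = 0" by (intro poly_mapping_eqI) (simp add: sigma_eq_0_iff)
qed simp

lemma (in additive_map) push_alg_sigma:
  assumes "sigma_field \<sigma>"
  shows "push \<psi> (alg_sigma \<sigma> f) = alg_sigma \<sigma> (push \<psi> f)"
proof -
  interpret sigma_base \<sigma> by unfold_locales fact
  show ?thesis
    by (induction f rule: poly_mapping_add_induct)
      (simp_all add: push_add alg_sigma_add alg_sigma_single smul)
qed

lemma kalg_funpow_alg_sigma: "pointed S \<Longrightarrow> f \<in> kalg S \<Longrightarrow> (alg_sigma \<sigma> ^^ i) f \<in> kalg S"
  by (induction i) (auto intro: alg_sigma_kalg)

lemma funpow_alg_sigma_chi: "(alg_sigma \<sigma> ^^ i) (chi u) = chi (monom 1 i \<odot> u)"
proof (induction i)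
  case (Suc i)
  have "[:0, 1:] * monom 1 i = (monom 1 (Suc i) :: int poly)"
    by (simp add: monom_Suc)
  with Suc show ?case by (simp add: alg_sigma_chi smul_smul)
qed simp

lemma chi_power: "chi u ^ n = (chi (of_nat n \<odot> u) :: ('b, 'k) alg)"
  by (induction n) (simp_all add: chi_zero smul_add_left chi_add)

lemma chi_sum: "finite A \<Longrightarrow> (\<Prod>i\<in>A. chi (f i)) = (chi (\<Sum>i\<in>A. f i) :: ('b, 'k) alg)"
  by (induction A rule: finite_induct) (simp_all add: chi_zero chi_add)

lemma smul_sum_left: "(\<Sum>i\<in>A. g i \<odot> u) = (\<Sum>i\<in>A. g i) \<odot> u"
  by (induction A rule: infinite_finite_induct) (simp_all add: smul_add_left)

text \<open>The dictionary between the denominators allowed in \<open>regular_map\<close> and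
  multiples of u: the sequence c becomes the polynomial with coefficients c_i.\<close>

lemma sigma_prod_chi: "sigma_prod \<sigma> (chi u) c = chi (natpoly_of c \<odot> u)"
proof -
  have "of_nat n * monom 1 i = (monom (int n) i :: int poly)" for n i
    by (simp add: of_nat_poly smult_monom)
  then show ?thesis
    unfolding sigma_prod_def natpoly_of_def
    by (simp add: funpow_alg_sigma_chi chi_power smul_smul chi_sum smul_sum_left)
qed

lemma sigma_prod_zero: "sigma_prod \<sigma> f 0 = 1"
  by (simp add: sigma_prod_def)

section \<open>Prime ideals and \<open>K\<close>-points\<close>

text \<open>Reflexive prime sigma-ideals, spelled out without the algebraic records. The equivalence
  for sigma replaces the quantification over all sigma-products, and closure under negation comes
  from multiplying by -1.\<close>

definition sigma_prime :: "'b expo set \<Rightarrow> ('b, 'k) alg set \<Rightarrow> bool" where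
  "sigma_prime S \<pp> \<longleftrightarrow> \<pp> \<subseteq> kalg S \<and> 0 \<in> \<pp> \<and> 1 \<notin> \<pp> \<and>
     (\<forall>f\<in>\<pp>. \<forall>g\<in>\<pp>. f + g \<in> \<pp>) \<and> (\<forall>f\<in>\<pp>. \<forall>g\<in>kalg S. f * g \<in> \<pp>) \<and>
     (\<forall>f\<in>kalg S. \<forall>g\<in>kalg S. f * g \<in> \<pp> \<longrightarrow> f \<in> \<pp> \<or> g \<in> \<pp>) \<and>
     (\<forall>f\<in>kalg S. alg_sigma \<sigma> f \<in> \<pp> \<longleftrightarrow> f \<in> \<pp>)"

lemma sigma_primeI:
  assumes "\<pp> \<subseteq> kalg S" "0 \<in> \<pp>" "1 \<notin> \<pp>"
    and "\<And>f g. f \<in> \<pp> \<Longrightarrow> g \<in> \<pp> \<Longrightarrow> f + g \<in> \<pp>"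
    and "\<And>f g. f \<in> \<pp> \<Longrightarrow> g \<in> kalg S \<Longrightarrow> f * g \<in> \<pp>"
    and "\<And>f g. f \<in> kalg S \<Longrightarrow> g \<in> kalg S \<Longrightarrow> f * g \<in> \<pp> \<Longrightarrow> f \<in> \<pp> \<or> g \<in> \<pp>"
    and "\<And>f. f \<in> kalg S \<Longrightarrow> alg_sigma \<sigma> f \<in> \<pp> \<longleftrightarrow> f \<in> \<pp>"
  shows "sigma_prime S \<pp>"
  unfolding sigma_prime_def by (intro conjI ballI impI) (rule assms; assumption)+

lemma sigma_primeD:
  assumes "sigma_prime S \<pp>"
  shows sigma_prime_subset: "\<pp> \<subseteq> kalg S"
    and sigma_prime_zero: "0 \<in> \<pp>"
    and sigma_prime_one: "1 \<notin> \<pp>"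
    and sigma_prime_add: "f \<in> \<pp> \<Longrightarrow> g \<in> \<pp> \<Longrightarrow> f + g \<in> \<pp>"
    and sigma_prime_ideal: "f \<in> \<pp> \<Longrightarrow> g \<in> kalg S \<Longrightarrow> f * g \<in> \<pp>"
    and sigma_prime_mult_iff: "f \<in> kalg S \<Longrightarrow> g \<in> kalg S \<Longrightarrow> f * g \<in> \<pp> \<longleftrightarrow> f \<in> \<pp> \<or> g \<in> \<pp>"
    and sigma_prime_sigma_iff: "f \<in> kalg S \<Longrightarrow> alg_sigma \<sigma> f \<in> \<pp> \<longleftrightarrow> f \<in> \<pp>"
proof -
  show "f \<in> kalg S \<Longrightarrow> g \<in> kalg S \<Longrightarrow> f * g \<in> \<pp> \<longleftrightarrow> f \<in> \<pp> \<or> g \<in> \<pp>"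
    using assms unfolding sigma_prime_def by (metis mult.commute)
qed (use assms in \<open>simp_all add: sigma_prime_def\<close>)

lemma sigma_prime_prod:
  assumes p: "sigma_prime S \<pp>" and S: "pointed S" and "finite A"
    and "\<And>i. i \<in> A \<Longrightarrow> f i \<in> kalg S" and "(\<Prod>i\<in>A. f i ^ n i) \<in> \<pp>"
  shows "\<exists>i\<in>A. f i \<in> \<pp>"
  using assms(3-)
proof (induction A rule: finite_induct)
  case empty
  then show ?case using sigma_prime_one[OF p] by simp
next
  case (insert i A)
  have fi: "f i \<in> kalg S" using insert.prems(1) by simp
  have "f i ^ m \<in> \<pp> \<Longrightarrow> f i \<in> \<pp>" for m
    by (induction m) (auto simp: sigma_prime_one[OF p] sigma_prime_mult_iff[OF p fi kalg_power[OF S fi]])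
  moreover have "f i ^ n i * (\<Prod>i\<in>A. f i ^ n i) \<in> \<pp>" using insert by simp
  then have "f i ^ n i \<in> \<pp> \<or> (\<Prod>i\<in>A. f i ^ n i) \<in> \<pp>"
    using S insert.prems(1) by (subst (asm) sigma_prime_mult_iff[OF p]) (auto intro!: kalg_power kalg_prod)
  ultimately show ?case using insert by blast
qed

text \<open>Primeness isolates one factor sigma^i(f), and reflexivity strips sigma^i. For c = 0 the
  product is 1, which lies in no such ideal.\<close>

lemma sigma_prime_sigma_prod:
  assumes p: "sigma_prime S \<pp>" and S: "pointed S" and f: "f \<in> kalg S"
    and c: "sigma_prod \<sigma> f c \<in> \<pp>"
  shows "f \<in> \<pp>"
proof -
  have "(alg_sigma \<sigma> ^^ i) f \<in> \<pp> \<Longrightarrow> f \<in> \<pp>" for i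
    by (induction i) (simp_all add: sigma_prime_sigma_iff[OF p kalg_funpow_alg_sigma[OF S f]])
  moreover have "\<exists>i\<in>Poly_Mapping.keys c. (alg_sigma \<sigma> ^^ i) f \<in> \<pp>"
    by (rule sigma_prime_prod[OF p S finite_keys _ c[unfolded sigma_prod_def]])
      (rule kalg_funpow_alg_sigma[OF S f])
  ultimately show ?thesis by blast
qed

lemma cring_kalg:
  assumes S: "pointed S"
  shows "cring (class_ring (kalg S :: ('b, 'k) alg set))"
proof (rule cringI)
  show "abelian_group (class_ring (kalg S :: ('b, 'k) alg set))"
  proof (rule abelian_groupI)
    fix f :: "('b, 'k) alg" assume "f \<in> carrier (class_ring (kalg S))"
    then show "\<exists>y\<in>carrier (class_ring (kalg S)). y \<oplus>\<^bsub>class_ring (kalg S)\<^esub> f = \<zero>\<^bsub>class_ring (kalg S)\<^esub>"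
      by (intro bexI[of _ "- f"]) (simp_all add: class_ring_def kalg_uminus)
  qed (simp_all add: class_ring_def kalg_add ac_simps)
  show "Group.comm_monoid (class_ring (kalg S :: ('b, 'k) alg set))"
    using S by (intro comm_monoidI) (simp_all add: class_ring_def ac_simps kalg_mult kalg_one)
  show "(f \<oplus>\<^bsub>class_ring (kalg S)\<^esub> g) \<otimes>\<^bsub>class_ring (kalg S)\<^esub> h =
      f \<otimes>\<^bsub>class_ring (kalg S)\<^esub> h \<oplus>\<^bsub>class_ring (kalg S)\<^esub> g \<otimes>\<^bsub>class_ring (kalg S)\<^esub> h"
    for f g h :: "('b, 'k) alg"
    by (simp add: class_ring_def distrib_right)
qed

text \<open>The condition on \<open>\<chi>\<^sup>g\<^sup>u\<close> is automatic, since \<open>g - 1 \<in> P[x]\<close> for \<open>g \<in> P[x]\<^sup>*\<close>.\<close>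

lemma Px_diff_one:
  assumes "g \<in> Px - {0}"
  shows "g - 1 \<in> Px"
proof (cases "degree g = 0")
  case True
  then obtain c where "g = [:c:]" by (rule degree_eq_zeroE)
  with assms show ?thesis by (auto simp: Px_def one_pCons)
next
  case False
  then have "degree (g - 1) = degree g"
    using degree_add_eq_left[of "- 1" g] by simp
  with False assms show ?thesis by (auto simp: Px_def)
qed

lemma Psigma_prime_iff:
  fixes S :: "'b expo set" and \<pp> :: "('b, 'k) alg set"
  assumes S: "pointed S"
  shows "Psigma_prime \<sigma> S \<pp> \<longleftrightarrow> sigma_prime S \<pp>"
proof
  assume "Psigma_prime \<sigma> S \<pp>"
  then have pr: "primeideal \<pp> (class_ring (kalg S))" and s: "alg_sigma \<sigma> ` \<pp> \<subseteq> \<pp>"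
    and c: "\<And>a c. a \<in> kalg S \<Longrightarrow> c \<noteq> 0 \<Longrightarrow> sigma_prod \<sigma> a c \<in> \<pp> \<Longrightarrow> a \<in> \<pp>"
    unfolding Psigma_prime_def by auto
  interpret primeideal \<pp> "class_ring (kalg S)" by fact
  have refl: "f \<in> \<pp>" if "f \<in> kalg S" "alg_sigma \<sigma> f \<in> \<pp>" for f
  proof -
    \<comment> \<open>For this exponent sequence, the polynomial x, the sigma-product of f is
      sigma(f) itself, so the closure condition yields reflexivity.\<close>
    have "Poly_Mapping.single 1 1 \<noteq> (0 :: nat \<Rightarrow>\<^sub>0 nat)"
      by (metis lookup_single_eq lookup_zero zero_neq_one)
    then show ?thesis
      using c[of f "Poly_Mapping.single 1 1"] that by (simp add: sigma_prod_def)
  qed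
  have "1 \<notin> \<pp>"
    using one_imp_carrier I_notcarr by (auto simp: class_ring_def)
  show "sigma_prime S \<pp>"
  proof (rule sigma_primeI)
    show "1 \<notin> \<pp>"
      using one_imp_carrier I_notcarr by (auto simp: class_ring_def)
    show "\<pp> \<subseteq> kalg S" using a_subset by (simp add: class_ring_def)
    show "0 \<in> \<pp>"
      using additive_subgroup.zero_closed[OF additive_subgroup_axioms] by (simp add: class_ring_def)
    show "f + g \<in> \<pp>" if "f \<in> \<pp>" "g \<in> \<pp>" for f g
      using additive_subgroup.a_closed[OF additive_subgroup_axioms that] by (simp add: class_ring_def)
    show "f * g \<in> \<pp>" if "f \<in> \<pp>" "g \<in> kalg S" for f g
      using I_r_closed[of f g] that by (simp add: class_ring_def)
    show "f \<in> \<pp> \<or> g \<in> \<pp>" if "f \<in> kalg S" "g \<in> kalg S" "f * g \<in> \<pp>" for f g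
      using I_prime[of f g] that by (simp add: class_ring_def)
    show "alg_sigma \<sigma> f \<in> \<pp> \<longleftrightarrow> f \<in> \<pp>" if "f \<in> kalg S" for f
      using refl[OF that] s by blast
  qed
next
  assume p: "sigma_prime S \<pp>"
  interpret cring "class_ring (kalg S :: ('b, 'k) alg set)" using S by (rule cring_kalg)
  have neg: "- f \<in> \<pp>" if "f \<in> \<pp>" for f
    using sigma_prime_ideal[OF p that kalg_uminus[OF kalg_one[OF S]]] by simp
  have inv: "inv\<^bsub>add_monoid (class_ring (kalg S))\<^esub> f = - f" if "f \<in> kalg S" for f :: "('b, 'k) alg"
    using minus_equality[of "- f" f] that kalg_uminus[OF that]
    by (simp add: class_ring_def a_inv_def)
  have "ideal \<pp> (class_ring (kalg S))"
  proof (rule idealI)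
    show "subgroup \<pp> (add_monoid (class_ring (kalg S)))"
      using sigma_prime_subset[OF p] sigma_prime_zero[OF p] sigma_prime_add[OF p] neg inv
      by (intro subgroup.intro) (auto simp: class_ring_def)
    show "ring (class_ring (kalg S :: ('b, 'k) alg set))" by (rule ring_axioms)
    fix f g :: "('b, 'k) alg" assume "f \<in> \<pp>" "g \<in> carrier (class_ring (kalg S))"
    then show "f \<otimes>\<^bsub>class_ring (kalg S)\<^esub> g \<in> \<pp>" "g \<otimes>\<^bsub>class_ring (kalg S)\<^esub> f \<in> \<pp>"
      using sigma_prime_ideal[OF p] by (simp_all add: class_ring_def mult.commute)
  qed
  then have "primeideal \<pp> (class_ring (kalg S))"
  proof (rule primeidealI[OF _ is_cring])
    show "carrier (class_ring (kalg S)) \<noteq> \<pp>"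
      using sigma_prime_one[OF p] kalg_one[OF S] by (auto simp: class_ring_def)
  qed (simp add: class_ring_def sigma_prime_mult_iff[OF p])
  moreover have "chi (g \<odot> u) * f \<in> \<pp>"
    if "u \<in> S" "f \<in> kalg S" "chi u * f \<in> \<pp>" "g \<in> Px - {0}" for u f g
  proof -
    \<comment> \<open>Since (g - 1) u still lies in S, the new element is an ordinary multiple of
      the given one.\<close>
    have "chi (u + (g - 1) \<odot> u) * f = chi u * f * chi ((g - 1) \<odot> u)"
      by (simp only: chi_add ac_simps)
    moreover have "u + (g - 1) \<odot> u = g \<odot> u" by (simp add: smul_diff_left)
    moreover have "chi u * f * chi ((g - 1) \<odot> u) \<in> \<pp>"
      by (rule sigma_prime_ideal[OF p that(3) kalg_chi[OF pointed_smul[OF S Px_diff_one[OF that(4)] that(1)]]])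
    ultimately show ?thesis by simp
  qed
  moreover have "alg_sigma \<sigma> ` \<pp> \<subseteq> \<pp>"
    using sigma_prime_sigma_iff[OF p] sigma_prime_subset[OF p] by auto
  ultimately show "Psigma_prime \<sigma> S \<pp>"
    unfolding Psigma_prime_def using sigma_prime_sigma_prod[OF p S] by blast
qed

section \<open>Prime ideals and K-points of Spec k[S]\<close>

lemma semi_Spec_alg [simp]: "semi (Spec_alg S) = S" "eqs (Spec_alg S) = {}"
  by (simp_all add: Spec_alg_def)

lemma spec_iff: "pointed S \<Longrightarrow> \<pp> \<in> spec \<sigma> (Spec_alg S) \<longleftrightarrow> sigma_prime S \<pp>"
  by (simp add: spec_def Psigma_prime_iff)

lemma kpts_iff:
  "h \<in> kpts \<sigma> (Spec_alg S) K \<longleftrightarrow> h \<in> extensional (kalg S) \<and> (\<forall>f\<in>kalg S. h f \<in> carrier K) \<and>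
     (\<forall>f\<in>kalg S. \<forall>g\<in>kalg S. h (f + g) = h f \<oplus>\<^bsub>K\<^esub> h g \<and> h (f * g) = h f \<otimes>\<^bsub>K\<^esub> h g) \<and>
     h 1 = \<one>\<^bsub>K\<^esub> \<and> (\<forall>c. h (Poly_Mapping.single 0 c) = ext_emb K c) \<and>
     (\<forall>f\<in>kalg S. h (alg_sigma \<sigma> f) = ext_sigma K (h f))"
  by (auto simp: kpts_def ring_hom_def class_ring_def)

lemma kptsD:
  assumes "h \<in> kpts \<sigma> (Spec_alg S) K"
  shows kpts_ext: "h \<in> extensional (kalg S)"
    and kpts_closed: "f \<in> kalg S \<Longrightarrow> h f \<in> carrier K"
    and kpts_add: "f \<in> kalg S \<Longrightarrow> g \<in> kalg S \<Longrightarrow> h (f + g) = h f \<oplus>\<^bsub>K\<^esub> h g"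
    and kpts_mult: "f \<in> kalg S \<Longrightarrow> g \<in> kalg S \<Longrightarrow> h (f * g) = h f \<otimes>\<^bsub>K\<^esub> h g"
    and kpts_one: "h 1 = \<one>\<^bsub>K\<^esub>"
    and kpts_const: "h (Poly_Mapping.single 0 c) = ext_emb K c"
    and kpts_sigma: "f \<in> kalg S \<Longrightarrow> h (alg_sigma \<sigma> f) = ext_sigma K (h f)"
  using assms by (auto simp: kpts_iff)

lemma sigma_extD:
  assumes "sigma_ext \<sigma> K"
  shows sigma_ext_field: "field K"
    and ext_sigma_closed: "x \<in> carrier K \<Longrightarrow> ext_sigma K x \<in> carrier K"
    and ext_sigma_add: "x \<in> carrier K \<Longrightarrow> y \<in> carrier K \<Longrightarrow> ext_sigma K (x \<oplus>\<^bsub>K\<^esub> y) = ext_sigma K x \<oplus>\<^bsub>K\<^esub> ext_sigma K y"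
    and ext_sigma_mult: "x \<in> carrier K \<Longrightarrow> y \<in> carrier K \<Longrightarrow> ext_sigma K (x \<otimes>\<^bsub>K\<^esub> y) = ext_sigma K x \<otimes>\<^bsub>K\<^esub> ext_sigma K y"
    and ext_sigma_one: "ext_sigma K \<one>\<^bsub>K\<^esub> = \<one>\<^bsub>K\<^esub>"
    and ext_emb_closed: "ext_emb K c \<in> carrier K"
    and ext_emb_add: "ext_emb K (c + d) = ext_emb K c \<oplus>\<^bsub>K\<^esub> ext_emb K d"
    and ext_emb_mult: "ext_emb K (c * d) = ext_emb K c \<otimes>\<^bsub>K\<^esub> ext_emb K d"
    and ext_emb_one: "ext_emb K 1 = \<one>\<^bsub>K\<^esub>"
    and ext_emb_sigma: "ext_emb K (\<sigma> c) = ext_sigma K (ext_emb K c)"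
  using assms by (auto simp: sigma_ext_def ring_hom_def class_ring_def)

lemma ext_zero:
  assumes "sigma_ext \<sigma> K"
  shows ext_emb_zero: "ext_emb K 0 = \<zero>\<^bsub>K\<^esub>"
    and ext_sigma_eq_zero_iff: "x \<in> carrier K \<Longrightarrow> ext_sigma K x = \<zero>\<^bsub>K\<^esub> \<longleftrightarrow> x = \<zero>\<^bsub>K\<^esub>"
proof -
  interpret K: field K using assms by (rule sigma_ext_field)
  have idem: "x = \<zero>\<^bsub>K\<^esub>" if "x \<in> carrier K" "x = x \<oplus>\<^bsub>K\<^esub> x" for x
    using that K.add.l_cancel_one' by metis
  show "ext_emb K 0 = \<zero>\<^bsub>K\<^esub>"
    using idem ext_emb_closed[OF assms] ext_emb_add[OF assms, of 0 0] by simp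
  have z: "ext_sigma K \<zero>\<^bsub>K\<^esub> = \<zero>\<^bsub>K\<^esub>"
    using idem ext_sigma_closed[OF assms] ext_sigma_add[OF assms, of "\<zero>\<^bsub>K\<^esub>" "\<zero>\<^bsub>K\<^esub>"] by simp
  show "ext_sigma K x = \<zero>\<^bsub>K\<^esub> \<longleftrightarrow> x = \<zero>\<^bsub>K\<^esub>" if x: "x \<in> carrier K"
  proof
    assume 0: "ext_sigma K x = \<zero>\<^bsub>K\<^esub>"
    show "x = \<zero>\<^bsub>K\<^esub>"
    proof (rule ccontr)
      assume "x \<noteq> \<zero>\<^bsub>K\<^esub>"
      then have u: "x \<in> Units K" using x by (simp add: K.field_Units)
      then have "ext_sigma K x \<otimes>\<^bsub>K\<^esub> ext_sigma K (inv\<^bsub>K\<^esub> x) = \<one>\<^bsub>K\<^esub>"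
        by (metis K.Units_closed K.Units_inv_closed K.Units_r_inv assms ext_sigma_mult ext_sigma_one)
      with 0 u show False using ext_sigma_closed[OF assms] by simp
    qed
  qed (simp add: z)
qed

lemma kpts_zero: "sigma_ext \<sigma> K \<Longrightarrow> h \<in> kpts \<sigma> (Spec_alg S) K \<Longrightarrow> h 0 = \<zero>\<^bsub>K\<^esub>"
  using kpts_const[of h S K 0] ext_emb_zero by simp

text \<open>Primeness holds because K is a field, reflexivity because sigma is injective on K.
  Through this the openness conditions, phrased by \<open>support\<close>, apply to K-points as they
  do to prime ideals.\<close>

lemma kpts_kernel:
  assumes S: "pointed S" and K: "sigma_ext \<sigma> K" and h: "h \<in> kpts \<sigma> (Spec_alg S) K"
  shows "sigma_prime S {f \<in> kalg S. h f = \<zero>\<^bsub>K\<^esub>}"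
proof -
  interpret K: field K using K by (rule sigma_ext_field)
  show ?thesis
    by (rule sigma_primeI)
      (auto simp: kpts_zero[OF K h] kpts_one[OF h] kpts_add[OF h] kpts_mult[OF h] kpts_sigma[OF h]
        kpts_closed[OF h] ext_sigma_eq_zero_iff[OF K] K.integral_iff
        kalg_add kalg_mult[OF S] alg_sigma_kalg[OF S])
qed

lemma kpts_eqI:
  assumes S: "pointed S" and K: "sigma_ext \<sigma> K"
    and h: "h \<in> kpts \<sigma> (Spec_alg S) K" and h': "h' \<in> kpts \<sigma> (Spec_alg S) K"
    and eq: "\<And>u. u \<in> S \<Longrightarrow> h (chi u) = h' (chi u)"
  shows "h = h'"
proof (rule extensionalityI)
  show "h \<in> extensional (kalg S)" "h' \<in> extensional (kalg S)" using h h' by (simp_all add: kpts_iff)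
  fix f :: "('a, 'k) alg" assume "f \<in> kalg S"
  then show "h f = h' f"
  proof (induction f rule: kalg_induct)
    case zero
    show ?case using kpts_zero[OF K h] kpts_zero[OF K h'] by simp
  next
    case (single u c)
    then show ?case
      unfolding single_eq_chi[of u c]
      using kpts_mult[OF h kalg_single[OF pointed_zero[OF S]] kalg_chi]
        kpts_mult[OF h' kalg_single[OF pointed_zero[OF S]] kalg_chi] eq
        kpts_const[OF h] kpts_const[OF h'] by simp
  next
    case (add f g)
    then show ?case using kpts_add[OF h] kpts_add[OF h'] by simp
  qed
qed

lemma kpt_of_map_chi:
  assumes K: "sigma_ext \<sigma> K" and u: "u \<in> S" "\<phi> u \<in> carrier K"
  shows "kpt_of_map K S \<phi> (chi u) = \<phi> u"
proof -
  interpret K: field K using K by (rule sigma_ext_field)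
  show ?thesis
    using u by (simp add: kpt_of_map_def chi_def ext_emb_one[OF K] kalg_single)
qed

text \<open>The k-linear extension of a monoid map is multiplicative by checking single terms;
  compatibility with multiplication of exponents by x gives compatibility with sigma.\<close>

lemma kpt_of_map_kpts:
  assumes S: "pointed S" and K: "sigma_ext \<sigma> K"
    and closed: "\<And>u. u \<in> S \<Longrightarrow> \<phi> u \<in> carrier K"
    and zero: "\<phi> 0 = \<one>\<^bsub>K\<^esub>"
    and add: "\<And>u v. u \<in> S \<Longrightarrow> v \<in> S \<Longrightarrow> \<phi> (u + v) = \<phi> u \<otimes>\<^bsub>K\<^esub> \<phi> v"
    and sig: "\<And>u. u \<in> S \<Longrightarrow> \<phi> ([:0, 1:] \<odot> u) = ext_sigma K (\<phi> u)"
  shows "kpt_of_map K S \<phi> \<in> kpts \<sigma> (Spec_alg S) K"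
proof -
  interpret K: field K using K by (rule sigma_ext_field)
  note emb = ext_emb_closed[OF K]
  define H where "H f = finsum K (\<lambda>u. ext_emb K (Poly_Mapping.lookup f u) \<otimes>\<^bsub>K\<^esub> \<phi> u) (Poly_Mapping.keys f)"
    for f :: "('a, 'k) alg"
  \<comment> \<open>The support of f + g can be smaller than the union of the supports. Enlarging
    the index set is harmless since the extra coefficients are 0, and it puts all sums over the same
    set.\<close>
  have sup: "H f = finsum K (\<lambda>u. ext_emb K (Poly_Mapping.lookup f u) \<otimes>\<^bsub>K\<^esub> \<phi> u) A"
    if "finite A" "Poly_Mapping.keys f \<subseteq> A" "A \<subseteq> S" for f A
    unfolding H_def using that closed emb
    by (intro K.add.finprod_mono_neutral_cong_left)
      (auto simp: in_keys_iff ext_emb_zero[OF K] intro!: K.m_closed K.l_null)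
  have closedH: "H f \<in> carrier K" if "f \<in> kalg S" for f
    unfolding H_def using that closed emb by (intro K.finsum_closed) (auto simp: kalg_def)
  have addH: "H (f + g) = H f \<oplus>\<^bsub>K\<^esub> H g" if "f \<in> kalg S" "g \<in> kalg S" for f g
  proof -
    let ?A = "Poly_Mapping.keys f \<union> Poly_Mapping.keys g"
    have A: "?A \<subseteq> S" using that by (auto simp: kalg_def)
    have "H (f + g) = finsum K (\<lambda>u. ext_emb K (Poly_Mapping.lookup (f + g) u) \<otimes>\<^bsub>K\<^esub> \<phi> u) ?A"
      using A Poly_Mapping.keys_add[of f g] by (intro sup) auto
    also have "\<dots> = finsum K (\<lambda>u. ext_emb K (Poly_Mapping.lookup f u) \<otimes>\<^bsub>K\<^esub> \<phi> u \<oplus>\<^bsub>K\<^esub>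
        ext_emb K (Poly_Mapping.lookup g u) \<otimes>\<^bsub>K\<^esub> \<phi> u) ?A"
      using A closed emb
      by (intro K.add.finprod_cong') (auto simp: lookup_add ext_emb_add[OF K] intro!: K.l_distr)
    also have "\<dots> = finsum K (\<lambda>u. ext_emb K (Poly_Mapping.lookup f u) \<otimes>\<^bsub>K\<^esub> \<phi> u) ?A \<oplus>\<^bsub>K\<^esub>
        finsum K (\<lambda>u. ext_emb K (Poly_Mapping.lookup g u) \<otimes>\<^bsub>K\<^esub> \<phi> u) ?A"
      using A closed emb by (intro K.finsum_addf) auto
    also have "\<dots> = H f \<oplus>\<^bsub>K\<^esub> H g" using A by (subst (1 2) sup[of ?A]) auto
    finally show ?thesis .
  qed
  have singleH: "H (Poly_Mapping.single u c) = ext_emb K c \<otimes>\<^bsub>K\<^esub> \<phi> u" if "u \<in> S" for u c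
    using that closed emb by (subst sup[of "{u}"]) auto
  have zeroH: "H 0 = \<zero>\<^bsub>K\<^esub>" by (simp add: H_def)
  have multH: "H (f * g) = H f \<otimes>\<^bsub>K\<^esub> H g" if "f \<in> kalg S" "g \<in> kalg S" for f g
    using that(1)
  proof (induction f rule: kalg_induct)
    case zero
    show ?case using closedH that by (simp add: zeroH)
  next
    case (single u c)
    from that(2) show ?case
    proof (induction g rule: kalg_induct)
      case zero
      show ?case using K.r_null[OF closedH[OF kalg_single[OF single]]] by (simp add: zeroH)
    next
      case (single v d)
      then show ?case
        using \<open>u \<in> S\<close> closed emb pointed_add[OF S]
        by (simp add: mult_single singleH add ext_emb_mult[OF K] K.m_ac)
    next
      case (add f g)
      then show ?case
        using \<open>u \<in> S\<close> by (simp add: addH distrib_left K.r_distr closedH kalg_single kalg_mult[OF S])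
    qed
  next
    case (add f f')
    then show ?case
      using that by (simp add: addH distrib_right K.l_distr closedH kalg_mult[OF S])
  qed
  have sigH: "H (alg_sigma \<sigma> f) = ext_sigma K (H f)" if "f \<in> kalg S" for f
    using that
  proof (induction f rule: kalg_induct)
    case zero
    show ?case using ext_sigma_eq_zero_iff[OF K K.zero_closed] by (simp add: zeroH)
  next
    case (single u c)
    then show ?case
      using closed emb pointed_x[OF S]
      by (simp add: alg_sigma_single singleH sig ext_emb_sigma[OF K] ext_sigma_mult[OF K])
  next
    case (add f g)
    then show ?case
      using closedH alg_sigma_kalg[OF S] by (simp add: alg_sigma_add addH ext_sigma_add[OF K])
  qed
  have H: "kpt_of_map K S \<phi> = (\<lambda>f\<in>kalg S. H f)" by (simp add: kpt_of_map_def H_def)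
  have "H 1 = \<one>\<^bsub>K\<^esub>"
    using singleH[OF pointed_zero[OF S], of 1] by (simp add: zero ext_emb_one[OF K])
  then show ?thesis
    unfolding kpts_iff H
    by (simp add: addH multH sigH closedH singleH kalg_single pointed_zero[OF S] zero emb
        kalg_add kalg_mult[OF S] kalg_one[OF S] alg_sigma_kalg[OF S])
qed

end

section \<open>Pullback of points\<close>

text \<open>The map on points with comorphism \<open>push \<psi>\<close> from k[S]: preimages of
  prime ideals, composition for K-points. Restriction of points is the case of the identity.\<close>

fun pull_pt :: "('b expo \<Rightarrow> 'c expo) \<Rightarrow> 'b expo set \<Rightarrow> ('c, 'k::field_char_0, 'u) pt \<Rightarrow> ('b, 'k, 'u) pt" where
  "pull_pt \<psi> S (Prime \<pp>) = Prime {f \<in> kalg S. push \<psi> f \<in> \<pp>}"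
| "pull_pt \<psi> S (KPt K h) = KPt K (\<lambda>f\<in>kalg S. h (push \<psi> f))"

lemma restrict_pt_eq_pull_pt: "restrict_pt S z = pull_pt (\<lambda>u. u) S z"
  by (cases z) (auto simp: push_id)

lemma restrict_pt_restrict_pt:
  fixes z :: "('b, 'k::field_char_0, 'u) pt"
  assumes "S \<subseteq> R"
  shows "restrict_pt S (restrict_pt R z) = restrict_pt S z"
proof -
  have "kalg S \<subseteq> (kalg R :: ('b, 'k) alg set)" using assms by (rule kalg_mono)
  then show ?thesis by (cases z) (auto simp: fun_eq_iff restrict_def)
qed

context sigma_base
begin

lemma Prime_pts: "pointed S \<Longrightarrow> Prime \<pp> \<in> pts \<sigma> (Spec_alg S) \<longleftrightarrow> sigma_prime S \<pp>"
  by (auto simp: pts_def spec_iff)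

lemma KPt_pts: "KPt K h \<in> pts \<sigma> (Spec_alg S) \<longleftrightarrow> sigma_ext \<sigma> K \<and> h \<in> kpts \<sigma> (Spec_alg S) K"
  by (auto simp: pts_def)

lemma support_pts: "pointed S \<Longrightarrow> x \<in> pts \<sigma> (Spec_alg S) \<Longrightarrow> sigma_prime S (support (Spec_alg S) x)"
  by (cases x) (auto simp: Prime_pts KPt_pts kpts_kernel)

lemma pts_over_spec: "pointed S \<Longrightarrow> pts_over \<sigma> (Spec_alg S) (spec \<sigma> (Spec_alg S)) = pts \<sigma> (Spec_alg S)"
  by (auto simp: pts_over_def spec_iff support_pts)

lemma pts_over_basic_open:
  "pointed S \<Longrightarrow> x \<in> pts_over \<sigma> (Spec_alg S) (basic_open \<sigma> (Spec_alg S) e) \<longleftrightarrow>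
     x \<in> pts \<sigma> (Spec_alg S) \<and> e \<notin> support (Spec_alg S) x"
  by (auto simp: pts_over_def basic_open_def spec_iff support_pts)

lemma basic_open_one: "pointed S \<Longrightarrow> basic_open \<sigma> (Spec_alg S) 1 = spec \<sigma> (Spec_alg S)"
  by (auto simp: basic_open_def spec_iff sigma_prime_one)

lemma open_basic_open:
  assumes "e \<in> kalg S"
  shows "open_in_var \<sigma> (Spec_alg S) (basic_open \<sigma> (Spec_alg S) e)"
  unfolding open_in_var_def closed_in_var_def basic_open_def
  using assms by (auto intro!: exI[of _ "{e}"])

lemma open_spec: "pointed S \<Longrightarrow> open_in_var \<sigma> (Spec_alg S) (spec \<sigma> (Spec_alg S))"
  using open_basic_open[OF kalg_one, of S] by (simp add: basic_open_one)

context
  fixes \<psi> :: "'b expo \<Rightarrow> 'c expo" and S T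
  assumes psi: "additive_map \<psi>" and S: "pointed S" and T: "pointed T" and sub: "\<psi> ` S \<subseteq> T"
begin

interpretation psi: additive_map \<psi> by (rule psi)

lemma pull_sigma_prime:
  assumes p: "sigma_prime T \<pp>"
  shows "sigma_prime S {f \<in> kalg S. push \<psi> f \<in> \<pp>}"
  by (rule sigma_primeI)
    (auto simp: push_add psi.push_mult psi.push_one psi.push_alg_sigma[OF sigma_field] psi.push_kalg[OF _ sub]
      sigma_prime_zero[OF p] sigma_prime_one[OF p] sigma_prime_add[OF p] sigma_prime_mult_iff[OF p]
      sigma_prime_sigma_iff[OF p] kalg_add kalg_mult[OF S] alg_sigma_kalg[OF S])

lemma pull_kpts:
  assumes h: "h \<in> kpts \<sigma> (Spec_alg T) K"
  shows "(\<lambda>f\<in>kalg S. h (push \<psi> f)) \<in> kpts \<sigma> (Spec_alg S) K"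
  unfolding kpts_iff
  using kalg_one[OF S, where 'k = 'k]
  by (simp add: push_add psi.push_mult psi.push_one psi.push_alg_sigma[OF sigma_field] psi.push_kalg[OF _ sub]
      kpts_add[OF h] kpts_mult[OF h] kpts_one[OF h] kpts_closed[OF h] kpts_sigma[OF h] kpts_const[OF h]
      kalg_add kalg_mult[OF S] alg_sigma_kalg[OF S] kalg_single pointed_zero[OF S])

lemma pull_pts: "x \<in> pts \<sigma> (Spec_alg T) \<Longrightarrow> pull_pt \<psi> S x \<in> pts \<sigma> (Spec_alg S)"
  by (cases x) (simp_all add: Prime_pts S T KPt_pts pull_sigma_prime pull_kpts)

text \<open>The comorphism is defined globally, so e = 1 with the empty sigma-product as denominator
  works at every point.\<close>

lemma regular_pull_pt:
  "regular_map \<sigma> (Spec_alg T) (spec \<sigma> (Spec_alg T)) (Spec_alg S) (spec \<sigma> (Spec_alg S))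
     (pull_pt \<psi> S :: ('c, 'k, 'u) pt \<Rightarrow> _)"
  unfolding regular_map_def pts_over_spec[OF S] pts_over_spec[OF T]
proof (intro conjI ballI)
  fix \<pp> assume "\<pp> \<in> spec \<sigma> (Spec_alg T)"
  then have p: "sigma_prime T \<pp>" by (simp add: spec_iff T)
  have rep: "represents x (pull_pt \<psi> S x) f (push \<psi> f) (sigma_prod \<sigma> 1 0)"
    if f: "f \<in> kalg S" and x: "x \<in> pts \<sigma> (Spec_alg T)" for f and x :: "('c, 'k, 'u) pt"
  proof (cases x)
    case (Prime \<qq>)
    with f show ?thesis by simp
  next
    case (KPt K h)
    with x have K: "sigma_ext \<sigma> K" and h: "h \<in> kpts \<sigma> (Spec_alg T) K" by (auto simp: KPt_pts)
    interpret K: field K using K by (rule sigma_ext_field)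
    from KPt f show ?thesis
      using kpts_closed[OF h psi.push_kalg[OF f sub]] by (simp add: sigma_prod_zero kpts_one[OF h])
  qed
  show "\<exists>e\<in>kalg (semi (Spec_alg T)). e \<notin> \<pp> \<and> basic_open \<sigma> (Spec_alg T) e \<subseteq> spec \<sigma> (Spec_alg T) \<and>
      (\<forall>f\<in>kalg (semi (Spec_alg S)). \<exists>a\<in>kalg (semi (Spec_alg T)). \<exists>c.
        \<forall>x\<in>pts_over \<sigma> (Spec_alg T) (basic_open \<sigma> (Spec_alg T) e).
          represents (x :: ('c, 'k, 'u) pt) (pull_pt \<psi> S x) f a (sigma_prod \<sigma> e c))"
    using rep psi.push_kalg[OF _ sub] sigma_prime_one[OF p] kalg_one[OF T]
    by (intro bexI[of _ 1]) (auto simp: basic_open_one T pts_over_spec intro!: bexI exI[of _ 0])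
qed (rule pull_pts)

end

lemma restrict_pts:
  assumes "pointed S" "pointed T" "S \<subseteq> T" "z \<in> pts \<sigma> (Spec_alg T)"
  shows "restrict_pt S z \<in> pts \<sigma> (Spec_alg S)"
  unfolding restrict_pt_eq_pull_pt
  using assms by (intro pull_pts additive_map_id) auto

lemma restrict_pt_self:
  assumes "pointed T" "z \<in> pts \<sigma> (Spec_alg T)"
  shows "restrict_pt T z = z"
  using assms sigma_prime_subset
  by (cases z) (auto simp: Prime_pts KPt_pts kpts_iff extensional_restrict Int_absorb2)

lemma regular_restrict_pt:
  assumes "pointed S" "pointed T" "S \<subseteq> T"
  shows "regular_map \<sigma> (Spec_alg T) (spec \<sigma> (Spec_alg T)) (Spec_alg S) (spec \<sigma> (Spec_alg S))
     (restrict_pt S :: ('b, 'k, 'u) pt \<Rightarrow> _)"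
  unfolding restrict_pt_eq_pull_pt[abs_def]
  using assms by (intro regular_pull_pt additive_map_id) auto

end

section \<open>Localisation\<close>

locale localisation = sigma_base \<sigma> for \<sigma> :: "'k::field_char_0 \<Rightarrow> 'k" +
  fixes S T :: "'b expo set" and u :: "'b expo"
  assumes localises: "localises S T u"
begin

lemmas S = localises_pointed(1)[OF localises] and T = localises_pointed(2)[OF localises]
  and S_T = localises_subset[OF localises]

lemma u: "u \<in> S" using localises by (simp add: localises_def)

lemma kalg_S_T: "f \<in> kalg S \<Longrightarrow> f \<in> kalg T" using kalg_mono[OF S_T] by blast

definition denoms :: "('b, 'k) alg set" where
  "denoms = {chi (g \<odot> u) | g. natpoly g}"

lemma denoms_kalg: "d \<in> denoms \<Longrightarrow> d \<in> kalg S"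
  using S u by (auto simp: denoms_def intro: kalg_chi pointed_natpoly)

lemma denoms_one: "1 \<in> denoms"
  by (auto simp: denoms_def chi_zero intro!: exI[of _ 0])

lemma denoms_chi: "chi u \<in> denoms"
  by (auto simp: denoms_def intro!: exI[of _ 1])

lemma denoms_mult: "d \<in> denoms \<Longrightarrow> d' \<in> denoms \<Longrightarrow> d * d' \<in> denoms"
  unfolding denoms_def using natpoly_add by (auto simp flip: chi_add smul_add_left)

lemma denoms_sigma: "d \<in> denoms \<Longrightarrow> alg_sigma \<sigma> d \<in> denoms"
  unfolding denoms_def using natpoly_mult[OF natpoly_simps(3)]
  by (auto simp: alg_sigma_chi smul_smul simp del: mult_pCons_left)

lemma denoms_sigma_prod: "d \<in> denoms \<Longrightarrow> \<exists>c. d = sigma_prod \<sigma> (chi u) c"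
  unfolding denoms_def sigma_prod_chi by (blast elim: natpoly_ofE)

lemma denoms_unit:
  assumes "d \<in> denoms"
  obtains d' where "d' \<in> kalg T" "d' * d = 1"
proof -
  obtain g where "d = chi (g \<odot> u)" using assms by (auto simp: denoms_def)
  moreover have "chi (- (g \<odot> u)) \<in> (kalg T :: ('b, 'k) alg set)"
    using localises_uminus[OF localises] by (rule kalg_chi)
  ultimately show thesis using that chi_uminus by blast
qed

text \<open>A single term carries its own denominator; for a sum the product of the two denominators
  serves.\<close>

lemma clear_denoms:
  assumes "f \<in> kalg T"
  obtains d where "d \<in> denoms" "d * f \<in> kalg S"
proof -
  have "\<exists>d\<in>denoms. d * f \<in> kalg S"
    using assms
  proof (induction f rule: kalg_induct)
    case zero
    show ?case using denoms_one by auto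
  next
    case (single t c)
    then obtain s g where "s \<in> S" "natpoly g" "t = s - g \<odot> u"
      using add_span_uminusE[OF S u] localises unfolding localises_def by metis
    then show ?case
      by (intro bexI[of _ "chi (g \<odot> u)"]) (auto simp: chi_def mult_single kalg_single denoms_def)
  next
    case (add f g)
    then obtain d d' where d: "d \<in> denoms" "d * f \<in> kalg S" "d' \<in> denoms" "d' * g \<in> kalg S" by blast
    have "d * d' * (f + g) = (d * f) * d' + (d' * g) * d" by (simp add: algebra_simps)
    also have "\<dots> \<in> kalg S"
      using kalg_add[OF kalg_mult[OF S d(2) denoms_kalg[OF d(3)]] kalg_mult[OF S d(4) denoms_kalg[OF d(1)]]] .
    finally show ?case using denoms_mult[OF d(1,3)] by blast
  qed
  with that show thesis by blast
qed

lemma denoms_notin: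
  assumes "sigma_prime S \<pp>" "chi u \<notin> \<pp>" "d \<in> denoms"
  shows "d \<notin> \<pp>"
  using assms denoms_sigma_prod sigma_prime_sigma_prod[OF assms(1) S kalg_chi[OF u]] by blast

text \<open>The extension of the ideal to the localisation, in the form of fractions with numerator
  in it.\<close>

definition ext_prime :: "('b, 'k) alg set \<Rightarrow> ('b, 'k) alg set" where
  "ext_prime \<pp> = {f \<in> kalg T. \<exists>d\<in>denoms. d * f \<in> \<pp>}"

text \<open>Membership can be tested with any one denominator that clears f: cross-multiplying
  compares two denominators, and neither of them lies in the prime ideal.\<close>

lemma ext_prime_iff:
  assumes p: "sigma_prime S \<pp>" "chi u \<notin> \<pp>" and d: "d \<in> denoms" "d * f \<in> kalg S" and f: "f \<in> kalg T"
  shows "f \<in> ext_prime \<pp> \<longleftrightarrow> d * f \<in> \<pp>"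
proof
  assume "f \<in> ext_prime \<pp>"
  then obtain d' where d': "d' \<in> denoms" "d' * f \<in> \<pp>" by (auto simp: ext_prime_def)
  have "d' * (d * f) = d' * f * d" by (simp add: ac_simps)
  also have "\<dots> \<in> \<pp>" using p(1) d'(2) denoms_kalg[OF d(1)] by (rule sigma_prime_ideal)
  finally show "d * f \<in> \<pp>"
    using sigma_prime_mult_iff[OF p(1) denoms_kalg[OF d'(1)] d(2)] denoms_notin[OF p d'(1)] by blast
qed (use f d in \<open>auto simp: ext_prime_def\<close>)

lemma sigma_prime_ext_prime:
  assumes p: "sigma_prime S \<pp>" "chi u \<notin> \<pp>"
  shows "sigma_prime T (ext_prime \<pp>)"
proof (rule sigma_primeI)
  show "ext_prime \<pp> \<subseteq> kalg T" by (auto simp: ext_prime_def)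
  show "0 \<in> ext_prime \<pp>" using denoms_one sigma_prime_zero[OF p(1)] by (auto simp: ext_prime_def)
  show "1 \<notin> ext_prime \<pp>"
    using ext_prime_iff[OF p denoms_one, of 1] kalg_one[OF S] kalg_one[OF T] sigma_prime_one[OF p(1)] by auto
next
  fix f g assume "f \<in> ext_prime \<pp>" "g \<in> ext_prime \<pp>"
  then obtain d d' where d: "d \<in> denoms" "d * f \<in> \<pp>" "d' \<in> denoms" "d' * g \<in> \<pp>" "f \<in> kalg T" "g \<in> kalg T"
    by (auto simp: ext_prime_def)
  have "d * d' * (f + g) = (d * f) * d' + (d' * g) * d" by (simp add: algebra_simps)
  also have "\<dots> \<in> \<pp>"
    using sigma_prime_add[OF p(1) sigma_prime_ideal[OF p(1) d(2) denoms_kalg[OF d(3)]]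
        sigma_prime_ideal[OF p(1) d(4) denoms_kalg[OF d(1)]]] .
  finally show "f + g \<in> ext_prime \<pp>"
    using d denoms_mult[OF d(1,3)] kalg_add by (auto simp: ext_prime_def)
next
  fix f g :: "('b, 'k) alg" assume "f \<in> ext_prime \<pp>" and g: "g \<in> kalg T"
  then obtain d where d: "d \<in> denoms" "d * f \<in> \<pp>" "f \<in> kalg T" by (auto simp: ext_prime_def)
  obtain d' where d': "d' \<in> denoms" "d' * g \<in> kalg S" using g by (rule clear_denoms)
  have "d * d' * (f * g) = (d * f) * (d' * g)" by (simp add: ac_simps)
  also have "\<dots> \<in> \<pp>" using p(1) d(2) d'(2) by (rule sigma_prime_ideal)
  finally show "f * g \<in> ext_prime \<pp>"
    using d(3) g denoms_mult[OF d(1) d'(1)] kalg_mult[OF T] by (auto simp: ext_prime_def)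
next
  fix f g :: "('b, 'k) alg" assume f: "f \<in> kalg T" and g: "g \<in> kalg T" and fg: "f * g \<in> ext_prime \<pp>"
  obtain d where d: "d \<in> denoms" "d * f \<in> kalg S" using f by (rule clear_denoms)
  obtain d' where d': "d' \<in> denoms" "d' * g \<in> kalg S" using g by (rule clear_denoms)
  have e: "d * d' * (f * g) = (d * f) * (d' * g)" by (simp add: ac_simps)
  have "(d * f) * (d' * g) \<in> \<pp>"
    using fg ext_prime_iff[OF p denoms_mult[OF d(1) d'(1)] _ kalg_mult[OF T f g]] kalg_mult[OF S d(2) d'(2)]
    by (simp add: e)
  then have "d * f \<in> \<pp> \<or> d' * g \<in> \<pp>" using sigma_prime_mult_iff[OF p(1) d(2) d'(2)] by simp
  then show "f \<in> ext_prime \<pp> \<or> g \<in> ext_prime \<pp>"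
    using d d' f g by (auto simp: ext_prime_def)
next
  fix f :: "('b, 'k) alg" assume f: "f \<in> kalg T"
  obtain d where d: "d \<in> denoms" "d * f \<in> kalg S" using f by (rule clear_denoms)
  have "alg_sigma \<sigma> f \<in> ext_prime \<pp> \<longleftrightarrow> alg_sigma \<sigma> (d * f) \<in> \<pp>"
    using ext_prime_iff[OF p denoms_sigma[OF d(1)] _ alg_sigma_kalg[OF T f]] alg_sigma_kalg[OF S d(2)]
    by (simp add: alg_sigma_mult)
  also have "\<dots> \<longleftrightarrow> d * f \<in> \<pp>" using p(1) d(2) by (rule sigma_prime_sigma_iff)
  also have "\<dots> \<longleftrightarrow> f \<in> ext_prime \<pp>" using ext_prime_iff[OF p d f] by simp
  finally show "alg_sigma \<sigma> f \<in> ext_prime \<pp> \<longleftrightarrow> f \<in> ext_prime \<pp>" .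
qed

lemma ext_prime_restrict:
  assumes p: "sigma_prime S \<pp>" "chi u \<notin> \<pp>"
  shows "ext_prime \<pp> \<inter> kalg S = \<pp>"
  using ext_prime_iff[OF p denoms_one] kalg_S_T sigma_prime_subset[OF p(1)] by auto

text \<open>Denominators are units of k[T], so none lies in a prime ideal of k[T]. This makes primes
  of k[T] determined by their trace on k[S].\<close>

lemma denoms_mult_sigma_prime_iff:
  assumes q: "sigma_prime T \<qq>" and d: "d \<in> denoms" and f: "f \<in> kalg T"
  shows "d * f \<in> \<qq> \<longleftrightarrow> f \<in> \<qq>"
proof -
  obtain d' where d': "d' \<in> kalg T" "d' * d = 1" using d by (rule denoms_unit)
  have "d \<notin> \<qq>" using sigma_prime_ideal[OF q _ d'(1), of d] d'(2) sigma_prime_one[OF q] by (auto simp: mult.commute)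
  then show ?thesis using sigma_prime_mult_iff[OF q kalg_S_T[OF denoms_kalg[OF d]] f] by simp
qed

lemma sigma_prime_eqI:
  assumes q: "sigma_prime T \<qq>" and q': "sigma_prime T \<qq>'" and eq: "\<qq> \<inter> kalg S = \<qq>' \<inter> kalg S"
  shows "\<qq> = \<qq>'"
proof -
  have "f \<in> \<qq> \<longleftrightarrow> f \<in> \<qq>'" if f: "f \<in> kalg T" for f
  proof -
    obtain d where d: "d \<in> denoms" "d * f \<in> kalg S" using f by (rule clear_denoms)
    then have "d * f \<in> \<qq> \<longleftrightarrow> d * f \<in> \<qq>'" using eq by blast
    then show ?thesis using denoms_mult_sigma_prime_iff[OF q d(1) f] denoms_mult_sigma_prime_iff[OF q' d(1) f] by simp
  qed
  then show ?thesis using sigma_prime_subset[OF q] sigma_prime_subset[OF q'] by blast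
qed

section \<open>K-points of the localisation\<close>

lemma kpts_denoms_nonzero:
  assumes K: "sigma_ext \<sigma> K" and h: "h \<in> kpts \<sigma> (Spec_alg T) K" and d: "d \<in> denoms"
  shows "h d \<noteq> \<zero>\<^bsub>K\<^esub>"
proof -
  have "1 \<notin> {f \<in> kalg T. h f = \<zero>\<^bsub>K\<^esub>}" using sigma_prime_one[OF kpts_kernel[OF T K h]] .
  then show ?thesis
    using denoms_mult_sigma_prime_iff[OF kpts_kernel[OF T K h] d kalg_one[OF T]]
      kalg_S_T[OF denoms_kalg[OF d]] by simp
qed

lemma kpts_localisation_eqI:
  assumes K: "sigma_ext \<sigma> K"
    and h: "h \<in> kpts \<sigma> (Spec_alg T) K" and h': "h' \<in> kpts \<sigma> (Spec_alg T) K"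
    and eq: "restrict h (kalg S) = restrict h' (kalg S)"
  shows "h = h'"
proof (rule extensionalityI[OF kpts_ext[OF h] kpts_ext[OF h']])
  interpret K: field K using K by (rule sigma_ext_field)
  fix f :: "('b, 'k) alg" assume f: "f \<in> kalg T"
  obtain d where d: "d \<in> denoms" "d * f \<in> kalg S" using f by (rule clear_denoms)
  have eq': "h g = h' g" if "g \<in> kalg S" for g using fun_cong[OF eq, of g] that by simp
  have dT: "d \<in> kalg T" using d(1) by (intro kalg_S_T denoms_kalg)
  have "h d \<otimes>\<^bsub>K\<^esub> h f = h d \<otimes>\<^bsub>K\<^esub> h' f"
    using kpts_mult[OF h dT f] kpts_mult[OF h' dT f] eq'[OF d(2)] eq'[OF denoms_kalg[OF d(1)]] by simp
  then show "h f = h' f"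
    using kpts_denoms_nonzero[OF K h d(1)] kpts_closed[OF h f] kpts_closed[OF h' f] kpts_closed[OF h dT]
    by (simp add: K.m_lcancel)
qed

text \<open>The universal property of localisation: the value at f is h (d f) / h d. Division is
  possible since the kernel of h is a reflexive prime avoiding \<open>chi u\<close>, hence avoiding
  all denominators.\<close>

lemma kpts_extend:
  assumes K: "sigma_ext \<sigma> K" and h: "h \<in> kpts \<sigma> (Spec_alg S) K" and hu: "h (chi u) \<noteq> \<zero>\<^bsub>K\<^esub>"
  obtains h' where "h' \<in> kpts \<sigma> (Spec_alg T) K" "restrict h' (kalg S) = h"
proof -
  interpret K: field K using K by (rule sigma_ext_field)
  have hd0: "h d \<noteq> \<zero>\<^bsub>K\<^esub>" if "d \<in> denoms" for d
    using denoms_notin[OF kpts_kernel[OF S K h] _ that] hu denoms_kalg[OF that] by simp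
  have hd: "h d \<in> carrier K" if "d \<in> denoms" for d
    using kpts_closed[OF h denoms_kalg[OF that]] .
  have cancel: "x = y"
    if "d \<in> denoms" "x \<in> carrier K" "y \<in> carrier K" "x \<otimes>\<^bsub>K\<^esub> h d = y \<otimes>\<^bsub>K\<^esub> h d" for d x y
    using K.m_rcancel[OF hd0[OF that(1)] hd[OF that(1)] that(2,3)] that(4) by simp
  \<comment> \<open>The value is pinned down by all admissible denominators at once. It is
    constructed from one of them, and \<open>uniq\<close> later recognises it from any one, so each
    homomorphism law can use the denominator that suits it.\<close>
  define R where "R f y \<longleftrightarrow> y \<in> carrier K \<and> (\<forall>d\<in>denoms. d * f \<in> kalg S \<longrightarrow> y \<otimes>\<^bsub>K\<^esub> h d = h (d * f))" for f y
  have ex: "\<exists>y. R f y" if f: "f \<in> kalg T" for f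
  proof -
    obtain c where c: "c \<in> denoms" "c * f \<in> kalg S" using f by (rule clear_denoms)
    have hc: "h c \<in> Units K" using hd[OF c(1)] hd0[OF c(1)] by (simp add: K.field_Units)
    note hcf = kpts_closed[OF h c(2)]
    let ?y = "h (c * f) \<otimes>\<^bsub>K\<^esub> inv\<^bsub>K\<^esub> (h c)"
    have y: "?y \<in> carrier K" using hcf hc by simp
    have yc: "?y \<otimes>\<^bsub>K\<^esub> h c = h (c * f)" using hcf hc K.Units_closed[OF hc] by (simp add: K.m_assoc)
    have "?y \<otimes>\<^bsub>K\<^esub> h d = h (d * f)" if d: "d \<in> denoms" "d * f \<in> kalg S" for d
    proof (rule cancel[OF c(1)])
      have "?y \<otimes>\<^bsub>K\<^esub> h d \<otimes>\<^bsub>K\<^esub> h c = (?y \<otimes>\<^bsub>K\<^esub> h c) \<otimes>\<^bsub>K\<^esub> h d"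
        using y hd[OF d(1)] hd[OF c(1)] by (simp only: K.m_ac)
      also have "\<dots> = h (c * f * d)" unfolding yc kpts_mult[OF h c(2) denoms_kalg[OF d(1)]] ..
      also have "c * f * d = d * f * c" by (simp add: ac_simps)
      also have "h (d * f * c) = h (d * f) \<otimes>\<^bsub>K\<^esub> h c" using h d(2) denoms_kalg[OF c(1)] by (rule kpts_mult)
      finally show "?y \<otimes>\<^bsub>K\<^esub> h d \<otimes>\<^bsub>K\<^esub> h c = h (d * f) \<otimes>\<^bsub>K\<^esub> h c" .
    qed (use y hd[OF d(1)] kpts_closed[OF h d(2)] in auto)
    with y show ?thesis unfolding R_def by blast
  qed
  define h' where "h' = (\<lambda>f\<in>kalg T. SOME y. R f y)"
  have R: "R f (h' f)" if "f \<in> kalg T" for f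
    using someI_ex[OF ex[OF that]] that by (simp add: h'_def)
  have closed: "h' f \<in> carrier K" if "f \<in> kalg T" for f
    using R[OF that] by (simp add: R_def)
  have eval: "h' f \<otimes>\<^bsub>K\<^esub> h d = h (d * f)" if "f \<in> kalg T" "d \<in> denoms" "d * f \<in> kalg S" for f d
    using R[OF that(1)] that(2,3) by (simp add: R_def)
  have uniq: "h' f = y" if "f \<in> kalg T" "d \<in> denoms" "d * f \<in> kalg S" "y \<in> carrier K"
    "y \<otimes>\<^bsub>K\<^esub> h d = h (d * f)" for f d y
    using cancel[OF that(2) closed[OF that(1)] that(4)] eval[OF that(1-3)] that(5) by simp
  have on_S: "h' f = h f" if f: "f \<in> kalg S" for f
    using uniq[OF kalg_S_T[OF f] denoms_one, of "h f"] f kpts_closed[OF h f] by (simp add: kpts_one[OF h])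
  have "h' \<in> kpts \<sigma> (Spec_alg T) K"
    unfolding kpts_iff
  proof (intro conjI ballI allI)
    show "h' \<in> extensional (kalg T)" by (simp add: h'_def)
    show "h' 1 = \<one>\<^bsub>K\<^esub>" using on_S[OF kalg_one[OF S]] kpts_one[OF h] by simp
    show "h' (Poly_Mapping.single 0 c) = ext_emb K c" for c
      using on_S[OF kalg_single[OF pointed_zero[OF S]]] kpts_const[OF h] by simp
    fix f :: "('b, 'k) alg" assume f: "f \<in> kalg T"
    show "h' f \<in> carrier K" using f by (rule closed)
    obtain d where d: "d \<in> denoms" "d * f \<in> kalg S" using f by (rule clear_denoms)
    show "h' (alg_sigma \<sigma> f) = ext_sigma K (h' f)"
    proof (rule uniq[OF alg_sigma_kalg[OF T f] denoms_sigma[OF d(1)]])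
      have e: "alg_sigma \<sigma> d * alg_sigma \<sigma> f = alg_sigma \<sigma> (d * f)" by (simp add: alg_sigma_mult)
      show "alg_sigma \<sigma> d * alg_sigma \<sigma> f \<in> kalg S" unfolding e using S d(2) by (rule alg_sigma_kalg)
      show "ext_sigma K (h' f) \<in> carrier K" using K closed[OF f] by (rule ext_sigma_closed)
      show "ext_sigma K (h' f) \<otimes>\<^bsub>K\<^esub> h (alg_sigma \<sigma> d) = h (alg_sigma \<sigma> d * alg_sigma \<sigma> f)"
        unfolding e kpts_sigma[OF h d(2)] kpts_sigma[OF h denoms_kalg[OF d(1)]]
        using ext_sigma_mult[OF K closed[OF f] hd[OF d(1)]] eval[OF f d] by simp
    qed
    fix g :: "('b, 'k) alg" assume g: "g \<in> kalg T"
    obtain d' where d': "d' \<in> denoms" "d' * g \<in> kalg S" using g by (rule clear_denoms)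
    \<comment> \<open>A common denominator for f and g, hence for their sum and product.\<close>
    have dd: "d * d' \<in> denoms" using d(1) d'(1) by (rule denoms_mult)
    have ddf: "d * d' * f \<in> kalg S" and ddg: "d * d' * g \<in> kalg S"
      using kalg_mult[OF S d(2) denoms_kalg[OF d'(1)]] kalg_mult[OF S d'(2) denoms_kalg[OF d(1)]]
      by (simp_all add: ac_simps)
    show "h' (f + g) = h' f \<oplus>\<^bsub>K\<^esub> h' g"
    proof (rule uniq[OF kalg_add[OF f g] dd])
      show "d * d' * (f + g) \<in> kalg S"
        unfolding distrib_left using ddf ddg by (rule kalg_add)
      show "(h' f \<oplus>\<^bsub>K\<^esub> h' g) \<otimes>\<^bsub>K\<^esub> h (d * d') = h (d * d' * (f + g))"
        unfolding distrib_left kpts_add[OF h ddf ddg] K.l_distr[OF closed[OF f] closed[OF g] hd[OF dd]]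
          eval[OF f dd ddf] eval[OF g dd ddg] ..
    qed (use closed f g in auto)
    show "h' (f * g) = h' f \<otimes>\<^bsub>K\<^esub> h' g"
    proof (rule uniq[OF kalg_mult[OF T f g] dd])
      have e: "d * d' * (f * g) = (d * f) * (d' * g)" by (simp add: ac_simps)
      show "d * d' * (f * g) \<in> kalg S" unfolding e using S d(2) d'(2) by (rule kalg_mult)
      have "h' f \<otimes>\<^bsub>K\<^esub> h' g \<otimes>\<^bsub>K\<^esub> (h d \<otimes>\<^bsub>K\<^esub> h d') = (h' f \<otimes>\<^bsub>K\<^esub> h d) \<otimes>\<^bsub>K\<^esub> (h' g \<otimes>\<^bsub>K\<^esub> h d')"
        using closed[OF f] closed[OF g] hd[OF d(1)] hd[OF d'(1)] by (simp add: K.m_ac)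
      then show "h' f \<otimes>\<^bsub>K\<^esub> h' g \<otimes>\<^bsub>K\<^esub> h (d * d') = h (d * d' * (f * g))"
        unfolding e kpts_mult[OF h d(2) d'(2)] kpts_mult[OF h denoms_kalg[OF d(1)] denoms_kalg[OF d'(1)]]
          eval[OF f d] eval[OF g d'] .
    qed (use closed f g in auto)
  qed
  moreover have "restrict h' (kalg S) = h"
    using on_S by (intro extensionalityI[OF restrict_extensional kpts_ext[OF h]]) auto
  ultimately show thesis by (rule that)
qed

lemma inj_on_restrict_pt: "inj_on (restrict_pt S) (pts \<sigma> (Spec_alg T))"
proof (rule inj_onI)
  fix z z' assume *: "z \<in> pts \<sigma> (Spec_alg T)" "z' \<in> pts \<sigma> (Spec_alg T)" "restrict_pt S z = restrict_pt S z'"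
  then show "z = z'"
    by (cases z; cases z')
      (auto simp: Prime_pts T KPt_pts dest: sigma_prime_eqI kpts_localisation_eqI)
qed

text \<open>One inclusion holds because \<open>chi u\<close> is a unit in k[T]. The other extends
  points: \<open>ext_prime\<close> for prime ideals, \<open>kpts_extend\<close> for
  K-points.\<close>

lemma restrict_pt_image:
  "restrict_pt S ` pts \<sigma> (Spec_alg T) = pts_over \<sigma> (Spec_alg S) (basic_open \<sigma> (Spec_alg S) (chi u))"
proof (intro subset_antisym subsetI)
  fix x assume "x \<in> restrict_pt S ` pts \<sigma> (Spec_alg T)"
  then obtain z where z: "z \<in> pts \<sigma> (Spec_alg T)" "x = restrict_pt S z" by blast
  have q: "sigma_prime T (support (Spec_alg T) z)" using T z(1) by (rule support_pts)
  have "chi u \<notin> support (Spec_alg T) z"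
    using denoms_mult_sigma_prime_iff[OF q denoms_chi kalg_one[OF T]] sigma_prime_one[OF q] by simp
  then have "chi u \<notin> support (Spec_alg S) x"
    using kalg_S_T by (cases z) (auto simp: z(2))
  then show "x \<in> pts_over \<sigma> (Spec_alg S) (basic_open \<sigma> (Spec_alg S) (chi u))"
    using restrict_pts[OF S T S_T z(1)] by (simp add: pts_over_basic_open[OF S] z(2))
next
  fix x assume "x \<in> pts_over \<sigma> (Spec_alg S) (basic_open \<sigma> (Spec_alg S) (chi u))"
  then have x: "x \<in> pts \<sigma> (Spec_alg S)" and xu: "chi u \<notin> support (Spec_alg S) x"
    by (auto simp: pts_over_basic_open[OF S])
  show "x \<in> restrict_pt S ` pts \<sigma> (Spec_alg T)"
  proof (cases x)
    case (Prime \<pp>)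
    then have p: "sigma_prime S \<pp>" "chi u \<notin> \<pp>" using x xu by (auto simp: Prime_pts S)
    have "x = restrict_pt S (Prime (ext_prime \<pp>))" using ext_prime_restrict[OF p] Prime by simp
    moreover have "Prime (ext_prime \<pp>) \<in> pts \<sigma> (Spec_alg T)"
      using sigma_prime_ext_prime[OF p] by (simp add: Prime_pts T)
    ultimately show ?thesis by blast
  next
    case (KPt K h)
    then have K: "sigma_ext \<sigma> K" and h: "h \<in> kpts \<sigma> (Spec_alg S) K" and hu: "h (chi u) \<noteq> \<zero>\<^bsub>K\<^esub>"
      using x xu kalg_chi[OF u] by (auto simp: KPt_pts)
    obtain h' where h': "h' \<in> kpts \<sigma> (Spec_alg T) K" "restrict h' (kalg S) = h"
      using K h hu by (rule kpts_extend)
    then have "x = restrict_pt S (KPt K h')" "KPt K h' \<in> pts \<sigma> (Spec_alg T)"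
      using KPt K by (auto simp: KPt_pts)
    then show ?thesis by blast
  qed
qed

text \<open>Written with \<open>the_inv_into\<close> so that it coincides with the inverse occurring
  in the gluing maps of \<open>fan_variety\<close>.\<close>

definition extend_pt :: "('b, 'k, 'u) pt \<Rightarrow> ('b, 'k, 'u) pt" where
  "extend_pt = the_inv_into (pts \<sigma> (Spec_alg T)) (restrict_pt S)"

lemma extend_restrict: "z \<in> pts \<sigma> (Spec_alg T) \<Longrightarrow> extend_pt (restrict_pt S z) = z"
  unfolding extend_pt_def by (rule the_inv_into_f_f[OF inj_on_restrict_pt])

text \<open>On k[T] one has f = (d f) / d with d f in k[S]; for a prime ideal, f and d f vanish
  together because d is a unit. The sequence c depends on f but not on the point.\<close>

lemma represents_extend:
  assumes f: "f \<in> kalg T"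
  obtains a c where "a \<in> kalg S"
    "\<And>z :: ('b, 'k, 'u) pt. z \<in> pts \<sigma> (Spec_alg T) \<Longrightarrow>
       represents (restrict_pt S z) z f a (sigma_prod \<sigma> (chi u) c)"
proof -
  obtain d where d: "d \<in> denoms" "d * f \<in> kalg S" using f by (rule clear_denoms)
  obtain c where c: "d = sigma_prod \<sigma> (chi u) c" using denoms_sigma_prod[OF d(1)] by blast
  have "represents (restrict_pt S z) z f (d * f) d" if z: "z \<in> pts \<sigma> (Spec_alg T)" for z :: "('b, 'k, 'u) pt"
  proof (cases z)
    case (Prime \<qq>)
    then show ?thesis using z denoms_mult_sigma_prime_iff[OF _ d(1) f] d(2) by (simp add: Prime_pts T)
  next
    case (KPt K h)
    with z have K: "sigma_ext \<sigma> K" and h: "h \<in> kpts \<sigma> (Spec_alg T) K" by (auto simp: KPt_pts)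
    interpret K: field K using K by (rule sigma_ext_field)
    have dT: "d \<in> kalg T" using denoms_kalg[OF d(1)] by (rule kalg_S_T)
    show ?thesis
      using KPt d denoms_kalg[OF d(1)] kpts_mult[OF h dT f] K.m_comm[OF kpts_closed[OF h dT] kpts_closed[OF h f]]
      by simp
  qed
  then show thesis using that[OF d(2)] c by blast
qed

text \<open>Applied in two situations: gluing maps, where R is the other chart inside T, and the
  inverse of the torus inclusion, where R = T. The neighbourhood is the whole open set, with e =
  \<open>chi u\<close>.\<close>

lemma regular_extend:
  assumes R: "R \<subseteq> T"
    and U': "\<And>z :: ('b, 'k, 'u) pt. z \<in> pts \<sigma> (Spec_alg T) \<Longrightarrow> restrict_pt R z \<in> pts_over \<sigma> (Spec_alg R) U'"
  shows "regular_map \<sigma> (Spec_alg S) (basic_open \<sigma> (Spec_alg S) (chi u)) (Spec_alg R) U'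
    (\<lambda>x :: ('b, 'k, 'u) pt. restrict_pt R (extend_pt x))"
  unfolding regular_map_def restrict_pt_image[symmetric]
proof (intro conjI ballI)
  fix x :: "('b, 'k, 'u) pt" assume "x \<in> restrict_pt S ` pts \<sigma> (Spec_alg T)"
  then show "restrict_pt R (extend_pt x) \<in> pts_over \<sigma> (Spec_alg R) U'"
    using U' by (auto simp: extend_restrict)
next
  fix \<pp> assume p: "\<pp> \<in> basic_open \<sigma> (Spec_alg S) (chi u)"
  have rep: "\<exists>a\<in>kalg S. \<exists>c. \<forall>x\<in>restrict_pt S ` pts \<sigma> (Spec_alg T).
      represents (x :: ('b, 'k, 'u) pt) (restrict_pt R (extend_pt x)) f a (sigma_prod \<sigma> (chi u) c)"
    if f: "f \<in> kalg R" for f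
  proof -
    have fT: "f \<in> kalg T" using f kalg_mono[OF R] by blast
    obtain a c where a: "a \<in> kalg S" "\<And>z :: ('b, 'k, 'u) pt. z \<in> pts \<sigma> (Spec_alg T) \<Longrightarrow>
       represents (restrict_pt S z) z f a (sigma_prod \<sigma> (chi u) c)"
      using represents_extend[OF fT] by metis
    have "represents (restrict_pt S z) (restrict_pt R z) f a (sigma_prod \<sigma> (chi u) c)"
      if "z \<in> pts \<sigma> (Spec_alg T)" for z :: "('b, 'k, 'u) pt"
      using a(2)[OF that] f by (cases z) auto
    then show ?thesis using a(1) by (intro bexI[of _ a] exI[of _ c]) (auto simp: extend_restrict)
  qed
  show "\<exists>e\<in>kalg (semi (Spec_alg S)). e \<notin> \<pp> \<and>
      basic_open \<sigma> (Spec_alg S) e \<subseteq> basic_open \<sigma> (Spec_alg S) (chi u) \<and>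
      (\<forall>f\<in>kalg (semi (Spec_alg R)). \<exists>a\<in>kalg (semi (Spec_alg S)). \<exists>c.
        \<forall>x\<in>pts_over \<sigma> (Spec_alg S) (basic_open \<sigma> (Spec_alg S) e).
          represents (x :: ('b, 'k, 'u) pt) (restrict_pt R (extend_pt x)) f a (sigma_prod \<sigma> e c))"
    using rep p kalg_chi[OF u] unfolding semi_Spec_alg
    by (intro bexI[of _ "chi u"] conjI) (simp_all add: restrict_pt_image[symmetric], simp add: basic_open_def)
qed

end

context sigma_base
begin

lemma localisationI: "localises S T v \<Longrightarrow> localisation \<sigma> S T v"
  by unfold_locales

text \<open>By primeness, the product of two characters is nonzero at a point exactly where both
  are; that product is the character inverted in the sum of the two localisations.\<close>

lemma restrict_image_plus:
  assumes "localises S T v" and "localises S T' v'"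
  shows "restrict_pt S ` pts \<sigma> (Spec_alg T) \<inter> restrict_pt S ` pts \<sigma> (Spec_alg T')
    = (restrict_pt S ` pts \<sigma> (Spec_alg (T + T')) :: ('b, 'k, 'u) pt set)"
proof -
  have S: "pointed S" and v: "v \<in> S" "v' \<in> S" using assms by (auto simp: localises_def)
  have "chi (v + v') \<in> \<pp> \<longleftrightarrow> chi v \<in> \<pp> \<or> chi v' \<in> \<pp>" if "sigma_prime S \<pp>" for \<pp>
    using sigma_prime_mult_iff[OF that kalg_chi[OF v(1)] kalg_chi[OF v(2)]] by (simp add: chi_add)
  then show ?thesis
    unfolding localisation.restrict_pt_image[OF localisationI[OF assms(1)]]
      localisation.restrict_pt_image[OF localisationI[OF assms(2)]]
      localisation.restrict_pt_image[OF localisationI[OF localises_plus[OF assms]]]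
    by (auto simp: pts_over_basic_open[OF S] support_pts[OF S])
qed

lemma restrict_kpts:
  assumes "pointed S" "pointed T" "S \<subseteq> T" "h \<in> kpts \<sigma> (Spec_alg T) K"
  shows "restrict h (kalg S) \<in> kpts \<sigma> (Spec_alg S) K"
  using pull_kpts[OF additive_map_id assms(1,2) _ assms(4)] assms(3) by (simp add: push_id)

section \<open>Translation of points by the torus\<close>

text \<open>The point t of the torus acting on a K-point h of Spec k[R]: the value at each character
  is multiplied by that of t. For R = M this is the group law of the torus.\<close>

definition translate ::
  "('u, 'k) sfext \<Rightarrow> 'b expo set \<Rightarrow> (('b, 'k) alg \<Rightarrow> 'u) \<Rightarrow> (('b, 'k) alg \<Rightarrow> 'u) \<Rightarrow> ('b, 'k) alg \<Rightarrow> 'u" where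
  "translate K R t h = kpt_of_map K R (\<lambda>v. t (chi v) \<otimes>\<^bsub>K\<^esub> h (chi v))"

lemma torus_mult_eq: "torus_mult K M s t = translate K M s t"
  by (simp add: torus_mult_def translate_def)

context
  fixes K :: "('u, 'k) sfext" and M R :: "'b expo set"
  assumes K: "sigma_ext \<sigma> K" and M: "pointed M" and R: "pointed R" and R_M: "R \<subseteq> M"
begin

interpretation K: field K using K by (rule sigma_ext_field)

lemma translate_chi:
  assumes t: "t \<in> kpts \<sigma> (Spec_alg M) K" and h: "h \<in> kpts \<sigma> (Spec_alg R) K" and v: "v \<in> R"
  shows "translate K R t h (chi v) = t (chi v) \<otimes>\<^bsub>K\<^esub> h (chi v)"
  unfolding translate_def
  using v R_M by (intro kpt_of_map_chi[OF K v] K.m_closed kpts_closed[OF t] kpts_closed[OF h] kalg_chi) auto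

lemma translate_kpts:
  assumes t: "t \<in> kpts \<sigma> (Spec_alg M) K" and h: "h \<in> kpts \<sigma> (Spec_alg R) K"
  shows "translate K R t h \<in> kpts \<sigma> (Spec_alg R) K"
  unfolding translate_def
proof (rule kpt_of_map_kpts[OF R K])
  have chi: "chi v \<in> kalg M" "chi v \<in> kalg R" if "v \<in> R" for v
    using that R_M by (auto intro: kalg_chi)
  have closed: "t (chi v) \<in> carrier K" "h (chi v) \<in> carrier K" if "v \<in> R" for v
    using kpts_closed[OF t] kpts_closed[OF h] chi[OF that] by auto
  show "t (chi v) \<otimes>\<^bsub>K\<^esub> h (chi v) \<in> carrier K" if "v \<in> R" for v
    using closed[OF that] by simp
  show "t (chi 0) \<otimes>\<^bsub>K\<^esub> h (chi 0) = \<one>\<^bsub>K\<^esub>"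
    by (simp add: chi_zero kpts_one[OF t] kpts_one[OF h])
  show "t (chi (v + w)) \<otimes>\<^bsub>K\<^esub> h (chi (v + w)) =
      t (chi v) \<otimes>\<^bsub>K\<^esub> h (chi v) \<otimes>\<^bsub>K\<^esub> (t (chi w) \<otimes>\<^bsub>K\<^esub> h (chi w))" if "v \<in> R" "w \<in> R" for v w
    using closed[OF that(1)] closed[OF that(2)]
    by (simp add: chi_add kpts_mult[OF t] kpts_mult[OF h] chi[OF that(1)] chi[OF that(2)] K.m_ac)
  show "t (chi ([:0, 1:] \<odot> v)) \<otimes>\<^bsub>K\<^esub> h (chi ([:0, 1:] \<odot> v)) = ext_sigma K (t (chi v) \<otimes>\<^bsub>K\<^esub> h (chi v))"
    if "v \<in> R" for v
    unfolding alg_sigma_chi[symmetric] kpts_sigma[OF t chi(1)[OF that]] kpts_sigma[OF h chi(2)[OF that]]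
      ext_sigma_mult[OF K closed[OF that]] ..
qed

text \<open>Translation commutes with restriction to a smaller semimodule, which makes the actions
  on different charts compatible. The right-hand side is the translate of the restricted point, with
  its definition unfolded.\<close>

lemma translate_restrict:
  assumes t: "t \<in> kpts \<sigma> (Spec_alg M) K" and h: "h \<in> kpts \<sigma> (Spec_alg R) K"
    and Q: "pointed Q" "Q \<subseteq> R"
  shows "restrict (translate K R t h) (kalg Q) = kpt_of_map K Q (\<lambda>v. t (chi v) \<otimes>\<^bsub>K\<^esub> restrict h (kalg Q) (chi v))"
proof (rule extensionalityI[of _ "kalg Q"])
  fix f :: "('b, 'k) alg" assume f: "f \<in> kalg Q"
  have "f \<in> kalg R" using f kalg_mono[OF Q(2)] by blast
  moreover have "chi v \<in> (kalg Q :: ('b, 'k) alg set)" if "v \<in> Poly_Mapping.keys f" for v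
    using f that by (auto simp: kalg_def chi_def)
  moreover have "t (chi v) \<in> carrier K" "h (chi v) \<in> carrier K" if "v \<in> Poly_Mapping.keys f" for v
    using f that R_M Q(2) by (auto intro!: kpts_closed[OF t] kpts_closed[OF h] kalg_chi simp: kalg_def)
  ultimately show "restrict (translate K R t h) (kalg Q) f =
      kpt_of_map K Q (\<lambda>v. t (chi v) \<otimes>\<^bsub>K\<^esub> restrict h (kalg Q) (chi v)) f"
    using f by (auto simp: translate_def kpt_of_map_def ext_emb_closed[OF K] intro!: K.add.finprod_cong')
qed (auto simp: kpt_of_map_def)

lemma translate_torus_one:
  assumes h: "h \<in> kpts \<sigma> (Spec_alg R) K"
  shows "translate K R (kpt_of_map K M (\<lambda>v. \<one>\<^bsub>K\<^esub>)) h = h"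
proof (rule kpts_eqI[OF R K _ h])
  have one: "kpt_of_map K M (\<lambda>v. \<one>\<^bsub>K\<^esub>) \<in> kpts \<sigma> (Spec_alg M) K"
    by (rule kpt_of_map_kpts[OF M K]) (auto simp: ext_sigma_one[OF K])
  show "translate K R (kpt_of_map K M (\<lambda>v. \<one>\<^bsub>K\<^esub>)) h \<in> kpts \<sigma> (Spec_alg R) K"
    by (rule translate_kpts[OF one h])
  show "translate K R (kpt_of_map K M (\<lambda>v. \<one>\<^bsub>K\<^esub>)) h (chi v) = h (chi v)" if "v \<in> R" for v
    using that R_M kpts_closed[OF h kalg_chi]
    by (subst translate_chi[OF one h that]) (auto simp: kpt_of_map_chi[OF K])
qed

end

lemma translate_translate:
  assumes K: "sigma_ext \<sigma> K" and M: "pointed M" and R: "pointed R" and R_M: "R \<subseteq> M"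
    and s: "s \<in> kpts \<sigma> (Spec_alg M) K" and t: "t \<in> kpts \<sigma> (Spec_alg M) K"
    and h: "h \<in> kpts \<sigma> (Spec_alg R) K"
  shows "translate K R (translate K M s t) h = translate K R s (translate K R t h)"
proof (rule kpts_eqI[OF R K])
  interpret K: field K using K by (rule sigma_ext_field)
  note tR = translate_kpts[OF K M R R_M] and cR = translate_chi[OF K M R R_M]
  note st = translate_kpts[OF K M M subset_refl s t] and th = tR[OF t h]
  show "translate K R (translate K M s t) h \<in> kpts \<sigma> (Spec_alg R) K" using st h by (rule tR)
  show "translate K R s (translate K R t h) \<in> kpts \<sigma> (Spec_alg R) K" using s th by (rule tR)
  fix v assume v: "v \<in> R"
  then have vM: "v \<in> M" using R_M by blast
  show "translate K R (translate K M s t) h (chi v) = translate K R s (translate K R t h) (chi v)"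
    unfolding cR[OF st h v] cR[OF s th v] cR[OF t h v] translate_chi[OF K M M subset_refl s t vM]
    by (rule K.m_assoc[OF kpts_closed[OF s kalg_chi[OF vM]] kpts_closed[OF t kalg_chi[OF vM]]
          kpts_closed[OF h kalg_chi[OF v]]])
qed

end

section \<open>The variety of a fan\<close>

locale fan_datum = sigma_base \<sigma> for \<sigma> :: "'k::field_char_0 \<Rightarrow> 'k" +
  fixes I :: "'i set" and S :: "'i \<Rightarrow> nat expo set" and u :: "'i \<Rightarrow> 'i \<Rightarrow> nat expo" and M :: "nat expo set"
  assumes finite: "finite I" and nonempty: "I \<noteq> {}"
    and affine: "i \<in> I \<Longrightarrow> affine_semimodule (S i)"
    and lattice: "zx_lattice M" and md: "i \<in> I \<Longrightarrow> semi_md (S i) = M"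
    and pair: "i \<in> I \<Longrightarrow> j \<in> I \<Longrightarrow> i \<noteq> j \<Longrightarrow> fan_pair (S i) (S j) (u i j)"
begin

abbreviation X :: "('i, nat, 'k, 'u) avar" where "X \<equiv> fan_variety \<sigma> I S u"
abbreviation T :: "(unit, nat, 'k, 'u) avar" where "T \<equiv> torus_avar M"
abbreviation P :: "nat expo set \<Rightarrow> (nat, 'k, 'u) pt set" where "P R \<equiv> pts \<sigma> (Spec_alg R)"

lemma X_simps [simp]: "idx X = I" "chart X i = Spec_alg (S i)"
  "overlap X j i = basic_open \<sigma> (Spec_alg (S i)) (chi (u i j))"
  by (simp_all add: fan_variety_def)

lemma S: "i \<in> I \<Longrightarrow> pointed (S i)"
  using affine by (rule affine_semimodule_pointed)

lemma localises_pair: "i \<in> I \<Longrightarrow> j \<in> I \<Longrightarrow> i \<noteq> j \<Longrightarrow> localises (S i) (S i + S j) (u i j)"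
  by (rule fan_pair_localises[OF S S pair])

text \<open>For i = j the zero vector serves, because S i + S i = S i.\<close>

lemma localises_ex: "i \<in> I \<Longrightarrow> j \<in> I \<Longrightarrow> \<exists>v. localises (S i) (S i + S j) v"
  using localises_pair[of i j] localises_refl[OF S, of i] pointed_set_plus_self[OF S, of i] by metis

lemma M: "pointed M" and S_M: "i \<in> I \<Longrightarrow> S i \<subseteq> M" and localises_M: "i \<in> I \<Longrightarrow> \<exists>v. localises (S i) M v"
proof -
  show ex: "\<exists>v. localises (S i) M v" if "i \<in> I" for i
    using affine_semimodule_localises_md[OF affine[OF that]] md[OF that] by metis
  then show "i \<in> I \<Longrightarrow> S i \<subseteq> M" for i using localises_subset by blast
  show "pointed M" using ex localises_pointed(2) nonempty by blast
qed

lemma S_plus_M: "i \<in> I \<Longrightarrow> j \<in> I \<Longrightarrow> S i + S j \<subseteq> M"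
  using S_M[of i] S_M[of j] pointed_add[OF M] by (auto elim!: set_plus_elim)

lemma subset_plus:
  assumes "i \<in> I" "j \<in> I"
  shows "S i \<subseteq> S i + S j" "S j \<subseteq> S i + S j"
  using pointed_subset_plus[OF S S] assms by auto

lemma pointed_plus: "i \<in> I \<Longrightarrow> j \<in> I \<Longrightarrow> pointed (S i + S j)"
  by (intro pointed_set_plus S)

lemma inj_restrict_plus: "i \<in> I \<Longrightarrow> j \<in> I \<Longrightarrow> inj_on (restrict_pt (S i)) (P (S i + S j))"
  using localises_ex localisation.inj_on_restrict_pt[OF localisationI] by blast

lemma inj_restrict_M: "i \<in> I \<Longrightarrow> inj_on (restrict_pt (S i)) (P M)"
  using localises_M localisation.inj_on_restrict_pt[OF localisationI] by blast

text \<open>The sum of the two localisations contains S i twice; idempotence leaves the symmetric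
  triple sum.\<close>

lemma restrict_image_triple:
  assumes "i \<in> I" "j \<in> I" "k \<in> I"
  shows "restrict_pt (S i) ` P (S i + S j) \<inter> restrict_pt (S i) ` P (S i + S k)
    = (restrict_pt (S i) ` P (S i + S j + S k) :: (nat, 'k, 'u) pt set)"
proof -
  have "(S i + S j) + (S i + S k) = (S i + S i) + S j + S k" by (simp add: ac_simps)
  also have "\<dots> = S i + S j + S k" using assms by (simp add: pointed_set_plus_self S)
  finally show ?thesis using localises_ex[OF assms(1,2)] localises_ex[OF assms(1,3)] restrict_image_plus by metis
qed

section \<open>Gluing maps and the equivalence relation they generate\<close>

lemma pts_over_overlap:
  "i \<in> I \<Longrightarrow> j \<in> I \<Longrightarrow> i \<noteq> j \<Longrightarrow>
     pts_over \<sigma> (Spec_alg (S i)) (basic_open \<sigma> (Spec_alg (S i)) (chi (u i j))) = restrict_pt (S i) ` P (S i + S j)"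
  using localisation.restrict_pt_image[OF localisationI[OF localises_pair]] by blast

lemma glue_eq_extend:
  assumes "i \<in> I" "j \<in> I" "i \<noteq> j"
  shows "glue X j i x = restrict_pt (S j) (localisation.extend_pt \<sigma> (S i) (S i + S j) x)"
proof -
  have "add_span (S i) (- u i j) = S i + S j"
    using localises_pair[OF assms] by (simp add: localises_def)
  then show ?thesis
    by (simp add: fan_variety_def localisation.extend_pt_def[OF localisationI[OF localises_pair[OF assms]]])
qed

lemma glue_restrict:
  assumes "i \<in> I" "j \<in> I" "i \<noteq> j" "z \<in> P (S i + S j)"
  shows "glue X j i (restrict_pt (S i) z) = restrict_pt (S j) z"
  using assms by (simp add: glue_eq_extend localisation.extend_restrict[OF localisationI[OF localises_pair]])

text \<open>A form of the gluing relation that is visibly symmetric, refers to no chosen vector, and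
  includes equality of points when i = j. \<open>glue_rel_iff\<close> matches it with the actual
  relation.\<close>

definition glued :: "'i \<Rightarrow> (nat, 'k, 'u) pt \<Rightarrow> 'i \<Rightarrow> (nat, 'k, 'u) pt \<Rightarrow> bool" where
  "glued i x j y \<longleftrightarrow> (\<exists>z\<in>P (S i + S j). x = restrict_pt (S i) z \<and> y = restrict_pt (S j) z)"

lemma restrict_plus_pts:
  assumes "i \<in> I" "j \<in> I" "z \<in> P (S i + S j)"
  shows "restrict_pt (S i) z \<in> P (S i)" "restrict_pt (S j) z \<in> P (S j)"
  using restrict_pts[OF S[OF assms(1)] pointed_plus[OF assms(1,2)] subset_plus(1)[OF assms(1,2)] assms(3)]
    restrict_pts[OF S[OF assms(2)] pointed_plus[OF assms(1,2)] subset_plus(2)[OF assms(1,2)] assms(3)] .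

lemma glued_same: "i \<in> I \<Longrightarrow> glued i x i y \<longleftrightarrow> x = y \<and> x \<in> P (S i)"
  unfolding glued_def using pointed_set_plus_self[OF S, of i] restrict_pt_self[OF S, of i] by metis

lemma glued_sym: "glued i x j y \<Longrightarrow> glued j y i x"
  unfolding glued_def by (metis add.commute)

text \<open>The middle point y lies in both overlaps of its chart, so it comes from a point over the
  triple sum. Restricting that point to S i + S k gives the required witness.\<close>

lemma glued_trans:
  assumes "i \<in> I" "j \<in> I" "k \<in> I" and xy: "glued i x j y" and yw: "glued j y k w"
  shows "glued i x k (w :: (nat, 'k, 'u) pt)"
proof -
  obtain z where z: "z \<in> P (S j + S i)" "x = restrict_pt (S i) z" "y = restrict_pt (S j) z"
    using glued_sym[OF xy] by (auto simp: glued_def)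
  obtain z' where z': "z' \<in> P (S j + S k)" "y = restrict_pt (S j) z'" "w = restrict_pt (S k) z'"
    using yw by (auto simp: glued_def)
  have "y \<in> restrict_pt (S j) ` P (S j + S i + S k)"
    using restrict_image_triple[OF assms(2,1,3)] z z' by blast
  then obtain a where a: "a \<in> P (S j + S i + S k)" "y = restrict_pt (S j) a" by blast
  have pt3: "pointed (S j + S i + S k)" using assms by (intro pointed_set_plus S)
  have sub1: "S j + S i \<subseteq> S j + S i + S k" and sub2: "S j + S k \<subseteq> S j + S i + S k" and sub3: "S i + S k \<subseteq> S j + S i + S k"
    using pointed_subset_plus(1)[OF pointed_plus[of j i] S[of k]] pointed_subset_plus(1)[OF pointed_plus[of j k] S[of i]]
      pointed_subset_plus(2)[OF S[of j] pointed_plus[of i k]] assms by (simp_all add: ac_simps)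
  \<comment> \<open>Both sides restrict to y on S j, and restriction from a localisation of S j is
    injective.\<close>
  have "restrict_pt (S j + S i) a = z"
    by (rule inj_onD[OF inj_restrict_plus[OF assms(2,1)]])
      (use a z assms sub1 pt3 subset_plus in \<open>simp_all add: restrict_pt_restrict_pt restrict_pts pointed_plus\<close>)
  moreover have "restrict_pt (S j + S k) a = z'"
    by (rule inj_onD[OF inj_restrict_plus[OF assms(2,3)]])
      (use a z' assms sub2 pt3 subset_plus in \<open>simp_all add: restrict_pt_restrict_pt restrict_pts pointed_plus\<close>)
  ultimately have "x = restrict_pt (S i) a" "w = restrict_pt (S k) a"
    using z(2) z'(3) restrict_pt_restrict_pt[OF subset_plus(2)[OF assms(2,1)], of a]
      restrict_pt_restrict_pt[OF subset_plus(2)[OF assms(2,3)], of a] by simp_all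
  then show ?thesis
    unfolding glued_def
    using assms a(1) sub3 pt3 subset_plus[OF assms(1,3)]
    by (intro bexI[of _ "restrict_pt (S i + S k) a"])
      (simp_all add: restrict_pt_restrict_pt restrict_pts pointed_plus)
qed

lemma glue_rel_iff:
  assumes "i \<in> I" "j \<in> I"
  shows "((i, x), (j, y)) \<in> glue_rel \<sigma> (X :: ('i, nat, 'k, 'u) avar) \<longleftrightarrow> glued i x j y"
proof (cases "i = j")
  case True
  with assms show ?thesis by (auto simp: glue_rel_def glued_same)
next
  case False
  have "((i, x), (j, y)) \<in> glue_rel \<sigma> X \<longleftrightarrow>
      x \<in> pts_over \<sigma> (Spec_alg (S i)) (basic_open \<sigma> (Spec_alg (S i)) (chi (u i j))) \<and>
      y \<in> P (S j) \<and> y = glue X j i x"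
    using assms False by (auto simp: glue_rel_def pts_over_def)
  also have "\<dots> \<longleftrightarrow> glued i x j y"
    unfolding pts_over_overlap[OF assms False] glued_def
    using restrict_plus_pts[OF assms] glue_restrict[OF assms False] by auto
  finally show ?thesis .
qed

lemma cls_eq: "i \<in> I \<Longrightarrow> cls \<sigma> X i x = {(j, y). j \<in> I \<and> glued i x j y}"
  unfolding cls_def using glue_rel_iff[of i] by (auto simp: glue_rel_def)

lemma cls_eq_iff:
  assumes "i \<in> I" "j \<in> I" "y \<in> P (S j)"
  shows "cls \<sigma> X i x = cls \<sigma> X j y \<longleftrightarrow> glued i x j y"
proof
  assume "cls \<sigma> X i x = cls \<sigma> X j y"
  moreover have "(j, y) \<in> cls \<sigma> X j y" using assms by (simp add: cls_eq glued_same)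
  ultimately have "(j, y) \<in> cls \<sigma> X i x" by simp
  then show "glued i x j y" using assms(1) by (simp add: cls_eq)
next
  assume "glued i x j y"
  then show "cls \<sigma> X i x = cls \<sigma> X j y"
    unfolding cls_eq[OF assms(1)] cls_eq[OF assms(2)]
    using glued_trans[OF assms(1,2)] glued_trans[OF assms(2,1)] glued_sym by blast
qed

lemma cls_inj: "i \<in> I \<Longrightarrow> y \<in> P (S i) \<Longrightarrow> cls \<sigma> X i x = cls \<sigma> X i y \<Longrightarrow> x = y"
  using cls_eq_iff[of i i y x] by (simp add: glued_same)

lemma restrict_M_pts: "i \<in> I \<Longrightarrow> z \<in> P M \<Longrightarrow> restrict_pt (S i) z \<in> P (S i)"
  by (rule restrict_pts[OF S M S_M])

text \<open>The witness for the gluing is the restriction of z to S i + S j, which lies inside M. So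
  the copies of the torus in all charts are the same subset.\<close>

lemma cls_restrict_M:
  assumes "i \<in> I" "j \<in> I" "z \<in> P M"
  shows "cls \<sigma> X i (restrict_pt (S i) z) = cls \<sigma> X j (restrict_pt (S j) z)"
  unfolding cls_eq_iff[OF assms(1,2) restrict_M_pts[OF assms(2,3)]] glued_def
  using restrict_pts[OF pointed_plus[OF assms(1,2)] M S_plus_M[OF assms(1,2)] assms(3)]
  by (intro bexI[of _ "restrict_pt (S i + S j) z"])
    (simp_all add: restrict_pt_restrict_pt subset_plus[OF assms(1,2)])

text \<open>Every gluing map sends a restriction of z to another restriction of the same z. The
  inverse and cocycle laws are therefore identities between restrictions of one point, taken over
  the double or triple sum.\<close>

lemma abstract_variety_X: "abstract_variety \<sigma> (X :: ('i, nat, 'k, 'u) avar)"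
  unfolding abstract_variety_def X_simps
proof (intro conjI ballI impI)
  show "finite I" by (rule finite)
  show "affine_var (Spec_alg (S i) :: (nat, 'k) affvar)" if "i \<in> I" for i
    using affine[OF that] by (simp add: affine_var_def)
next
  fix i j assume ij: "i \<in> I" "j \<in> I" "i \<noteq> j"
  interpret L: localisation \<sigma> "S i" "S i + S j" "u i j"
    by (rule localisationI[OF localises_pair[OF ij]])
  have over_j: "pts_over \<sigma> (Spec_alg (S j)) (basic_open \<sigma> (Spec_alg (S j)) (chi (u j i))) =
      restrict_pt (S j) ` P (S i + S j)"
    using pts_over_overlap[OF ij(2,1)] ij(3) by (simp add: add.commute)
  show "open_in_var \<sigma> (Spec_alg (S i)) (basic_open \<sigma> (Spec_alg (S i)) (chi (u i j)))"
    by (rule open_basic_open[OF kalg_chi[OF L.u]])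
  show "regular_map \<sigma> (Spec_alg (S i)) (basic_open \<sigma> (Spec_alg (S i)) (chi (u i j))) (Spec_alg (S j))
      (basic_open \<sigma> (Spec_alg (S j)) (chi (u j i))) (glue (X :: ('i, nat, 'k, 'u) avar) j i)"
    unfolding glue_eq_extend[OF ij, abs_def]
    by (rule L.regular_extend[OF subset_plus(2)[OF ij(1,2)]]) (simp add: over_j)
  fix x :: "(nat, 'k, 'u) pt"
  assume "x \<in> pts_over \<sigma> (Spec_alg (S i)) (basic_open \<sigma> (Spec_alg (S i)) (chi (u i j)))"
  then obtain z where z: "z \<in> P (S i + S j)" "x = restrict_pt (S i) z"
    unfolding pts_over_overlap[OF ij] by blast
  then show "glue X i j (glue X j i x) = x"
    using ij by (simp add: glue_restrict add.commute)
next
  fix i j k assume ijk: "i \<in> I" "j \<in> I" "k \<in> I" "i \<noteq> j" "j \<noteq> k" "i \<noteq> k"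
  have over: "pts_over \<sigma> (Spec_alg (S i)) (basic_open \<sigma> (Spec_alg (S i)) (chi (u i j)) \<inter>
        basic_open \<sigma> (Spec_alg (S i)) (chi (u i k))) = (restrict_pt (S i) ` P (S i + S j + S k) :: (nat, 'k, 'u) pt set)"
    if "i \<in> I" "j \<in> I" "k \<in> I" "i \<noteq> j" "i \<noteq> k" for i j k
  proof -
    have "pts_over \<sigma> V (A \<inter> B) = (pts_over \<sigma> V A \<inter> pts_over \<sigma> V B :: (nat, 'k, 'u) pt set)" for V A B
      by (auto simp: pts_over_def)
    then show ?thesis using that restrict_image_triple by (simp add: pts_over_overlap)
  qed
  have pt3: "pointed (S i + S j + S k)" using ijk by (intro pointed_set_plus S)
  have sub1: "S i + S j \<subseteq> S i + S j + S k" and sub2: "S i + S k \<subseteq> S i + S j + S k" and sub3: "S j + S k \<subseteq> S i + S j + S k"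
    using pointed_subset_plus(1)[OF pointed_plus[of i j] S[of k]] pointed_subset_plus(1)[OF pointed_plus[of i k] S[of j]]
      pointed_subset_plus(2)[OF S[of i] pointed_plus[of j k]] ijk by (simp_all add: ac_simps)
  have glue3: "glue X j i (restrict_pt (S i) z) = restrict_pt (S j) z"
      "glue X k i (restrict_pt (S i) z) = restrict_pt (S k) z"
      "glue X k j (restrict_pt (S j) z) = restrict_pt (S k) z"
    if z: "z \<in> P (S i + S j + S k)" for z :: "(nat, 'k, 'u) pt"
    using glue_restrict[OF ijk(1,2,4) restrict_pts[OF pointed_plus[OF ijk(1,2)] pt3 sub1 z]]
      glue_restrict[OF ijk(1,3,6) restrict_pts[OF pointed_plus[OF ijk(1,3)] pt3 sub2 z]]
      glue_restrict[OF ijk(2,3,5) restrict_pts[OF pointed_plus[OF ijk(2,3)] pt3 sub3 z]] ijk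
    by (simp_all add: restrict_pt_restrict_pt subset_plus)
  have over_i: "pts_over \<sigma> (Spec_alg (S i)) (basic_open \<sigma> (Spec_alg (S i)) (chi (u i j)) \<inter>
        basic_open \<sigma> (Spec_alg (S i)) (chi (u i k))) = (restrict_pt (S i) ` P (S i + S j + S k) :: (nat, 'k, 'u) pt set)"
    using ijk by (intro over)
  have over_j: "pts_over \<sigma> (Spec_alg (S j)) (basic_open \<sigma> (Spec_alg (S j)) (chi (u j i)) \<inter>
        basic_open \<sigma> (Spec_alg (S j)) (chi (u j k))) = (restrict_pt (S j) ` P (S i + S j + S k) :: (nat, 'k, 'u) pt set)"
    using over[of j i k] ijk by (simp add: add.commute)
  show "glue X j i ` pts_over \<sigma> (Spec_alg (S i)) (basic_open \<sigma> (Spec_alg (S i)) (chi (u i j)) \<inter>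
        basic_open \<sigma> (Spec_alg (S i)) (chi (u i k))) =
      (pts_over \<sigma> (Spec_alg (S j)) (basic_open \<sigma> (Spec_alg (S j)) (chi (u j i)) \<inter>
        basic_open \<sigma> (Spec_alg (S j)) (chi (u j k))) :: (nat, 'k, 'u) pt set)"
    unfolding over_i over_j image_image using glue3(1) by (rule image_cong[OF refl])
  fix x :: "(nat, 'k, 'u) pt"
  assume "x \<in> pts_over \<sigma> (Spec_alg (S i)) (basic_open \<sigma> (Spec_alg (S i)) (chi (u i j)) \<inter>
        basic_open \<sigma> (Spec_alg (S i)) (chi (u i k)))"
  then obtain z where z: "z \<in> P (S i + S j + S k)" "x = restrict_pt (S i) z"
    unfolding over_i by blast
  show "glue X k j (glue X j i x) = glue X k i x"
    unfolding z(2) glue3[OF z(1)] ..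
qed

subsection \<open>Irreducibility\<close>

text \<open>k[M] has no zero divisors because the exponents form a linearly ordered group, the
  coefficients being ordered polynomials; reflexivity is the injectivity of
  \<open>alg_sigma\<close>.\<close>

lemma sigma_prime_generic: "sigma_prime M {0}"
  by (rule sigma_primeI) (auto simp: alg_sigma_eq_0_iff)

lemma generic_restrict: "i \<in> I \<Longrightarrow> restrict_pt (S i) (Prime {0}) = Prime {0}"
  by simp

lemma generic_pts: "Prime {0} \<in> P M"
  by (simp add: Prime_pts M sigma_prime_generic)

lemma generic_spec: "i \<in> I \<Longrightarrow> {0} \<in> spec \<sigma> (Spec_alg (S i))"
  using restrict_M_pts[OF _ generic_pts, of i] generic_restrict[of i] by (simp add: Prime_pts S spec_iff)

lemma cls_generic: "i \<in> I \<Longrightarrow> j \<in> I \<Longrightarrow> cls \<sigma> X i (Prime {0}) = cls \<sigma> X j (Prime {0})"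
  using cls_restrict_M[OF _ _ generic_pts, of i j] by (simp add: generic_restrict)

text \<open>In any chart j the closed set is the locus of some F. Containing the zero ideal forces F
  to have no nonzero element, so every prime of the chart belongs to it.\<close>

lemma closed_generic:
  fixes C :: "('i \<times> (nat, 'k, 'u) pt) set set"
  assumes C: "avar_closed \<sigma> X C" and i: "i \<in> I" and mem: "cls \<sigma> X i (Prime {0}) \<in> C"
  shows "C = top_pts \<sigma> X"
proof (rule ccontr)
  assume "C \<noteq> top_pts \<sigma> X"
  then obtain j \<pp> where j: "j \<in> I" "\<pp> \<in> spec \<sigma> (Spec_alg (S j))" "cls \<sigma> X j (Prime \<pp>) \<notin> C"
    using C by (auto simp: avar_closed_def top_pts_def)
  let ?W = "top_pts \<sigma> X - C"
  have part: "\<qq> \<in> chart_part \<sigma> X ?W j \<longleftrightarrow> \<qq> \<in> spec \<sigma> (Spec_alg (S j)) \<and> cls \<sigma> X j (Prime \<qq>) \<notin> C" for \<qq>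
    using j(1) by (auto simp: chart_part_def top_pts_def)
  obtain F where F: "spec \<sigma> (Spec_alg (S j)) - chart_part \<sigma> X ?W j = {\<qq> \<in> spec \<sigma> (Spec_alg (S j)). F \<subseteq> \<qq>}"
    using C j(1) unfolding avar_closed_def avar_open_def open_in_var_def closed_in_var_def by auto
  have "{0} \<in> spec \<sigma> (Spec_alg (S j)) - chart_part \<sigma> X ?W j"
    using part[of "{0}"] generic_spec[OF j(1)] mem[unfolded cls_generic[OF i j(1)]] by simp
  then have "F \<subseteq> {0}" unfolding F by simp
  also have "{0} \<subseteq> \<pp>" using j(2) sigma_prime_zero by (auto simp: spec_iff S[OF j(1)])
  finally have "\<pp> \<in> spec \<sigma> (Spec_alg (S j)) - chart_part \<sigma> X ?W j"
    unfolding F using j(2) by simp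
  then show False using j part by blast
qed

lemma irreducible_X: "irreducible_variety \<sigma> (X :: ('i, nat, 'k, 'u) avar)"
  unfolding irreducible_variety_def
proof (intro notI, elim exE conjE)
  fix C D :: "('i \<times> (nat, 'k, 'u) pt) set set"
  assume *: "avar_closed \<sigma> X C" "avar_closed \<sigma> X D" "C \<noteq> top_pts \<sigma> X" "D \<noteq> top_pts \<sigma> X" "C \<union> D = top_pts \<sigma> X"
  obtain i where i: "i \<in> I" using nonempty by blast
  have "cls \<sigma> X i (Prime {0}) \<in> C \<union> D"
    unfolding *(5) top_pts_def using generic_spec[OF i] i by auto
  then show False using closed_generic[OF _ i] * by blast
qed

subsection \<open>The torus\<close>

lemma cls_T: "x \<in> P M \<Longrightarrow> cls \<sigma> T () x = {((), x)}"
  by (auto simp: cls_def glue_rel_def torus_avar_def affine_avar_def)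

lemma T_simps [simp]: "idx T = UNIV" "chart T a = Spec_alg M"
  by (auto simp: torus_avar_def affine_avar_def)

lemma chart_part_T: "chart_part \<sigma> T (top_pts \<sigma> T) a = spec \<sigma> (Spec_alg M)"
  by (auto simp: chart_part_def top_pts_def)

lemma avar_pts_over_T: "avar_pts_over \<sigma> T (top_pts \<sigma> T) = {cls \<sigma> T () x | x. x \<in> P M}"
  by (auto simp: avar_pts_over_def chart_part_T pts_over_spec[OF M])

definition torus_open :: "('i \<times> (nat, 'k, 'u) pt) set set" where
  "torus_open = {cls \<sigma> X i (restrict_pt (S i) (Prime \<qq>)) | i \<qq>. i \<in> I \<and> sigma_prime M \<qq>}"

text \<open>A point of the torus may be presented in any chart j; \<open>cls_restrict_M\<close>
  moves it to chart i, and there distinct points have distinct classes. What remains is the image of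
  restriction from M, a basic open set.\<close>

lemma chart_part_torus_open:
  assumes i: "i \<in> I" and v: "localises (S i) M v"
  shows "chart_part \<sigma> X (torus_open :: ('i \<times> (nat, 'k, 'u) pt) set set) i = basic_open \<sigma> (Spec_alg (S i)) (chi v)"
proof -
  interpret L: localisation \<sigma> "S i" M v by (rule localisationI[OF v])
  have "\<pp> \<in> chart_part \<sigma> X (torus_open :: ('i \<times> (nat, 'k, 'u) pt) set set) i \<longleftrightarrow> \<pp> \<in> basic_open \<sigma> (Spec_alg (S i)) (chi v)" for \<pp>
  proof -
    have "\<pp> \<in> chart_part \<sigma> X (torus_open :: ('i \<times> (nat, 'k, 'u) pt) set set) i \<longleftrightarrow>
        (Prime \<pp> :: (nat, 'k, 'u) pt) \<in> restrict_pt (S i) ` P M"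
    proof
      assume p: "\<pp> \<in> chart_part \<sigma> X (torus_open :: ('i \<times> (nat, 'k, 'u) pt) set set) i"
      then obtain j \<qq> where j: "j \<in> I" "sigma_prime M \<qq>"
        "cls \<sigma> X i (Prime \<pp> :: (nat, 'k, 'u) pt) = cls \<sigma> X j (restrict_pt (S j) (Prime \<qq>))"
        unfolding chart_part_def torus_open_def by blast
      have q: "(Prime \<qq> :: (nat, 'k, 'u) pt) \<in> P M" using j(2) by (simp add: Prime_pts M)
      have "(Prime \<pp> :: (nat, 'k, 'u) pt) = restrict_pt (S i) (Prime \<qq>)"
        using j(3) cls_restrict_M[OF j(1) i q] by (intro cls_inj[OF i restrict_M_pts[OF i q]]) simp
      then show "(Prime \<pp> :: (nat, 'k, 'u) pt) \<in> restrict_pt (S i) ` P M" using q by blast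
    next
      assume "(Prime \<pp> :: (nat, 'k, 'u) pt) \<in> restrict_pt (S i) ` P M"
      then obtain z :: "(nat, 'k, 'u) pt" where z: "z \<in> P M" "Prime \<pp> = restrict_pt (S i) z" by blast
      obtain \<qq> where q: "z = Prime \<qq>" using z(2) by (cases z) auto
      have "(Prime \<pp> :: (nat, 'k, 'u) pt) \<in> P (S i)" using restrict_M_pts[OF i z(1)] z(2) by simp
      then have "\<pp> \<in> spec \<sigma> (Spec_alg (S i))" by (simp add: Prime_pts S[OF i] spec_iff)
      moreover have "cls \<sigma> X i (Prime \<pp> :: (nat, 'k, 'u) pt) \<in> torus_open"
        unfolding torus_open_def z(2) q
        using i z(1) by (intro CollectI exI[of _ i] exI[of _ \<qq>]) (simp add: q Prime_pts M)
      ultimately show "\<pp> \<in> chart_part \<sigma> X (torus_open :: ('i \<times> (nat, 'k, 'u) pt) set set) i"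
        by (simp add: chart_part_def)
    qed
    also have "\<dots> \<longleftrightarrow> \<pp> \<in> basic_open \<sigma> (Spec_alg (S i)) (chi v)"
      unfolding L.restrict_pt_image by (auto simp: pts_over_def pts_def basic_open_def)
    finally show ?thesis .
  qed
  then show ?thesis by blast
qed

lemma avar_pts_over_torus_open:
  assumes i: "i \<in> I"
  shows "avar_pts_over \<sigma> X (torus_open :: ('i \<times> (nat, 'k, 'u) pt) set set) = {cls \<sigma> X i (restrict_pt (S i) z) | z. z \<in> P M}"
proof -
  have over: "pts_over \<sigma> (Spec_alg (S j)) (chart_part \<sigma> X (torus_open :: ('i \<times> (nat, 'k, 'u) pt) set set) j) =
      (restrict_pt (S j) ` P M :: (nat, 'k, 'u) pt set)" if j: "j \<in> I" for j
  proof -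
    obtain v where v: "localises (S j) M v" using localises_M[OF j] by blast
    show ?thesis
      unfolding chart_part_torus_open[OF j v] localisation.restrict_pt_image[OF localisationI[OF v]] ..
  qed
  show ?thesis
  proof (intro subset_antisym subsetI)
    fix \<xi> :: "('i \<times> (nat, 'k, 'u) pt) set" assume "\<xi> \<in> avar_pts_over \<sigma> X torus_open"
    then obtain j x where j: "j \<in> I"
      and x: "x \<in> pts_over \<sigma> (Spec_alg (S j)) (chart_part \<sigma> X (torus_open :: ('i \<times> (nat, 'k, 'u) pt) set set) j)"
      and \<xi>: "\<xi> = cls \<sigma> X j x"
      unfolding avar_pts_over_def X_simps by blast
    obtain z where z: "z \<in> P M" and xi: "\<xi> = cls \<sigma> X j (restrict_pt (S j) z)"
      using x unfolding \<xi> over[OF j] by blast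
    show "\<xi> \<in> {cls \<sigma> X i (restrict_pt (S i) z) | z. z \<in> P M}"
      unfolding xi cls_restrict_M[OF j i z] using z by blast
  next
    fix \<xi> :: "('i \<times> (nat, 'k, 'u) pt) set" assume "\<xi> \<in> {cls \<sigma> X i (restrict_pt (S i) z) | z. z \<in> P M}"
    then show "\<xi> \<in> avar_pts_over \<sigma> X torus_open"
      unfolding avar_pts_over_def X_simps using over[OF i] i by blast
  qed
qed

lemma avar_open_torus_open: "avar_open \<sigma> X torus_open"
  unfolding avar_open_def
proof (intro conjI ballI)
  show "torus_open \<subseteq> top_pts \<sigma> X"
  proof
    fix \<xi> :: "('i \<times> (nat, 'k, 'u) pt) set" assume "\<xi> \<in> torus_open"
    then obtain i \<qq> where i: "i \<in> I" "sigma_prime M \<qq>" "\<xi> = cls \<sigma> X i (restrict_pt (S i) (Prime \<qq>))"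
      by (auto simp: torus_open_def)
    have "restrict_pt (S i) (Prime \<qq>) \<in> P (S i)"
      by (rule restrict_M_pts[OF i(1)]) (simp add: Prime_pts M i(2))
    then show "\<xi> \<in> top_pts \<sigma> X"
      unfolding top_pts_def X_simps i(3) spec_iff[OF S[OF i(1)]]
      by (intro CollectI exI[of _ i] exI[of _ "\<qq> \<inter> kalg (S i)"])
        (simp add: i(1) Prime_pts S[OF i(1)] spec_iff)
  qed
  fix i assume "i \<in> idx X"
  then have i: "i \<in> I" by simp
  obtain v where v: "localises (S i) M v" using localises_M[OF i] by blast
  then have "v \<in> S i" by (simp add: localises_def)
  then show "open_in_var \<sigma> (chart X i) (chart_part \<sigma> X torus_open i)"
    by (simp add: chart_part_torus_open[OF i v] open_basic_open kalg_chi)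
qed

definition base :: 'i where "base = (SOME i. i \<in> I)"

lemma base: "base \<in> I"
  unfolding base_def using nonempty by (rule some_in_eq[THEN iffD2])

text \<open>A class in the one-chart variety of the torus is a singleton, so \<open>the_elem\<close>
  and \<open>snd\<close> recover the point. The chart \<open>base\<close> is an arbitrary choice
  without influence on the value, by \<open>torus_incl_cls\<close>.\<close>

definition torus_incl :: "(unit \<times> (nat, 'k, 'u) pt) set \<Rightarrow> ('i \<times> (nat, 'k, 'u) pt) set" where
  "torus_incl \<tau> = cls \<sigma> X base (restrict_pt (S base) (snd (the_elem \<tau>)))"

definition torus_inv :: "('i \<times> (nat, 'k, 'u) pt) set \<Rightarrow> (unit \<times> (nat, 'k, 'u) pt) set" where
  "torus_inv \<xi> = cls \<sigma> T () (the_inv_into (P M) (\<lambda>z. cls \<sigma> X base (restrict_pt (S base) z)) \<xi>)"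

lemma torus_incl_cls: "i \<in> I \<Longrightarrow> z \<in> P M \<Longrightarrow> torus_incl (cls \<sigma> T () z) = cls \<sigma> X i (restrict_pt (S i) z)"
  using cls_restrict_M[OF base] by (simp add: torus_incl_def cls_T)

lemma torus_inv_cls:
  assumes "i \<in> I" and z: "z \<in> P M"
  shows "torus_inv (cls \<sigma> X i (restrict_pt (S i) z)) = cls \<sigma> T () z"
proof -
  have "inj_on (\<lambda>z. cls \<sigma> X base (restrict_pt (S base) z)) (P M)"
    using cls_inj[OF base restrict_M_pts[OF base]] inj_onD[OF inj_restrict_M[OF base]]
    by (intro inj_onI) blast
  then show ?thesis
    unfolding cls_restrict_M[OF assms(1) base z] torus_inv_def
    using z by (subst the_inv_into_f_f) auto
qed

lemma torus_embedding_X: "torus_embedding \<sigma> M X (torus_incl :: (unit \<times> (nat, 'k, 'u) pt) set \<Rightarrow> _)"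
  unfolding torus_embedding_def
proof (intro exI conjI ballI)
  show "avar_open \<sigma> X torus_open" by (rule avar_open_torus_open)
  show "avar_morphism \<sigma> T (top_pts \<sigma> T) X torus_open
      (torus_incl :: (unit \<times> (nat, 'k, 'u) pt) set \<Rightarrow> _)"
    unfolding avar_morphism_def
  proof (intro conjI ballI)
    fix \<tau> :: "(unit \<times> (nat, 'k, 'u) pt) set" assume "\<tau> \<in> avar_pts_over \<sigma> T (top_pts \<sigma> T)"
    then show "torus_incl \<tau> \<in> avar_pts_over \<sigma> X torus_open"
      unfolding avar_pts_over_T avar_pts_over_torus_open[OF base] using torus_incl_cls[OF base] by auto
  next
    fix a :: unit and \<pp> assume "\<pp> \<in> chart_part \<sigma> T (top_pts \<sigma> T :: (unit \<times> (nat, 'k, 'u) pt) set set) a"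
    then have p: "\<pp> \<in> spec \<sigma> (Spec_alg M)" by (simp add: chart_part_T)
    show "\<exists>\<beta>\<in>idx X. \<exists>U g. \<pp> \<in> U \<and> U \<subseteq> chart_part \<sigma> T (top_pts \<sigma> T :: (unit \<times> (nat, 'k, 'u) pt) set set) a \<and>
        open_in_var \<sigma> (chart (T :: (unit, nat, 'k, 'u) avar) a) U \<and>
        regular_map \<sigma> (chart (T :: (unit, nat, 'k, 'u) avar) a) U
          (chart (X :: ('i, nat, 'k, 'u) avar) \<beta>) (spec \<sigma> (chart (X :: ('i, nat, 'k, 'u) avar) \<beta>)) g \<and>
        (\<forall>x\<in>pts_over \<sigma> (chart (T :: (unit, nat, 'k, 'u) avar) a) U.
          torus_incl (cls \<sigma> T a x) = cls \<sigma> X \<beta> (g (x :: (nat, 'k, 'u) pt)))"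
      using base p regular_restrict_pt[OF S[OF base] M S_M[OF base]]
      by (intro bexI[of _ base] exI[of _ "spec \<sigma> (Spec_alg M)"] exI[of _ "restrict_pt (S base)"])
        (simp_all add: chart_part_T open_spec[OF M] pts_over_spec[OF M] torus_incl_cls)
  qed
  show "avar_morphism \<sigma> X torus_open T (top_pts \<sigma> T)
      (torus_inv :: ('i \<times> (nat, 'k, 'u) pt) set \<Rightarrow> _)"
    unfolding avar_morphism_def
  proof (intro conjI ballI)
    fix \<xi> :: "('i \<times> (nat, 'k, 'u) pt) set" assume "\<xi> \<in> avar_pts_over \<sigma> X torus_open"
    then show "torus_inv \<xi> \<in> avar_pts_over \<sigma> T (top_pts \<sigma> T)"
      unfolding avar_pts_over_T avar_pts_over_torus_open[OF base] using torus_inv_cls[OF base] by auto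
  next
    fix i \<pp> assume "i \<in> idx (X :: ('i, nat, 'k, 'u) avar)" and p: "\<pp> \<in> chart_part \<sigma> X (torus_open :: ('i \<times> (nat, 'k, 'u) pt) set set) i"
    then have i: "i \<in> I" by simp
    obtain v where v: "localises (S i) M v" using localises_M[OF i] by blast
    interpret L: localisation \<sigma> "S i" M v by (rule localisationI[OF v])
    let ?U = "basic_open \<sigma> (Spec_alg (S i)) (chi v)"
    \<comment> \<open>The outer restriction to M does nothing to points over M; it only brings the
      extension map into the form treated by \<open>regular_extend\<close>.\<close>
    let ?g = "\<lambda>x :: (nat, 'k, 'u) pt. restrict_pt M (L.extend_pt x)"
    have "regular_map \<sigma> (Spec_alg (S i)) ?U (Spec_alg M) (spec \<sigma> (Spec_alg M)) ?g"
      by (rule L.regular_extend) (simp_all add: pts_over_spec[OF M] restrict_pt_self[OF M])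
    moreover have "torus_inv (cls \<sigma> X i x) = cls \<sigma> T () (?g x)" if x: "x \<in> pts_over \<sigma> (Spec_alg (S i)) ?U" for x
    proof -
      obtain z where "z \<in> P M" "x = restrict_pt (S i) z" using x unfolding L.restrict_pt_image[symmetric] by blast
      then show ?thesis by (simp add: torus_inv_cls[OF i] L.extend_restrict restrict_pt_self[OF M])
    qed
    ultimately show "\<exists>\<beta>\<in>idx T. \<exists>U g. \<pp> \<in> U \<and> U \<subseteq> chart_part \<sigma> X (torus_open :: ('i \<times> (nat, 'k, 'u) pt) set set) i \<and>
        open_in_var \<sigma> (chart (X :: ('i, nat, 'k, 'u) avar) i) U \<and>
        regular_map \<sigma> (chart (X :: ('i, nat, 'k, 'u) avar) i) U
          (chart (T :: (unit, nat, 'k, 'u) avar) \<beta>) (spec \<sigma> (chart (T :: (unit, nat, 'k, 'u) avar) \<beta>)) g \<and>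
        (\<forall>x\<in>pts_over \<sigma> (chart (X :: ('i, nat, 'k, 'u) avar) i) U.
          torus_inv (cls \<sigma> X i x) = cls \<sigma> T \<beta> (g (x :: (nat, 'k, 'u) pt)))"
      using p unfolding chart_part_torus_open[OF i v] X_simps T_simps
      by (intro bexI[of _ "()"] exI[of _ ?U] exI[of _ ?g] conjI open_basic_open kalg_chi L.u) simp_all
  qed
  fix \<tau> :: "(unit \<times> (nat, 'k, 'u) pt) set" assume "\<tau> \<in> avar_pts_over \<sigma> T (top_pts \<sigma> T)"
  then show "torus_inv (torus_incl \<tau>) = \<tau>"
    unfolding avar_pts_over_T by (auto simp: torus_incl_cls[OF base] torus_inv_cls[OF base])
next
  fix \<xi> :: "('i \<times> (nat, 'k, 'u) pt) set" assume "\<xi> \<in> avar_pts_over \<sigma> X torus_open"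
  then show "torus_incl (torus_inv \<xi>) = \<xi>"
    unfolding avar_pts_over_torus_open[OF base] by (auto simp: torus_incl_cls[OF base] torus_inv_cls[OF base])
qed

subsection \<open>The action of the torus\<close>

text \<open>Some chart representative of the class is translated; \<open>act_cls\<close> shows that
  any other gives the same result.\<close>

definition act :: "('u, 'k) sfext \<Rightarrow> ((nat, 'k) alg \<Rightarrow> 'u) \<Rightarrow>
    ('i \<times> (nat, 'k, 'u) pt) set \<Rightarrow> ('i \<times> (nat, 'k, 'u) pt) set" where
  "act K t \<xi> = (case SOME (i, h). i \<in> I \<and> h \<in> kpts \<sigma> (Spec_alg (S i)) K \<and> \<xi> = cls \<sigma> X i (KPt K h) of
     (i, h) \<Rightarrow> cls \<sigma> X i (KPt K (translate K (S i) t h)))"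

context
  fixes K :: "('u, 'k) sfext" and t
  assumes K: "sigma_ext \<sigma> K" and t: "t \<in> kpts \<sigma> (Spec_alg M) K"
begin

lemma translate_S_kpts:
  "i \<in> I \<Longrightarrow> h \<in> kpts \<sigma> (Spec_alg (S i)) K \<Longrightarrow> translate K (S i) t h \<in> kpts \<sigma> (Spec_alg (S i)) K"
  using translate_kpts[OF K M S S_M t] .

text \<open>Translate the common point over S i + S j, which is possible as this sum lies in M, and
  restrict the result to both charts.\<close>

lemma translate_glued:
  assumes ij: "i \<in> I" "j \<in> I" and g: "glued i (KPt K h) j (KPt K h')"
  shows "glued i (KPt K (translate K (S i) t h)) j (KPt K (translate K (S j) t h'))"
proof -
  obtain z where z: "z \<in> P (S i + S j)" "KPt K h = restrict_pt (S i) z" "KPt K h' = restrict_pt (S j) z"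
    using g by (auto simp: glued_def)
  obtain k where k: "z = KPt K k" using z(2) by (cases z) auto
  have kk: "k \<in> kpts \<sigma> (Spec_alg (S i + S j)) K" using z(1) by (simp add: k KPt_pts)
  have h: "h = restrict k (kalg (S i))" "h' = restrict k (kalg (S j))" using z k by simp_all
  note * = K M pointed_plus[OF ij] S_plus_M[OF ij] t kk
  have "KPt K (translate K (S i + S j) t k) \<in> P (S i + S j)"
    using translate_kpts[OF *] K by (simp add: KPt_pts)
  moreover have "KPt K (translate K (S i) t h) = restrict_pt (S i) (KPt K (translate K (S i + S j) t k))"
    "KPt K (translate K (S j) t h') = restrict_pt (S j) (KPt K (translate K (S i + S j) t k))"
    using translate_restrict[OF * S[OF ij(1)] subset_plus(1)[OF ij]]
      translate_restrict[OF * S[OF ij(2)] subset_plus(2)[OF ij]]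
    by (simp_all add: h translate_def[of _ "S i"] translate_def[of _ "S j"])
  ultimately show ?thesis unfolding glued_def by blast
qed

lemma act_cls:
  assumes i: "i \<in> I" and h: "h \<in> kpts \<sigma> (Spec_alg (S i)) K"
  shows "act K t (cls \<sigma> X i (KPt K h)) = cls \<sigma> X i (KPt K (translate K (S i) t h))"
proof -
  let ?Q = "\<lambda>(j, h'). j \<in> I \<and> h' \<in> kpts \<sigma> (Spec_alg (S j)) K \<and> cls \<sigma> X i (KPt K h) = cls \<sigma> X j (KPt K h')"
  obtain j h' where jh: "(SOME p. ?Q p) = (j, h')" by (rule prod.exhaust)
  have "?Q (SOME p. ?Q p)" by (rule someI[of ?Q "(i, h)"]) (use i h in simp)
  then have j: "j \<in> I" and h': "h' \<in> kpts \<sigma> (Spec_alg (S j)) K"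
    and eq: "cls \<sigma> X i (KPt K h) = cls \<sigma> X j (KPt K h')"
    unfolding jh by auto
  have pts: "KPt K h' \<in> P (S j)" "KPt K (translate K (S j) t h') \<in> P (S j)"
    using h' translate_S_kpts[OF j h'] K by (simp_all add: KPt_pts)
  have "cls \<sigma> X i (KPt K (translate K (S i) t h)) = cls \<sigma> X j (KPt K (translate K (S j) t h'))"
    using translate_glued[OF i j] eq unfolding cls_eq_iff[OF i j pts(1)] cls_eq_iff[OF i j pts(2)] .
  then show ?thesis by (simp add: act_def jh)
qed

lemma act_kpts: "\<xi> \<in> avar_kpts \<sigma> X K \<Longrightarrow> act K t \<xi> \<in> avar_kpts \<sigma> X K"
  unfolding avar_kpts_def X_simps using act_cls translate_S_kpts by blast

text \<open>In the base chart both sides are the restriction of the translate of s by t, since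
  translation commutes with restriction.\<close>

lemma act_torus_incl:
  assumes s: "s \<in> kpts \<sigma> (Spec_alg M) K"
  shows "act K t (torus_incl (cls \<sigma> T () (KPt K s))) = torus_incl (cls \<sigma> T () (KPt K (torus_mult K M t s)))"
proof -
  note ts = translate_kpts[OF K M M subset_refl t s]
  have "KPt K s \<in> P M" "KPt K (translate K M t s) \<in> P M" using K s ts by (simp_all add: KPt_pts)
  then have "torus_incl (cls \<sigma> T () (KPt K s)) = cls \<sigma> X base (KPt K (restrict s (kalg (S base))))"
    "torus_incl (cls \<sigma> T () (KPt K (translate K M t s))) = cls \<sigma> X base (KPt K (restrict (translate K M t s) (kalg (S base))))"
    by (simp_all add: torus_incl_cls[OF base])
  moreover have "restrict s (kalg (S base)) \<in> kpts \<sigma> (Spec_alg (S base)) K"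
    by (rule restrict_kpts[OF S[OF base] M S_M[OF base] s])
  ultimately show ?thesis
    using translate_restrict[OF K M M subset_refl t s S[OF base] S_M[OF base]]
    by (simp add: torus_mult_eq act_cls[OF base] translate_def[of _ "S base"])
qed

end

lemma pointed_push: "pointed A \<Longrightarrow> pointed (push \<phi> ` A)"
  unfolding pointed_def semimodule_def
  by (auto simp flip: push_add push_smul intro: image_eqI[of _ _ 0])

lemma action_morphism_X: "action_morphism \<sigma> M X (act :: ('u, 'k) sfext \<Rightarrow> _)"
  unfolding action_morphism_def
proof (intro conjI allI impI ballI)
  show "act K t \<xi> \<in> avar_kpts \<sigma> X K"
    if "sigma_ext \<sigma> K" "t \<in> kpts \<sigma> (Spec_alg M) K" "\<xi> \<in> avar_kpts \<sigma> X K" for K :: "('u, 'k) sfext" and t \<xi>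
    using that by (rule act_kpts)
next
  fix i \<qq> assume "i \<in> idx (X :: ('i, nat, 'k, 'u) avar)"
    and q: "\<qq> \<in> spec \<sigma> (prod_affvar (Spec_alg M) (chart (X :: ('i, nat, 'k, 'u) avar) i))"
  then have i: "i \<in> I" by simp
  \<comment> \<open>The product of M and S i inside the direct sum of the two exponent modules, so
    k[Q] is the tensor product of k[M] and k[S i].\<close>
  define Q :: "(nat + nat) expo set" where "Q = push Inl ` M + push Inr ` S i"
  have prod: "prod_affvar (Spec_alg M) (Spec_alg (S i)) = (Spec_alg Q :: (nat + nat, 'k) affvar)"
    by (auto simp: prod_affvar_def Spec_alg_def Q_def set_plus_def)
  \<comment> \<open>The diagonal; its pushforward is the coaction. It maps S i into Q because S i is
    contained in M.\<close>
  define \<psi> :: "nat expo \<Rightarrow> (nat + nat) expo" where "\<psi> = (\<lambda>v. push Inl v + push Inr v)"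
  have \<psi>_app: "\<psi> v = push Inl v + push Inr v" for v by (simp add: \<psi>_def)
  have psi: "additive_map \<psi>"
    by unfold_locales (simp_all add: \<psi>_def push_add push_smul smul_add_right)
  have Q: "pointed Q" unfolding Q_def using M S[OF i] by (intro pointed_set_plus pointed_push)
  have sub: "\<psi> ` S i \<subseteq> Q" "push Inl ` M \<subseteq> Q" "push Inr ` S i \<subseteq> Q"
    using S_M[OF i] pointed_subset_plus[OF pointed_push[OF M, of Inl] pointed_push[OF S[OF i], of Inr]]
    by (auto simp: \<psi>_def Q_def intro!: set_plus_intro)
  have act_eq: "act K (proj1 (Spec_alg M) h) (cls \<sigma> X i (KPt K (proj2 (Spec_alg (S i)) h)))
      = cls \<sigma> X i (pull_pt \<psi> (S i) (KPt K h))" if Kh: "KPt K h \<in> pts \<sigma> (Spec_alg Q)" for K :: "('u, 'k) sfext" and h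
  proof -
    have K: "sigma_ext \<sigma> K" and h: "h \<in> kpts \<sigma> (Spec_alg Q) K" using Kh by (auto simp: KPt_pts)
    let ?t = "proj1 (Spec_alg M) h" and ?x = "proj2 (Spec_alg (S i)) h"
    have t: "?t \<in> kpts \<sigma> (Spec_alg M) K"
      unfolding proj1_def tens1_def semi_Spec_alg by (rule pull_kpts[OF additive_map_push M Q sub(2) h])
    have x: "?x \<in> kpts \<sigma> (Spec_alg (S i)) K"
      unfolding proj2_def tens2_def semi_Spec_alg by (rule pull_kpts[OF additive_map_push S[OF i] Q sub(3) h])
    \<comment> \<open>Two K-points of Spec k[S i] are compared on characters: h takes the product of
      its two components at v to the product of their values.\<close>
    have "translate K (S i) ?t ?x = (\<lambda>f\<in>kalg (S i). h (push \<psi> f))"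
    proof (rule kpts_eqI[OF S[OF i] K])
      show "translate K (S i) ?t ?x \<in> kpts \<sigma> (Spec_alg (S i)) K" by (rule translate_S_kpts[OF K t i x])
      show "(\<lambda>f\<in>kalg (S i). h (push \<psi> f)) \<in> kpts \<sigma> (Spec_alg (S i)) K"
        by (rule pull_kpts[OF psi S[OF i] Q sub(1) h])
      fix v assume v: "v \<in> S i"
      then have vM: "v \<in> M" using S_M[OF i] by blast
      have "push Inl v \<in> Q" "push Inr v \<in> Q" using sub v vM by auto
      then show "translate K (S i) ?t ?x (chi v) = (\<lambda>f\<in>kalg (S i). h (push \<psi> f)) (chi v)"
        unfolding translate_chi[OF K M S[OF i] S_M[OF i] t x v] using v vM
        by (simp add: proj1_def proj2_def tens1_def tens2_def kalg_chi additive_map.push_chi[OF psi]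
            additive_map.push_chi[OF additive_map_push] kpts_mult[OF h] \<psi>_app chi_add)
    qed
    then show ?thesis by (simp add: act_cls[OF K t i x])
  qed
  show "\<exists>\<beta>\<in>idx X. \<exists>U g. \<qq> \<in> U \<and> open_in_var \<sigma> (prod_affvar (Spec_alg M) (chart (X :: ('i, nat, 'k, 'u) avar) i)) U \<and>
      regular_map \<sigma> (prod_affvar (Spec_alg M) (chart (X :: ('i, nat, 'k, 'u) avar) i)) U
        (chart (X :: ('i, nat, 'k, 'u) avar) \<beta>) (spec \<sigma> (chart (X :: ('i, nat, 'k, 'u) avar) \<beta>)) g \<and>
      (\<forall>(K :: ('u, 'k) sfext) h. KPt K h \<in> pts_over \<sigma> (prod_affvar (Spec_alg M) (chart (X :: ('i, nat, 'k, 'u) avar) i)) U \<longrightarrow>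
        act K (proj1 (Spec_alg M) h) (cls \<sigma> X i (KPt K (proj2 (chart (X :: ('i, nat, 'k, 'u) avar) i) h)))
          = cls \<sigma> X \<beta> (g (KPt K h)))"
    using q i regular_pull_pt[OF psi S[OF i] Q sub(1)] open_spec[OF Q] act_eq unfolding X_simps prod
    by (intro bexI[of _ i] exI[of _ "spec \<sigma> (Spec_alg Q)"] exI[of _ "pull_pt \<psi> (S i)"])
      (simp_all add: pts_over_spec[OF Q])
qed

lemma torus_action_X: "torus_action \<sigma> M X (act :: ('u, 'k) sfext \<Rightarrow> _)"
  unfolding torus_action_def
proof (intro conjI allI impI ballI)
  show "action_morphism \<sigma> M X (act :: ('u, 'k) sfext \<Rightarrow> _)" by (rule action_morphism_X)
next
  fix K :: "('u, 'k) sfext" and \<xi> assume K: "sigma_ext \<sigma> K" and "\<xi> \<in> avar_kpts \<sigma> X K"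
  then obtain i h where i: "i \<in> I" and h: "h \<in> kpts \<sigma> (Spec_alg (S i)) K" and xi: "\<xi> = cls \<sigma> X i (KPt K h)"
    by (auto simp: avar_kpts_def)
  interpret K: field K using K by (rule sigma_ext_field)
  have one: "torus_one K M \<in> kpts \<sigma> (Spec_alg M) K"
    unfolding torus_one_def by (rule kpt_of_map_kpts[OF M K]) (auto simp: ext_sigma_one[OF K])
  show "act K (torus_one K M) \<xi> = \<xi>"
    unfolding xi act_cls[OF K one i h]
    using translate_torus_one[OF K M S[OF i] S_M[OF i] h] by (simp add: torus_one_def)
  fix s t assume s: "s \<in> kpts \<sigma> (Spec_alg M) K" and t: "t \<in> kpts \<sigma> (Spec_alg M) K"
  show "act K (torus_mult K M s t) \<xi> = act K s (act K t \<xi>)"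
    unfolding xi torus_mult_eq act_cls[OF K t i h] act_cls[OF K s i translate_S_kpts[OF K t i h]]
      act_cls[OF K translate_kpts[OF K M M subset_refl s t] i h]
      translate_translate[OF K M S[OF i] S_M[OF i] s t h] ..
qed

lemma toric_variety_X: "toric_variety \<sigma> (X :: ('i, nat, 'k, 'u) avar)"
  unfolding toric_variety_def
proof (intro conjI exI)
  show "\<forall>K. sigma_ext \<sigma> K \<longrightarrow> (\<forall>s\<in>kpts \<sigma> (Spec_alg M) K. \<forall>t\<in>kpts \<sigma> (Spec_alg M) K.
      act K s (torus_incl (cls \<sigma> T () (KPt K t))) =
      (torus_incl (cls \<sigma> T () (KPt K (torus_mult K M s t))) :: ('i \<times> (nat, 'k, 'u) pt) set))"
    using act_torus_incl by blast
qed (rule abstract_variety_X irreducible_X lattice torus_embedding_X torus_action_X)+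

end

theorem theorem6p6:
  fixes \<sigma> :: "'k::field_char_0 \<Rightarrow> 'k"
    and I :: "'i set"
    and S :: "'i \<Rightarrow> nat expo set"
    and u :: "'i \<Rightarrow> 'i \<Rightarrow> nat expo"
    and n :: nat
  assumes "sigma_field \<sigma>"
    and "fan n I S"
    and "\<And>i j. i \<in> I \<Longrightarrow> j \<in> I \<Longrightarrow> i \<noteq> j \<Longrightarrow> fan_pair (S i) (S j) (u i j)"
  shows "toric_variety \<sigma> (fan_variety \<sigma> I S u :: ('i, nat, 'k, 'u) avar)"
proof -
  obtain M where "zx_lattice M" "\<forall>i\<in>I. semi_md (S i) = M"
    using assms(2) unfolding fan_def by (elim conjE exE)
  with assms interpret fan_datum \<sigma> I S u M
    by unfold_locales (auto simp: fan_def)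
  show ?thesis by (rule toric_variety_X)
qed

end
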